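(* If $A\subseteq\omega$ is 1-random, then $A$ is quasiminimal in the cofinite degrees, and hence also in the mod-finite degrees, in the (uniform) generic degrees, and in the (uniform) coarse degrees.
   Context: A real is a subset of $\omega$, identified with its characteristic function. A real $X$ is density-1 if $\lim_{n\to\infty}|X\cap n|/n=1$. "1-random" means Martin-Löf random. A (time-dependent) partial oracle $(A)$ for a real $A$ is a set of triples $\langle n,x,l\rangle$ with $n,l\in\omega$, $x\in\{0,1\}$, such that $\langle n,x,l\rangle\in(A)$ implies $A(n)=x$, and for every $n,x$ there is at most one $l$ with $\langle n,x,l\rangle\in(A)$. Its domain is the set of $n$ for which some $\langle n,x,l\rangle\in(A)$ exists. A Turing functional uses $(A)$ as an ordinary oracle for this set of triples. A generic (respectively cofinite) oracle for $A$ is a partial oracle for $A$ with density-1 (respectively cofinite) domain. A partial computation of $B$ is a (possibly oracle) computation $\psi$ with $\psi(n)=B(n)$ whenever $\psi(n)\downarrow$. Reducibilities between reals (all uniform: one Turing functional $\phi$ must work for all listed oracles): - $B\leq_{\mathrm{g}}A$ (generic): there is $\phi$ such that for every generic oracle $(A)$ for $A$, $\phi^{(A)}$ is a partial computation of $B$ with density-1 domain. - $B\leq_{\mathrm{c}}A$ (coarse): there is $\phi$ such that for every $C$ with $\{n:A(n)=C(n)\}$ density-1, $\phi^C$ is total, $\{0,1\}$-valued, and agrees with $B$ on a density-1 set. - $B\leq_{\mathrm{cf}}A$ (cofinite): there is $\phi$ such that for every cofinite oracle $(A)$ for $A$, $\phi^{(A)}$ is a partial computation of $B$ with cofinite domain.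 - $B\leq_{\mathrm{mf}}A$ (mod-finite): there is $\phi$ such that for every $C$ differing from $A$ at only finitely many places, $\phi^C$ is total and computes a set differing from $B$ at only finitely many places. For $X\subseteq\omega$ let $\mathcal{R}(X)=\{(2m+1)2^n:m\in\omega,\ n\in X\}$ and $\widetilde{\mathcal{R}}(X)=\{m:(\exists n\in X)(2^n\leq m<2^{n+1})\}$. For $\leq$ one of these reducibilities, a real $A$ is quasiminimal in the $\leq$ degrees if $A\nleq 0$ (where $0$ is the degree of the computable reals) and for every noncomputable $B$: $\widetilde{\mathcal{R}}(\mathcal{R}(B))\nleq A$ if $\leq$ is $\leq_{\mathrm{c}}$ or $\leq_{\mathrm{g}}$; $\mathcal{R}(B)\nleq A$ if $\leq$ is $\leq_{\mathrm{mf}}$ or $\leq_{\mathrm{cf}}$. *)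

theory Defs
  imports "HOL-Probability.Probability" "HOL-Library.Nat_Bijection"
begin

text \<open>
  Turing functionals are represented by programs for Kleene's partial recursive functions with
  one additional basic function that queries the oracle. A program does not mention its oracle,
  so one program acts uniformly on all oracles. \<^term>\<open>None\<close> stands for divergence; composition
  is strict, and applying a basic function to too few arguments diverges.
\<close>

datatype prog =
    Zero
  | Succ
  | Proj nat
  | Query
  | Comp prog "prog list"
  | PrimRec prog prog
  | Minimize prog

primrec run :: "nat set \<Rightarrow> prog \<Rightarrow> nat list \<Rightarrow> nat option" where
  "run X Zero xs = Some 0"
| "run X Succ xs = (case xs of [] \<Rightarrow> None | x # _ \<Rightarrow> Some (Suc x))"
| "run X (Proj i) xs = (if i < length xs then Some (xs ! i) else None)"
| "run X Query xs = (case xs of [] \<Rightarrow> None | x # _ \<Rightarrow> Some (of_bool (x \<in> X)))"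
| "run X (Comp f gs) xs = Option.bind (those (map (\<lambda>g. run X g xs) gs)) (run X f)"
| "run X (PrimRec f g) xs =
     (case xs of
        [] \<Rightarrow> None
      | n # ys \<Rightarrow> rec_nat (run X f ys) (\<lambda>k r. Option.bind r (\<lambda>v. run X g (k # v # ys))) n)"
| "run X (Minimize f) xs =
     (let P = (\<lambda>y. run X f (y # xs) = Some 0 \<and> (\<forall>z<y. \<exists>v. run X f (z # xs) = Some (Suc v)))
      in if \<exists>y. P y then Some (THE y. P y) else None)"

definition computable :: "nat set \<Rightarrow> bool" where
  "computable B \<longleftrightarrow> (\<exists>p. \<forall>n. run {} p [n] = Some (of_bool (n \<in> B)))"


text \<open>
  Martin-Loef randomness for the fair-coin measure on Cantor space. Finite binary strings are coded
  by natural numbers, and a c.e. set of strings is given as the domain of a partial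
  computable function.
\<close>

definition cantor_measure :: "(nat \<Rightarrow> bool) measure" where
  "cantor_measure = (\<Pi>\<^sub>M i\<in>UNIV. measure_pmf (bernoulli_pmf (1/2)))"

definition cylinder :: "bool list \<Rightarrow> (nat \<Rightarrow> bool) set" where
  "cylinder \<sigma> = {f. \<forall>i<length \<sigma>. f i = \<sigma> ! i}"

definition string_code :: "bool list \<Rightarrow> nat" where
  "string_code \<sigma> = list_encode (map of_bool \<sigma>)"

definition ce_open :: "prog \<Rightarrow> nat \<Rightarrow> (nat \<Rightarrow> bool) set" where
  "ce_open p k = (\<Union>\<sigma>\<in>{\<sigma>. run {} p [k, string_code \<sigma>] \<noteq> None}. cylinder \<sigma>)"

definition ml_test :: "prog \<Rightarrow> bool" where
  "ml_test p \<longleftrightarrow> (\<forall>k. measure cantor_measure (ce_open p k) \<le> (1/2) ^ k)"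

definition ml_random :: "nat set \<Rightarrow> bool" where
  "ml_random A \<longleftrightarrow> (\<forall>p. ml_test p \<longrightarrow> (\<lambda>n. n \<in> A) \<notin> (\<Inter>k. ce_open p k))"

text \<open>The value of \<^const>\<open>measure\<close> in \<^const>\<open>ml_test\<close> is meaningful because of the following fact.\<close>

lemma ce_open_in_sets [measurable]: "ce_open p k \<in> sets cantor_measure"
proof -
  have cyl: "cylinder \<sigma> \<in> sets cantor_measure" for \<sigma>
  proof -
    have sp: "space cantor_measure = UNIV"
      by (simp add: cantor_measure_def space_PiM)
    have "{f \<in> space cantor_measure. \<forall>i\<in>{..<length \<sigma>}. f i = \<sigma> ! i} \<in> sets cantor_measure"
    proof (rule sets.sets_Collect_finite_All)
      fix i
      have "(\<lambda>f. f i) \<in> measurable cantor_measure (measure_pmf (bernoulli_pmf (1/2)))"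
        unfolding cantor_measure_def by (rule measurable_component_singleton) simp
      then have "(\<lambda>f. f i) -` {\<sigma> ! i} \<inter> space cantor_measure \<in> sets cantor_measure"
        by (rule measurable_sets) simp
      moreover have "(\<lambda>f. f i) -` {\<sigma> ! i} \<inter> space cantor_measure =
          {f \<in> space cantor_measure. f i = \<sigma> ! i}"
        by auto
      ultimately show "{f \<in> space cantor_measure. f i = \<sigma> ! i} \<in> sets cantor_measure"
        by simp
    qed simp
    then show ?thesis by (simp add: cylinder_def sp Ball_def)
  qed
  show ?thesis
    unfolding ce_open_def by (rule sets.countable_UN') (auto intro: cyl)
qed


definition density1 :: "nat set \<Rightarrow> bool" where
  "density1 X \<longleftrightarrow> (\<lambda>n. real (card (X \<inter> {..<n})) / real n) \<longlonglongrightarrow> 1"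


type_synonym partial_oracle = "(nat \<times> bool \<times> nat) set"

definition partial_oracle_for :: "nat set \<Rightarrow> partial_oracle \<Rightarrow> bool" where
  "partial_oracle_for A P \<longleftrightarrow>
     (\<forall>n x l. (n, x, l) \<in> P \<longrightarrow> (n \<in> A) = x) \<and>
     (\<forall>n x l l'. (n, x, l) \<in> P \<longrightarrow> (n, x, l') \<in> P \<longrightarrow> l = l')"

definition oracle_dom :: "partial_oracle \<Rightarrow> nat set" where
  "oracle_dom P = {n. \<exists>x l. (n, x, l) \<in> P}"

definition oracle_code :: "partial_oracle \<Rightarrow> nat set" where
  "oracle_code P = (\<lambda>(n, x, l). prod_encode (n, prod_encode (of_bool x, l))) ` P"

definition generic_oracle :: "nat set \<Rightarrow> partial_oracle \<Rightarrow> bool" where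
  "generic_oracle A P \<longleftrightarrow> partial_oracle_for A P \<and> density1 (oracle_dom P)"

definition cofinite_oracle :: "nat set \<Rightarrow> partial_oracle \<Rightarrow> bool" where
  "cofinite_oracle A P \<longleftrightarrow> partial_oracle_for A P \<and> finite (- oracle_dom P)"


definition comp_dom :: "nat set \<Rightarrow> prog \<Rightarrow> nat set" where
  "comp_dom X p = {n. run X p [n] \<noteq> None}"

definition partial_computation :: "nat set \<Rightarrow> prog \<Rightarrow> nat set \<Rightarrow> bool" where
  "partial_computation X p B \<longleftrightarrow> (\<forall>n\<in>comp_dom X p. run X p [n] = Some (of_bool (n \<in> B)))"

definition computes_real :: "nat set \<Rightarrow> prog \<Rightarrow> nat set \<Rightarrow> bool" where
  "computes_real X p D \<longleftrightarrow> (\<forall>n. run X p [n] = Some (of_bool (n \<in> D)))"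

text \<open>In all four relations \<open>B\<close> is the real that is reduced and \<open>A\<close> is the oracle.\<close>

definition generic_le :: "nat set \<Rightarrow> nat set \<Rightarrow> bool" where
  "generic_le B A \<longleftrightarrow> (\<exists>p. \<forall>P. generic_oracle A P \<longrightarrow>
     partial_computation (oracle_code P) p B \<and> density1 (comp_dom (oracle_code P) p))"

definition coarse_le :: "nat set \<Rightarrow> nat set \<Rightarrow> bool" where
  "coarse_le B A \<longleftrightarrow> (\<exists>p. \<forall>C. density1 {n. n \<in> A \<longleftrightarrow> n \<in> C} \<longrightarrow>
     (\<exists>D. computes_real C p D \<and> density1 {n. n \<in> B \<longleftrightarrow> n \<in> D}))"

definition cofinite_le :: "nat set \<Rightarrow> nat set \<Rightarrow> bool" where
  "cofinite_le B A \<longleftrightarrow> (\<exists>p. \<forall>P. cofinite_oracle A P \<longrightarrow>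
     partial_computation (oracle_code P) p B \<and> finite (- comp_dom (oracle_code P) p))"

definition mod_finite_le :: "nat set \<Rightarrow> nat set \<Rightarrow> bool" where
  "mod_finite_le B A \<longleftrightarrow> (\<exists>p. \<forall>C. finite {n. (n \<in> A) \<noteq> (n \<in> C)} \<longrightarrow>
     (\<exists>D. computes_real C p D \<and> finite {n. (n \<in> B) \<noteq> (n \<in> D)}))"


definition column_code :: "nat set \<Rightarrow> nat set" where
  "column_code X = {(2 * m + 1) * 2 ^ n | m n. n \<in> X}"

definition interval_code :: "nat set \<Rightarrow> nat set" where
  "interval_code X = {m. \<exists>n\<in>X. 2 ^ n \<le> m \<and> m < 2 ^ (n + 1)}"

datatype reducibility = Generic | Coarse | Cofinite | Mod_Finite

fun red_le :: "reducibility \<Rightarrow> nat set \<Rightarrow> nat set \<Rightarrow> bool" where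
  "red_le Generic = generic_le"
| "red_le Coarse = coarse_le"
| "red_le Cofinite = cofinite_le"
| "red_le Mod_Finite = mod_finite_le"

fun turing_embed :: "reducibility \<Rightarrow> nat set \<Rightarrow> nat set" where
  "turing_embed Generic B = interval_code (column_code B)"
| "turing_embed Coarse B = interval_code (column_code B)"
| "turing_embed Cofinite B = column_code B"
| "turing_embed Mod_Finite B = column_code B"

text \<open>
  The degree \<open>0\<close> contains every computable real, so \<open>A \<nleq> 0\<close> is expressed as: \<open>A\<close> is not
  reducible to any computable real.
\<close>

definition quasiminimal :: "reducibility \<Rightarrow> nat set \<Rightarrow> bool" where
  "quasiminimal r A \<longleftrightarrow>
     (\<forall>Z. computable Z \<longrightarrow> \<not> red_le r A Z) \<and>
     (\<forall>B. \<not> computable B \<longrightarrow> \<not> red_le r (turing_embed r B) A)"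

end

theory Submission
  imports Defs
begin

text \<open>
  Suppose the coded version of \<open>B\<close> is reducible to a random \<open>A\<close>. The same functional then works for
  every finite modification of \<open>A\<close>. So for each \<open>n\<close>, and for \<open>i\<close> the value of \<open>B\<close> at \<open>n\<close>, the real \<open>A\<close>
  lies in all sets of a decreasing sequence \<open>U k\<close> of effectively open sets, where \<open>U k\<close> says that the
  functional finds the answer \<open>i\<close> however the first \<open>k\<close> bits are changed, and thus depends only on the
  bits from position \<open>k\<close> on. If \<open>U 0\<close> had measure \<open>q < 1\<close>, then waiting for a prefix to enter
  \<open>U 0\<close>, then for a longer one to enter \<open>U k\<close> with \<open>k\<close> the length of the first, and so on, would by
  independence define tests of measure at most \<open>q ^ m\<close> capturing \<open>A\<close>. Hence \<open>U 0\<close> has measure \<open>1\<close>.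
  A search for an answer \<open>i\<close> whose set has measure greater than \<open>1 - 2 ^ - (n + 2)\<close> therefore
  terminates, and it is right for all but finitely many \<open>n\<close>, since otherwise the complements of these
  sets would form a test capturing \<open>A\<close>. So \<open>B\<close> is computable.

  If \<open>A\<close> were reducible to a computable real, then some effective sequence of predictions for bits of
  \<open>A\<close> would be right at least seven times in eight from some point on, which has exponentially
  small probability.
\<close>

section \<open>Total computable functions\<close>


text \<open>The intersection of the sets \<open>U k\<close> is invariant under finite changes, so
  the zero-one law gives it measure 0 or 1. This does not suffice: it is only a countable
  intersection of effectively open sets, whose measures may decrease to 0 without a computable rate,
  and a 1-random real can lie in a null set of that kind. The successive waiting supplies the
  missing rate. It needs each new condition to be independent of the prefix already read, which is
  why \<open>U 0\<close> is replaced by \<open>U k\<close> after \<open>k\<close> bits. Finite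
  modifications are the changes that all four reducibilities tolerate. The codings make answers
  survive them: each bit of \<open>B\<close> has infinitely many places, so finitely many faults do
  no harm, and in the density-1 cases each place is a whole dyadic interval.\<close>

definition recfn :: "nat \<Rightarrow> (nat list \<Rightarrow> nat) \<Rightarrow> bool" where
  "recfn k F \<longleftrightarrow> (\<exists>p. \<forall>xs. length xs = k \<longrightarrow> run {} p xs = Some (F xs))"

definition recpred :: "nat \<Rightarrow> (nat list \<Rightarrow> bool) \<Rightarrow> bool" where
  "recpred k P \<longleftrightarrow> recfn k (\<lambda>xs. of_bool (P xs))"

lemma recfn_of_bool: "recpred k P \<Longrightarrow> recfn k (\<lambda>xs. of_bool (P xs))"
  by (simp add: recpred_def)

lemma recfn_cong: "(\<And>xs. length xs = k \<Longrightarrow> F xs = G xs) \<Longrightarrow> recfn k F \<longleftrightarrow> recfn k G"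
  by (auto simp: recfn_def)

lemma those_map_Some: "those (map (\<lambda>x. Some (f x)) xs) = Some (map f xs)"
  by (induction xs) auto

lemma recfn_comp:
  assumes "recfn (length Gs) F" and "\<And>G. G \<in> set Gs \<Longrightarrow> recfn k G"
  shows "recfn k (\<lambda>xs. F (map (\<lambda>G. G xs) Gs))"
proof -
  obtain P where P: "\<And>xs. length xs = length Gs \<Longrightarrow> run {} P xs = Some (F xs)"
    using assms(1) by (auto simp: recfn_def)
  have "\<forall>G\<in>set Gs. \<exists>p. \<forall>xs. length xs = k \<longrightarrow> run {} p xs = Some (G xs)"
    using assms(2) by (auto simp: recfn_def)
  then obtain pg where pg: "\<And>G xs. G \<in> set Gs \<Longrightarrow> length xs = k \<Longrightarrow> run {} (pg G) xs = Some (G xs)"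
    by metis
  have "run {} (Comp P (map pg Gs)) xs = Some (F (map (\<lambda>G. G xs) Gs))" if "length xs = k" for xs
  proof -
    have "map (\<lambda>g. run {} g xs) (map pg Gs) = map (\<lambda>G. Some (G xs)) Gs"
      using pg that by auto
    then show ?thesis by (simp add: those_map_Some P del: map_map)
  qed
  then show ?thesis unfolding recfn_def by blast
qed

lemma recfn_nth: "i < k \<Longrightarrow> recfn k (\<lambda>xs. xs ! i)"
  unfolding recfn_def by (rule exI[of _ "Proj i"]) simp

lemma recfn_Cons_nth:
  "recfn k a \<Longrightarrow> (\<And>j. i = Suc j \<Longrightarrow> recfn k (\<lambda>xs. b xs ! j)) \<Longrightarrow> recfn k (\<lambda>xs. (a xs # b xs) ! i)"
  by (cases i) auto

text \<open>Composition with an argument list built by one function. It lets arguments be inserted,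
  dropped or appended when their number is a variable, as in the induction over programs
  below.\<close>

lemma recfn_subst:
  assumes "recfn k F" and "\<And>i. i < k \<Longrightarrow> recfn l (\<lambda>ys. h ys ! i)"
    and "\<And>ys. length ys = l \<Longrightarrow> length (h ys) = k"
  shows "recfn l (\<lambda>ys. F (h ys))"
proof -
  have "recfn l (\<lambda>ys. F (map (\<lambda>G. G ys) (map (\<lambda>i ys. h ys ! i) [0..<k])))"
    by (rule recfn_comp) (use assms in auto)
  moreover have "map (\<lambda>G. G ys) (map (\<lambda>i ys. h ys ! i) [0..<k]) = h ys" if "length ys = l" for ys
    using assms(3)[OF that] by (auto intro: nth_equalityI)
  ultimately show ?thesis by (subst (asm) recfn_cong[where G = "\<lambda>ys. F (h ys)"]) auto
qed

lemma recfn_tl: "recfn k F \<Longrightarrow> recfn (Suc k) (\<lambda>xs. F (tl xs))"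
  by (rule recfn_subst[of k F]) (auto simp: nth_tl recfn_def intro!: exI[of _ "Proj (Suc _)"])

lemma recfn_comp1:
  assumes "recfn 1 (\<lambda>xs. f (xs ! 0))" "recfn k a"
  shows "recfn k (\<lambda>xs. f (a xs))"
  using recfn_comp[of "[a]" "\<lambda>xs. f (xs ! 0)" k] assms by simp

lemma recfn_comp2:
  assumes "recfn 2 (\<lambda>xs. f (xs ! 0) (xs ! 1))" "recfn k a" "recfn k b"
  shows "recfn k (\<lambda>xs. f (a xs) (b xs))"
proof -
  have "recfn k (\<lambda>xs. (\<lambda>xs. f (xs ! 0) (xs ! 1)) (map (\<lambda>G. G xs) [a, b]))"
    by (rule recfn_comp) (use assms in \<open>auto simp: eval_nat_numeral\<close>)
  then show ?thesis by (simp add: eval_nat_numeral)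
qed

lemma recfn_comp3:
  assumes "recfn 3 (\<lambda>xs. f (xs ! 0) (xs ! 1) (xs ! 2))" "recfn k a" "recfn k b" "recfn k c"
  shows "recfn k (\<lambda>xs. f (a xs) (b xs) (c xs))"
proof -
  have "recfn k (\<lambda>xs. (\<lambda>xs. f (xs ! 0) (xs ! 1) (xs ! 2)) (map (\<lambda>G. G xs) [a, b, c]))"
    by (rule recfn_comp) (use assms in \<open>auto simp: eval_nat_numeral\<close>)
  then show ?thesis by (simp add: eval_nat_numeral)
qed

lemma recfn_comp4:
  assumes "recfn 4 (\<lambda>xs. f (xs ! 0) (xs ! 1) (xs ! 2) (xs ! 3))" "recfn k a" "recfn k b" "recfn k c" "recfn k d"
  shows "recfn k (\<lambda>xs. f (a xs) (b xs) (c xs) (d xs))"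
proof -
  have "recfn k (\<lambda>xs. (\<lambda>xs. f (xs ! 0) (xs ! 1) (xs ! 2) (xs ! 3)) (map (\<lambda>G. G xs) [a, b, c, d]))"
    by (rule recfn_comp) (use assms in \<open>auto simp: eval_nat_numeral\<close>)
  then show ?thesis by (simp add: eval_nat_numeral)
qed

lemma recfn_comp5:
  assumes "recfn 5 (\<lambda>xs. f (xs ! 0) (xs ! 1) (xs ! 2) (xs ! 3) (xs ! 4))" "recfn k a" "recfn k b" "recfn k c" "recfn k d" "recfn k e"
  shows "recfn k (\<lambda>xs. f (a xs) (b xs) (c xs) (d xs) (e xs))"
proof -
  have "recfn k (\<lambda>xs. (\<lambda>xs. f (xs ! 0) (xs ! 1) (xs ! 2) (xs ! 3) (xs ! 4)) (map (\<lambda>G. G xs) [a, b, c, d, e]))"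
    by (rule recfn_comp) (use assms in \<open>auto simp: eval_nat_numeral\<close>)
  then show ?thesis by (simp add: eval_nat_numeral)
qed

lemma recfn_Suc: "recfn k a \<Longrightarrow> recfn k (\<lambda>xs. Suc (a xs))"
  by (rule recfn_comp1[of Suc])
    (auto simp: recfn_def length_Suc_conv intro!: exI[of _ Succ])

lemma recfn_const: "recfn k (\<lambda>xs. c)"
proof (induction c)
  case 0
  show ?case unfolding recfn_def by (rule exI[of _ Zero]) simp
qed (rule recfn_Suc)

text \<open>
  In rules for operators that bind a variable, \<open>ys ! 0\<close> is the bound variable and \<open>tl ys\<close> the
  argument list of the surrounding function.
\<close>

lemma recfn_rec_nat:
  assumes n: "recfn k n" and a: "recfn k a"
    and g: "recfn (Suc (Suc k)) (\<lambda>ys. g (ys ! 0) (ys ! 1) (tl (tl ys)))"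
  shows "recfn k (\<lambda>xs. rec_nat (a xs) (\<lambda>i r. g i r xs) (n xs))"
proof -
  obtain pa where pa: "\<And>xs. length xs = k \<Longrightarrow> run {} pa xs = Some (a xs)"
    using a by (auto simp: recfn_def)
  obtain pg where pg: "\<And>i r xs. length xs = k \<Longrightarrow> run {} pg (i # r # xs) = Some (g i r xs)"
    using g unfolding recfn_def by (metis length_Cons list.sel(3) nth_Cons_0 nth_Cons_Suc One_nat_def)
  have "run {} (PrimRec pa pg) (m # xs) = Some (rec_nat (a xs) (\<lambda>i r. g i r xs) m)"
    if "length xs = k" for m xs
    using that by (induction m) (auto simp: pa pg)
  then have "recfn (Suc k) (\<lambda>ys. rec_nat (a (tl ys)) (\<lambda>i r. g i r (tl ys)) (hd ys))"
    unfolding recfn_def by (intro exI[of _ "PrimRec pa pg"]) (auto simp: length_Suc_conv)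
  then have "recfn k (\<lambda>xs. rec_nat (a (tl (n xs # xs))) (\<lambda>i r. g i r (tl (n xs # xs))) (hd (n xs # xs)))"
    by (rule recfn_subst) (auto intro!: recfn_Cons_nth n recfn_nth)
  then show ?thesis by simp
qed

lemma recfn_tl_nth: "Suc i < k \<Longrightarrow> recfn k (\<lambda>xs. tl xs ! i)"
  using recfn_nth[of "Suc i" k] by (subst recfn_cong) (auto simp: nth_tl)

lemma recfn_tl2_nth: "Suc (Suc i) < k \<Longrightarrow> recfn k (\<lambda>xs. tl (tl xs) ! i)"
  using recfn_nth[of "Suc (Suc i)" k] by (subst recfn_cong) (auto simp: nth_tl)

lemma recfn_tl3_nth: "Suc (Suc (Suc i)) < k \<Longrightarrow> recfn k (\<lambda>xs. tl (tl (tl xs)) ! i)"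
  using recfn_nth[of "Suc (Suc (Suc i))" k] by (subst recfn_cong) (auto simp: nth_tl)

lemmas recfn_var = recfn_nth recfn_tl_nth recfn_tl2_nth recfn_tl3_nth

lemma recfn_add: "recfn k a \<Longrightarrow> recfn k b \<Longrightarrow> recfn k (\<lambda>xs. a xs + b xs)"
proof (rule recfn_comp2[of "(+)"])
  have "recfn 2 (\<lambda>xs. rec_nat (xs ! 0) (\<lambda>i r. Suc r) (xs ! 1))"
    by (intro recfn_rec_nat recfn_Suc recfn_var) auto
  moreover have "rec_nat x (\<lambda>i r. Suc r) y = x + y" for x y :: nat by (induction y) auto
  ultimately show "recfn 2 (\<lambda>xs. xs ! 0 + xs ! 1)" by simp
qed

lemma recfn_sum:
  assumes "recfn k b" "recfn (Suc k) (\<lambda>ys. f (ys ! 0) (tl ys))"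
  shows "recfn k (\<lambda>xs. \<Sum>i<b xs. f i xs)"
proof -
  \<comment> \<open>The step function of a recursion also receives the accumulated value; it is
    dropped before \<open>f\<close> is applied.\<close>
  have "recfn (Suc (Suc k)) (\<lambda>ys. f ((ys ! 0 # tl (tl ys)) ! 0) (tl (ys ! 0 # tl (tl ys))))"
    by (rule recfn_subst[OF assms(2)]) (auto intro!: recfn_Cons_nth recfn_var)
  then have "recfn k (\<lambda>xs. rec_nat 0 (\<lambda>i r. r + f i xs) (b xs))"
    by (intro recfn_rec_nat assms(1) recfn_add recfn_const recfn_var) auto
  moreover have "rec_nat 0 (\<lambda>i r. r + h i) m = (\<Sum>i<m. h i)" for h :: "nat \<Rightarrow> nat" and m
    by (induction m) auto
  ultimately show ?thesis by simp
qed

lemma recfn_mult: "recfn k a \<Longrightarrow> recfn k b \<Longrightarrow> recfn k (\<lambda>xs. a xs * b xs)"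
proof (rule recfn_comp2[of "(*)"])
  have "recfn 2 (\<lambda>xs. \<Sum>i<xs ! 0. xs ! 1)"
    by (intro recfn_sum recfn_var) auto
  then show "recfn 2 (\<lambda>xs. xs ! 0 * xs ! 1)" by simp
qed

lemma recfn_power: "recfn k a \<Longrightarrow> recfn k b \<Longrightarrow> recfn k (\<lambda>xs. a xs ^ b xs)"
proof (rule recfn_comp2[of "(^)"])
  have "recfn 2 (\<lambda>xs. rec_nat 1 (\<lambda>i r. xs ! 0 * r) (xs ! 1))"
    by (intro recfn_rec_nat recfn_mult recfn_const recfn_var) auto
  moreover have "rec_nat 1 (\<lambda>i r. x * r) y = x ^ y" for x y :: nat by (induction y) auto
  ultimately show "recfn 2 (\<lambda>xs. (xs ! 0) ^ (xs ! 1))" by simp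
qed

lemma recfn_diff: "recfn k a \<Longrightarrow> recfn k b \<Longrightarrow> recfn k (\<lambda>xs. a xs - b xs)"
proof (rule recfn_comp2[of "(-)"])
  \<comment> \<open>Predecessor: the recursion returns its counter and forgets the accumulated
    value.\<close>
  have "recfn 1 (\<lambda>xs. rec_nat 0 (\<lambda>i r. i) (xs ! 0))"
    by (intro recfn_rec_nat recfn_const recfn_var) auto
  moreover have "rec_nat 0 (\<lambda>i r. i) x = x - 1" for x :: nat by (cases x) auto
  ultimately have pred: "recfn 1 (\<lambda>xs. xs ! 0 - 1)" by simp
  have "recfn 2 (\<lambda>xs. rec_nat (xs ! 0) (\<lambda>i r. r - 1) (xs ! 1))"
    by (intro recfn_rec_nat recfn_var recfn_comp1[OF pred]) auto
  moreover have "rec_nat x (\<lambda>i r. r - 1) y = x - y" for x y :: nat by (induction y) auto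
  ultimately show "recfn 2 (\<lambda>xs. xs ! 0 - xs ! 1)" by simp
qed

section \<open>Decidable predicates and bounded quantifiers\<close>

lemma recpred_not: "recpred k P \<Longrightarrow> recpred k (\<lambda>xs. \<not> P xs)"
proof -
  assume "recpred k P"
  then have "recfn k (\<lambda>xs. 1 - of_bool (P xs))" by (intro recfn_diff recfn_const recfn_of_bool)
  moreover have "1 - of_bool b = (of_bool (\<not> b) :: nat)" for b by (cases b) auto
  ultimately show ?thesis by (simp only: recpred_def)
qed

lemma recpred_le:
  assumes "recfn k a" "recfn k b"
  shows "recpred k (\<lambda>xs. a xs \<le> b xs)"
proof -
  have "recfn k (\<lambda>xs. 1 - (a xs - b xs))" using assms by (intro recfn_diff recfn_const)
  then show ?thesis unfolding recpred_def by (subst recfn_cong) auto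
qed

lemma recpred_less: "recfn k a \<Longrightarrow> recfn k b \<Longrightarrow> recpred k (\<lambda>xs. a xs < b xs)"
  unfolding not_le[symmetric] by (intro recpred_not recpred_le)

lemma recpred_conj: "recpred k P \<Longrightarrow> recpred k Q \<Longrightarrow> recpred k (\<lambda>xs. P xs \<and> Q xs)"
  unfolding recpred_def of_bool_conj by (rule recfn_mult)

lemma disj_not_conj: "P \<or> Q \<longleftrightarrow> \<not> (\<not> P \<and> \<not> Q)"
  by blast

lemma recpred_disj: "recpred k P \<Longrightarrow> recpred k Q \<Longrightarrow> recpred k (\<lambda>xs. P xs \<or> Q xs)"
  unfolding disj_not_conj by (intro recpred_not recpred_conj)

lemma recpred_imp: "recpred k P \<Longrightarrow> recpred k Q \<Longrightarrow> recpred k (\<lambda>xs. P xs \<longrightarrow> Q xs)"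
  unfolding imp_conv_disj by (intro recpred_not recpred_disj)

lemma recpred_iff: "recpred k P \<Longrightarrow> recpred k Q \<Longrightarrow> recpred k (\<lambda>xs. P xs \<longleftrightarrow> Q xs)"
  unfolding iff_conv_conj_imp by (intro recpred_conj recpred_imp)

lemma recpred_eq: "recfn k a \<Longrightarrow> recfn k b \<Longrightarrow> recpred k (\<lambda>xs. a xs = b xs)"
  unfolding order_eq_iff by (intro recpred_conj recpred_le)

lemma recfn_if: "recpred k P \<Longrightarrow> recfn k a \<Longrightarrow> recfn k b \<Longrightarrow> recfn k (\<lambda>xs. if P xs then a xs else b xs)"
proof -
  assume *: "recpred k P" "recfn k a" "recfn k b"
  then have "recfn k (\<lambda>xs. of_bool (P xs) * a xs + of_bool (\<not> P xs) * b xs)"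
    by (intro recfn_add recfn_mult recpred_not recfn_of_bool)
  then show ?thesis by (subst recfn_cong) auto
qed

lemma recpred_ex_less:
  assumes "recfn k b" "recpred (Suc k) (\<lambda>ys. P (ys ! 0) (tl ys))"
  shows "recpred k (\<lambda>xs. \<exists>i<b xs. P i xs)"
proof -
  have "recpred k (\<lambda>xs. 0 < (\<Sum>i<b xs. of_bool (P i xs) :: nat))"
    by (intro recpred_less recfn_const recfn_sum recfn_of_bool assms)
  moreover have "0 < (\<Sum>i<b xs. of_bool (P i xs) :: nat) \<longleftrightarrow> (\<exists>i<b xs. P i xs)" for xs
    by (subst zero_less_iff_neq_zero) (auto simp: sum_eq_0_iff)
  ultimately show ?thesis by simp
qed

lemma recpred_all_less:
  assumes "recfn k b" "recpred (Suc k) (\<lambda>ys. P (ys ! 0) (tl ys))"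
  shows "recpred k (\<lambda>xs. \<forall>i<b xs. P i xs)"
proof -
  have "recpred k (\<lambda>xs. \<not> (\<exists>i<b xs. \<not> P i xs))" by (intro recpred_not recpred_ex_less assms)
  then show ?thesis by simp
qed

lemma recfn_card_less:
  assumes "recfn k b" "recpred (Suc k) (\<lambda>ys. P (ys ! 0) (tl ys))"
  shows "recfn k (\<lambda>xs. card {i. i < b xs \<and> P i xs})"
proof -
  have "recfn k (\<lambda>xs. \<Sum>i<b xs. of_bool (P i xs))"
    by (intro recfn_sum recfn_of_bool assms)
  moreover have "(\<Sum>i<b xs. of_bool (P i xs)) = card {i. i < b xs \<and> P i xs}" for xs
    by (simp add: lessThan_def Collect_conj_eq)
  ultimately show ?thesis by simp
qed

lemma recfn_div: "recfn k a \<Longrightarrow> recfn k b \<Longrightarrow> recfn k (\<lambda>xs. a xs div b xs)"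
proof (rule recfn_comp2[of "(div)"])
  \<comment> \<open>The quotient is the number of positive multiples of the divisor up to the
    dividend. The condition \<open>0 < xs ! 1\<close> gives the value 0 for division by 0.\<close>
  have "recfn 2 (\<lambda>xs. card {i. i < xs ! 0 \<and> 0 < xs ! 1 \<and> Suc i * xs ! 1 \<le> xs ! 0})"
    by (intro recfn_card_less recpred_conj recpred_less recpred_le recfn_const recfn_mult recfn_Suc recfn_var) auto
  moreover have "card {i. i < x \<and> 0 < y \<and> Suc i * y \<le> x} = x div y" for x y :: nat
  proof (cases "y = 0")
    case False
    then have "{i. i < x \<and> 0 < y \<and> Suc i * y \<le> x} = {..<x div y}"
      by (auto simp: less_eq_div_iff_mult_less_eq[symmetric] Suc_le_eq
          intro: less_le_trans[OF _ div_le_dividend] simp del: mult_Suc)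
    then show ?thesis by simp
  qed auto
  ultimately show "recfn 2 (\<lambda>xs. xs ! 0 div xs ! 1)" by simp
qed

lemma recfn_mod: "recfn k a \<Longrightarrow> recfn k b \<Longrightarrow> recfn k (\<lambda>xs. a xs mod b xs)"
  unfolding minus_div_mult_eq_mod[symmetric] by (intro recfn_diff recfn_mult recfn_div)

lemmas recfn_intros = recfn_var recpred_not recpred_le recpred_less recpred_eq recpred_conj
  recpred_disj recpred_imp recpred_iff recpred_ex_less recpred_all_less recfn_card_less recfn_if recfn_sum
  recfn_add recfn_mult recfn_power recfn_diff recfn_div recfn_mod recfn_Suc recfn_of_bool recfn_const

section \<open>Bits, pairs and unbounded search\<close>

lemma recpred_bit: "recfn k a \<Longrightarrow> recfn k b \<Longrightarrow> recpred k (\<lambda>xs. bit (a xs) (b xs))"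
  unfolding bit_iff_odd odd_iff_mod_2_eq_one by (intro recfn_intros)

lemma recfn_take_bit: "recfn k a \<Longrightarrow> recfn k b \<Longrightarrow> recfn k (\<lambda>xs. take_bit (a xs) (b xs))"
  unfolding take_bit_eq_mod by (intro recfn_intros)

lemma recfn_prod_encode: "recfn k a \<Longrightarrow> recfn k b \<Longrightarrow> recfn k (\<lambda>xs. prod_encode (a xs, b xs))"
  unfolding prod_encode_def triangle_def by simp (intro recfn_intros)

lemma sum_delta_conj:
  assumes "finite S" "x \<in> S" shows "(\<Sum>a\<in>S. of_bool (a = x \<and> P) * f a) = of_bool P * (f x :: nat)"
proof -
  have "(\<Sum>a\<in>S. of_bool (a = x \<and> P) * f a) = (\<Sum>a\<in>S. if a = x then of_bool P * f x else 0)"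
    by (intro sum.cong) auto
  then show ?thesis using assms by simp
qed

text \<open>Neither component of a pair exceeds its code, so decoding is a finite sum over a square
  in which a single pair contributes.\<close>

lemma recfn_fst_prod_decode: "recfn k a \<Longrightarrow> recfn k (\<lambda>xs. fst (prod_decode (a xs)))"
proof (rule recfn_comp1[of "\<lambda>z. fst (prod_decode z)"])
  have "recfn 1 (\<lambda>xs. \<Sum>a<Suc (xs ! 0). \<Sum>b<Suc (xs ! 0). of_bool (prod_encode (a, b) = xs ! 0) * a)"
    by (intro recfn_intros recfn_prod_encode) auto
  moreover have "(\<Sum>a<Suc z. \<Sum>b<Suc z. of_bool (prod_encode (a, b) = z) * a) = fst (prod_decode z)" for z
  proof -
    obtain a0 b0 where z: "z = prod_encode (a0, b0)" by (metis prod.collapse prod_decode_inverse)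
    have le: "a0 < Suc z" "b0 < Suc z" unfolding z using le_prod_encode_1 le_prod_encode_2 by (auto simp: less_Suc_eq_le)
    have "(\<Sum>a<Suc z. \<Sum>b<Suc z. of_bool (prod_encode (a, b) = z) * a)
      = (\<Sum>a<Suc z. \<Sum>b<Suc z. of_bool (a = a0 \<and> b = b0) * a)"
      by (simp add: z)
    also have "\<dots> = (\<Sum>a<Suc z. of_bool (a = a0) * a)"
      using le by (intro sum.cong refl) (subst conj_commute, subst sum_delta_conj, auto)
    also have "\<dots> = a0" using sum_delta_conj[of "{..<Suc z}" a0 True "\<lambda>a. a"] le by simp
    finally show ?thesis by (simp add: z)
  qed
  ultimately show "recfn 1 (\<lambda>xs. fst (prod_decode (xs ! 0)))" by simp
qed

lemma recfn_snd_prod_decode: "recfn k a \<Longrightarrow> recfn k (\<lambda>xs. snd (prod_decode (a xs)))"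
proof (rule recfn_comp1[of "\<lambda>z. snd (prod_decode z)"])
  have "recfn 1 (\<lambda>xs. \<Sum>a<Suc (xs ! 0). \<Sum>b<Suc (xs ! 0). of_bool (prod_encode (a, b) = xs ! 0) * b)"
    by (intro recfn_intros recfn_prod_encode) auto
  moreover have "(\<Sum>a<Suc z. \<Sum>b<Suc z. of_bool (prod_encode (a, b) = z) * b) = snd (prod_decode z)" for z
  proof -
    obtain a0 b0 where z: "z = prod_encode (a0, b0)" by (metis prod.collapse prod_decode_inverse)
    have le: "a0 < Suc z" "b0 < Suc z" unfolding z using le_prod_encode_1 le_prod_encode_2 by (auto simp: less_Suc_eq_le)
    have "(\<Sum>a<Suc z. \<Sum>b<Suc z. of_bool (prod_encode (a, b) = z) * b)
      = (\<Sum>a<Suc z. \<Sum>b<Suc z. of_bool (b = b0 \<and> a = a0) * b)"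
      by (intro sum.cong refl) (auto simp: z)
    also have "\<dots> = (\<Sum>a<Suc z. of_bool (a = a0) * b0)"
      using le by (intro sum.cong refl sum_delta_conj) auto
    also have "\<dots> = b0" using sum_delta_conj[of "{..<Suc z}" a0 True "\<lambda>a. b0"] le by simp
    finally show ?thesis by (simp add: z)
  qed
  ultimately show "recfn 1 (\<lambda>xs. snd (prod_decode (xs ! 0)))" by simp
qed

lemma recfn_Least:
  assumes "recpred (Suc k) (\<lambda>ys. P (ys ! 0) (tl ys))" and "\<And>xs. length xs = k \<Longrightarrow> \<exists>y. P y xs"
  shows "recfn k (\<lambda>xs. LEAST y. P y xs)"
proof -
  \<comment> \<open>\<open>Minimize\<close> stops at the value 0, hence a program for the
    negation.\<close>
  obtain p where p: "\<And>y xs. length xs = k \<Longrightarrow> run {} p (y # xs) = Some (of_bool (\<not> P y xs))"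
    using recpred_not[OF assms(1)] unfolding recpred_def recfn_def
    by (metis length_Cons list.sel(3) nth_Cons_0)
  have "run {} (Minimize p) xs = Some (LEAST y. P y xs)" if "length xs = k" for xs
  proof -
    have *: "(run {} p (y # xs) = Some 0 \<and> (\<forall>z<y. \<exists>v. run {} p (z # xs) = Some (Suc v))) \<longleftrightarrow> y = (LEAST y. P y xs)" for y
    proof -
      have "(run {} p (y # xs) = Some 0 \<and> (\<forall>z<y. \<exists>v. run {} p (z # xs) = Some (Suc v))) \<longleftrightarrow> P y xs \<and> (\<forall>z<y. \<not> P z xs)"
        using p[OF that] by (auto simp: of_bool_def split: if_splits)
      also have "\<dots> \<longleftrightarrow> y = (LEAST y. P y xs)"
        using assms(2)[OF that] by (metis LeastI_ex linorder_less_linear not_less_Least)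
      finally show ?thesis .
    qed
    show ?thesis by (simp add: *)
  qed
  then show ?thesis unfolding recfn_def by blast
qed

text \<open>A search through a dummy argument: it stops at once if the tested value is 0 and never
  if it is 1.\<close>

lemma recpred_semidecision:
  assumes "recpred k P"
  shows "\<exists>p. \<forall>xs. length xs = k \<longrightarrow> (run {} p xs \<noteq> None \<longleftrightarrow> P xs)"
proof -
  obtain p where p: "\<And>y xs. length xs = k \<Longrightarrow> run {} p (y # xs) = Some (of_bool (\<not> P xs))"
    using recfn_tl[OF recpred_not[OF assms, unfolded recpred_def]] unfolding recfn_def by (metis length_Cons list.sel(3))
  have "run {} (Minimize p) xs \<noteq> None \<longleftrightarrow> P xs" if "length xs = k" for xs
    using p[OF that] by (auto simp: of_bool_def)
  then show ?thesis by blast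
qed

lemma computable_iff_recpred: "computable B \<longleftrightarrow> recpred 1 (\<lambda>xs. xs ! 0 \<in> B)"
proof -
  have "(\<forall>xs. length xs = 1 \<longrightarrow> R xs) \<longleftrightarrow> (\<forall>n. R [n])" for R :: "nat list \<Rightarrow> bool"
    by (auto simp: length_Suc_conv)
  then show ?thesis unfolding computable_def recpred_def recfn_def by simp
qed

lemma recpred_mem: "computable B \<Longrightarrow> recfn k a \<Longrightarrow> recpred k (\<lambda>xs. a xs \<in> B)"
  unfolding recpred_def
  by (rule recfn_comp1[of "\<lambda>x. of_bool (x \<in> B)"]) (simp_all add: computable_iff_recpred recpred_def)

text \<open>The finite set of exceptions is decidable, and \<open>C\<close> is its symmetric
  difference with \<open>B\<close>. Only the existence of a program is claimed; the exceptions are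
  not found effectively.\<close>

lemma computable_finite_diff:
  assumes "computable B" and "finite {n. (n \<in> B) \<noteq> (n \<in> C)}"
  shows "computable C"
proof -
  have fin: "recpred 1 (\<lambda>xs. xs ! 0 \<in> F)" if "finite F" for F
    using that
  proof (induction F)
    case (insert x F)
    then show ?case unfolding insert_iff by (intro recfn_intros) auto
  next
    case empty
    show ?case unfolding recpred_def by (simp add: recfn_const)
  qed
  have "recpred 1 (\<lambda>xs. \<not> (xs ! 0 \<in> {n. (n \<in> B) \<noteq> (n \<in> C)} \<longleftrightarrow> xs ! 0 \<in> B))"
    by (intro recpred_not recpred_iff fin assms recpred_mem recfn_nth) auto
  moreover have "(\<not> (x \<in> {n. (n \<in> B) \<noteq> (n \<in> C)} \<longleftrightarrow> x \<in> B)) \<longleftrightarrow> x \<in> C" for x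
    by auto
  ultimately show ?thesis by (simp add: computable_iff_recpred)
qed


section \<open>Time-bounded oracle computations\<close>

text \<open>
  The oracle \<open>q\<close> is partial, and an undefined answer makes the computation diverge. Only
  minimization is bounded by \<open>s\<close>, which suffices to make the result computable.
\<close>

primrec bounded_run :: "(nat \<Rightarrow> nat option) \<Rightarrow> nat \<Rightarrow> prog \<Rightarrow> nat list \<Rightarrow> nat option" where
  "bounded_run q s Zero xs = Some 0"
| "bounded_run q s Succ xs = (case xs of [] \<Rightarrow> None | x # _ \<Rightarrow> Some (Suc x))"
| "bounded_run q s (Proj i) xs = (if i < length xs then Some (xs ! i) else None)"
| "bounded_run q s Query xs = (case xs of [] \<Rightarrow> None | x # _ \<Rightarrow> q x)"
| "bounded_run q s (Comp f gs) xs =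
     Option.bind (those (map (\<lambda>g. bounded_run q s g xs) gs)) (bounded_run q s f)"
| "bounded_run q s (PrimRec f g) xs =
     (case xs of
        [] \<Rightarrow> None
      | n # ys \<Rightarrow> rec_nat (bounded_run q s f ys)
          (\<lambda>k r. Option.bind r (\<lambda>v. bounded_run q s g (k # v # ys))) n)"
| "bounded_run q s (Minimize f) xs =
     (let P = (\<lambda>y. y < s \<and> bounded_run q s f (y # xs) = Some 0
        \<and> (\<forall>z<y. \<exists>v. bounded_run q s f (z # xs) = Some (Suc v)))
      in if \<exists>y. P y then Some (THE y. P y) else None)"

definition extends :: "(nat \<Rightarrow> nat option) \<Rightarrow> (nat \<Rightarrow> nat option) \<Rightarrow> bool" where
  "extends q q' \<longleftrightarrow> (\<forall>x v. q x = Some v \<longrightarrow> q' x = Some v)"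

definition minimizes :: "(nat \<Rightarrow> nat option) \<Rightarrow> nat \<Rightarrow> bool" where
  "minimizes h y \<longleftrightarrow> h y = Some 0 \<and> (\<forall>z<y. \<exists>v. h z = Some (Suc v))"

lemma minimizes_unique: "minimizes h y \<Longrightarrow> minimizes h y' \<Longrightarrow> y = y'"
  unfolding minimizes_def
  by (metis Zero_not_Suc linorder_neqE_nat option.inject)

lemma the_minimizes: "minimizes h y \<Longrightarrow> (THE y. minimizes h y) = y"
  using minimizes_unique by blast

lemma run_Minimize:
  "run X (Minimize f) xs = Some y \<longleftrightarrow> minimizes (\<lambda>y. run X f (y # xs)) y"
  unfolding run.simps Let_def minimizes_def[of "\<lambda>y. run X f (y # xs)", symmetric]
  by (auto simp: the_minimizes intro: minimizes_unique)

lemma bounded_run_Minimize: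
  "bounded_run q s (Minimize f) xs = Some y \<longleftrightarrow> y < s \<and> minimizes (\<lambda>y. bounded_run q s f (y # xs)) y"
proof -
  have *: "(THE y. y < s \<and> minimizes (\<lambda>y. bounded_run q s f (y # xs)) y) = y"
    if "y < s" "minimizes (\<lambda>y. bounded_run q s f (y # xs)) y" for y
    using that minimizes_unique by blast
  then show ?thesis
    unfolding bounded_run.simps Let_def minimizes_def[of "\<lambda>y. bounded_run q s f (y # xs)", symmetric]
    by auto
qed

lemma those_eq_Some: "those os = Some ys \<longleftrightarrow> os = map Some ys"
  by (induction os arbitrary: ys) (auto split: option.splits)

lemma those_map_None: "g \<in> set gs \<Longrightarrow> h g = None \<Longrightarrow> those (map h gs) = None"
  by (induction gs) (auto split: option.splits)

declare run.simps(7)[simp del] bounded_run.simps(7)[simp del]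

lemma minimizes_mono: "extends h h' \<Longrightarrow> minimizes h y \<Longrightarrow> minimizes h' y"
  unfolding minimizes_def extends_def by blast

lemma those_map_mono:
  assumes "\<And>g v. g \<in> set gs \<Longrightarrow> h g = Some v \<Longrightarrow> h' g = Some v" "those (map h gs) = Some vs"
  shows "those (map h' gs) = Some vs"
  using assms by (induction gs arbitrary: vs) (auto split: option.splits)

lemma rec_option_mono:
  assumes "\<And>v. a = Some v \<Longrightarrow> a' = Some v" "\<And>k w v. g k w = Some v \<Longrightarrow> g' k w = Some v"
    "rec_nat a (\<lambda>k r. Option.bind r (g k)) n = Some v"
  shows "rec_nat a' (\<lambda>k r. Option.bind r (g' k)) n = Some v"
  using assms(3) by (induction n arbitrary: v) (auto simp: bind_eq_Some_conv assms(1,2))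

text \<open>Missing oracle answers and exhausted bounds both yield \<open>None\<close>, so a value
  once obtained did not depend on them.\<close>

lemma bounded_run_mono:
  assumes "extends q q'" "s \<le> s'"
  shows "bounded_run q s p xs = Some v \<Longrightarrow> bounded_run q' s' p xs = Some v"
proof (induction p arbitrary: xs v)
  case Query
  then show ?case using assms by (auto simp: extends_def split: list.splits)
next
  case (Comp f gs)
  then obtain ys where ys: "those (map (\<lambda>g. bounded_run q s g xs) gs) = Some ys" "bounded_run q s f ys = Some v"
    by (auto simp: bind_eq_Some_conv)
  then show ?case using those_map_mono[OF _ ys(1), of "\<lambda>g. bounded_run q' s' g xs"] Comp.IH by auto
next
  case (PrimRec f g)
  then show ?case
    by (auto split: list.splits elim!: rec_option_mono[rotated 2])
next
  case (Minimize f)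
  then have "y < s" "minimizes (\<lambda>y. bounded_run q s f (y # xs)) v" if "v = y" for y
    using that by (auto simp: bounded_run_Minimize)
  moreover have "extends (\<lambda>y. bounded_run q s f (y # xs)) (\<lambda>y. bounded_run q' s' f (y # xs))"
    using Minimize.IH by (auto simp: extends_def)
  ultimately show ?case using assms by (auto simp: bounded_run_Minimize intro: minimizes_mono)
qed (auto split: list.splits if_splits)

lemma bounded_run_sound:
  assumes "extends q (\<lambda>x. Some (of_bool (x \<in> X)))"
  shows "bounded_run q s p xs = Some v \<Longrightarrow> run X p xs = Some v"
proof (induction p arbitrary: xs v)
  case Query
  then obtain x ys where "xs = x # ys" "q x = Some v" by (auto split: list.splits)
  moreover have "Some (of_bool (x \<in> X)) = Some v" using assms \<open>q x = Some v\<close> unfolding extends_def by blast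
  ultimately show ?case by simp
next
  case (Comp f gs)
  then obtain ys where ys: "those (map (\<lambda>g. bounded_run q s g xs) gs) = Some ys" "bounded_run q s f ys = Some v"
    by (auto simp: bind_eq_Some_conv)
  then show ?case using those_map_mono[OF _ ys(1), of "\<lambda>g. run X g xs"] Comp.IH by auto
next
  case (PrimRec f g)
  then show ?case
    by (auto split: list.splits elim!: rec_option_mono[rotated 2])
next
  case (Minimize f)
  then have "minimizes (\<lambda>y. bounded_run q s f (y # xs)) v"
    by (auto simp: bounded_run_Minimize)
  moreover have "extends (\<lambda>y. bounded_run q s f (y # xs)) (\<lambda>y. run X f (y # xs))"
    using Minimize.IH by (auto simp: extends_def)
  ultimately show ?case by (auto simp: run_Minimize intro: minimizes_mono)
qed (auto split: list.splits if_splits)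

text \<open>A halting computation uses finitely many oracle answers and finitely long searches. Both
  the oracle and the bound grow with \<open>s\<close>, so the maximum of the stages needed by the
  parts serves for the whole.\<close>

lemma bounded_run_complete:
  assumes mono: "\<And>s s'. s \<le> s' \<Longrightarrow> extends (q s) (q s')"
    and lim: "\<And>x. \<exists>s. q s x = Some (of_bool (x \<in> X))"
  shows "run X p xs = Some v \<Longrightarrow> \<exists>s. bounded_run (q s) s p xs = Some v"
proof (induction p arbitrary: xs v)
  case Query
  then show ?case using lim by (auto split: list.splits)
next
  case (Comp f gs)
  have up: "bounded_run (q s) s p xs = Some v \<Longrightarrow> s \<le> s' \<Longrightarrow> bounded_run (q s') s' p xs = Some v" for s s' p xs v
    using bounded_run_mono mono by blast
  from Comp.prems obtain ys where ys: "map (\<lambda>g. run X g xs) gs = map Some ys" "run X f ys = Some v"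
    by (auto simp: bind_eq_Some_conv those_eq_Some)
  have "\<exists>s. map (\<lambda>g. bounded_run (q s) s g xs) gs = map Some ys"
    using ys(1) Comp.IH(2)
  proof (induction gs arbitrary: ys)
    case (Cons g gs)
    then obtain y ys' where y: "ys = y # ys'" "run X g xs = Some y" "map (\<lambda>g. run X g xs) gs = map Some ys'"
      by (cases ys) auto
    obtain s1 where "bounded_run (q s1) s1 g xs = Some y" using Cons.prems(2)[of g xs y] y(2) by auto
    moreover obtain s2 where s2: "map (\<lambda>g. bounded_run (q s2) s2 g xs) gs = map Some ys'"
      using Cons.IH[OF y(3)] Cons.prems by auto
    have "map (\<lambda>g. bounded_run (q (max s1 s2)) (max s1 s2) g xs) gs = map Some ys'"
      using those_map_mono[of gs "\<lambda>g. bounded_run (q s2) s2 g xs" "\<lambda>g. bounded_run (q (max s1 s2)) (max s1 s2) g xs" ys'] s2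
        up[of s2 _ _ _ "max s1 s2"] by (auto simp: those_eq_Some)
    ultimately have "map (\<lambda>g. bounded_run (q (max s1 s2)) (max s1 s2) g xs) (g # gs) = map Some ys"
      using y up[of s1 _ _ _ "max s1 s2"] by auto
    then show ?case by blast
  qed simp
  then obtain s1 where s1: "those (map (\<lambda>g. bounded_run (q s1) s1 g xs) gs) = Some ys"
    by (auto simp: those_eq_Some)
  obtain s2 where "bounded_run (q s2) s2 f ys = Some v" using Comp.IH(1) ys by auto
  then have "bounded_run (q (max s1 s2)) (max s1 s2) f ys = Some v" by (rule up) simp
  moreover have "those (map (\<lambda>g. bounded_run (q (max s1 s2)) (max s1 s2) g xs) gs) = Some ys"
    by (rule those_map_mono[OF _ s1]) (rule up, auto)
  ultimately show ?case by (auto intro!: exI[of _ "max s1 s2"])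
next
  case (PrimRec f g)
  have up: "bounded_run (q s) s p xs = Some v \<Longrightarrow> s \<le> s' \<Longrightarrow> bounded_run (q s') s' p xs = Some v" for s s' p xs v
    using bounded_run_mono mono by blast
  from PrimRec.prems obtain n ys where xs: "xs = n # ys" by (auto split: list.splits)
  have "\<exists>s. bounded_run (q s) s (PrimRec f g) (n # ys) = Some v" if "run X (PrimRec f g) (n # ys) = Some v" for n v
    using that
  proof (induction n arbitrary: v)
    case 0
    then show ?case using PrimRec.IH(1) by simp
  next
    case (Suc n)
    then obtain w where w: "run X (PrimRec f g) (n # ys) = Some w" "run X g (n # w # ys) = Some v"
      by (auto simp: bind_eq_Some_conv)
    from Suc.IH[OF w(1)] obtain s1 where "bounded_run (q s1) s1 (PrimRec f g) (n # ys) = Some w" by blast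
    then have 1: "bounded_run (q (max s1 s)) (max s1 s) (PrimRec f g) (n # ys) = Some w" for s by (rule up) simp
    from PrimRec.IH(2)[OF w(2)] obtain s2 where "bounded_run (q s2) s2 g (n # w # ys) = Some v" by blast
    then have 2: "bounded_run (q (max s s2)) (max s s2) g (n # w # ys) = Some v" for s by (rule up) simp
    show ?case using 1[of s2] 2[of s1] by (auto intro!: exI[of _ "max s1 s2"])
  qed
  then show ?case using PrimRec.prems xs by blast
next
  case (Minimize f)
  have up: "bounded_run (q s) s p xs = Some v \<Longrightarrow> s \<le> s' \<Longrightarrow> bounded_run (q s') s' p xs = Some v" for s s' p xs v
    using bounded_run_mono mono by blast
  from Minimize.prems have m: "minimizes (\<lambda>y. run X f (y # xs)) v" by (simp add: run_Minimize)
  \<comment> \<open>Each test before the successful one needs a stage of its own; the induction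
    merges them into a common one.\<close>
  have "\<exists>s. \<forall>z<u. \<exists>w. bounded_run (q s) s f (z # xs) = Some (Suc w)" if "u \<le> v" for u
    using that
  proof (induction u)
    case (Suc u)
    then obtain s1 where s1: "\<forall>z<u. \<exists>w. bounded_run (q s1) s1 f (z # xs) = Some (Suc w)" by auto
    obtain w where "run X f (u # xs) = Some (Suc w)" using Suc.prems m unfolding minimizes_def by (meson Suc_le_lessD)
    then obtain s2 where s2: "bounded_run (q s2) s2 f (u # xs) = Some (Suc w)" using Minimize.IH by blast
    have "\<exists>w. bounded_run (q (max s1 s2)) (max s1 s2) f (z # xs) = Some (Suc w)" if "z < Suc u" for z
    proof (cases "z = u")
      case True
      then show ?thesis using up[OF s2, of "max s1 s2"] by auto
    next
      case False
      then obtain w where "bounded_run (q s1) s1 f (z # xs) = Some (Suc w)" using s1 \<open>z < Suc u\<close> by (auto simp: less_Suc_eq)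
      then show ?thesis using up[of s1 _ _ _ "max s1 s2"] by auto
    qed
    then show ?case by blast
  qed simp
  then obtain s1 where s1: "\<forall>z<v. \<exists>w. bounded_run (q s1) s1 f (z # xs) = Some (Suc w)" by blast
  obtain s2 where s2: "bounded_run (q s2) s2 f (v # xs) = Some 0"
    using m Minimize.IH[of "v # xs" 0] by (auto simp: minimizes_def)
  define s where "s = max (Suc v) (max s1 s2)"
  have "minimizes (\<lambda>y. bounded_run (q s) s f (y # xs)) v" "v < s"
  proof -
    have "bounded_run (q s) s f (v # xs) = Some 0" by (rule up[OF s2]) (simp add: s_def)
    moreover have "s1 \<le> s" by (simp add: s_def)
    ultimately show "minimizes (\<lambda>y. bounded_run (q s) s f (y # xs)) v"
      using s1 up[of s1 _ _ _ s] unfolding minimizes_def by blast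
  qed (simp add: s_def)
  then show ?case by (auto simp: bounded_run_Minimize)
qed (auto split: list.splits if_splits)

section \<open>Bounded runs as total computable functions\<close>

definition opt_code :: "nat option \<Rightarrow> nat" where
  "opt_code o' = (case o' of None \<Rightarrow> 0 | Some v \<Rightarrow> Suc v)"

definition opt_decode :: "nat \<Rightarrow> nat option" where
  "opt_decode n = (case n of 0 \<Rightarrow> None | Suc v \<Rightarrow> Some v)"

lemma opt_simps [simp]: "opt_code None = 0" "opt_code (Some v) = Suc v" "opt_decode 0 = None"
  "opt_decode (Suc v) = Some v" "opt_code (opt_decode n) = n" "opt_code o' = 0 \<longleftrightarrow> o' = None"
  "opt_code o' = Suc v \<longleftrightarrow> o' = Some v"
  by (auto simp: opt_code_def opt_decode_def split: nat.split option.split)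

lemma recfn_drop_nth: "j + i < k \<Longrightarrow> recfn k (\<lambda>xs. drop j xs ! i)"
  using recfn_nth[of "j + i" k] by (subst recfn_cong) auto

lemma recfn_append_nth:
  assumes "\<And>i. i < n \<Longrightarrow> recfn k (\<lambda>xs. f xs ! i)" "\<And>i. i < m \<Longrightarrow> recfn k (\<lambda>xs. g xs ! i)"
    "\<And>xs. length xs = k \<Longrightarrow> length (f xs) = n" "i < n + m"
  shows "recfn k (\<lambda>xs. (f xs @ g xs) ! i)"
proof -
  have "recfn k (\<lambda>xs. if i < n then f xs ! i else g xs ! (i - n))"
    using assms(1,2)[of i] assms(2)[of "i - n"] assms(4) by (cases "i < n") auto
  then show ?thesis by (subst recfn_cong) (auto simp: nth_append assms(3))
qed

lemma recpred_list_all: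
  "(\<And>g. g \<in> set gs \<Longrightarrow> recpred k (P g)) \<Longrightarrow> recpred k (\<lambda>xs. \<forall>g\<in>set gs. P g xs)"
proof (induction gs)
  case Nil
  show ?case unfolding recpred_def by (simp add: recfn_const)
next
  case (Cons g gs)
  then have "recpred k (\<lambda>xs. P g xs \<and> (\<forall>g\<in>set gs. P g xs))" by (intro recpred_conj) auto
  then show ?case by simp
qed

text \<open>
  The argument list consists of the \<open>k\<close> arguments of the program followed by parameters on which
  the oracle depends; the first parameter is the bound.
\<close>

definition bounded_code :: "(nat list \<Rightarrow> nat) \<Rightarrow> prog \<Rightarrow> nat \<Rightarrow> nat list \<Rightarrow> nat" where
  "bounded_code q p k xs =
     opt_code (bounded_run (\<lambda>y. opt_decode (q (y # drop k xs))) (xs ! k) p (take k xs))"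

text \<open>No search is unbounded any more, so each outcome, with divergence as 0, is a value of a
  total function. The arity \<open>k\<close> is general in the induction because subprograms take
  other numbers of arguments, while the \<open>r\<close> parameters are passed along behind
  them.\<close>

lemma recfn_bounded_code:
  assumes "0 < r" "recfn (Suc r) q"
  shows "recfn (k + r) (bounded_code q p k)"
proof (induction p arbitrary: k)
  case Zero
  show ?case by (simp add: bounded_code_def[abs_def] recfn_const)
next
  case Succ
  show ?case
  proof (cases k)
    case (Suc k')
    then have "recfn (k + r) (\<lambda>xs. Suc (Suc (xs ! 0)))" by (intro recfn_intros) auto
    then show ?thesis
      by (subst recfn_cong) (auto simp: bounded_code_def Suc length_Suc_conv)
  qed (simp add: bounded_code_def[abs_def] recfn_const)
next
  case (Proj i)
  show ?case
  proof (cases "i < k")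
    case True
    then have "recfn (k + r) (\<lambda>xs. Suc (xs ! i))" by (intro recfn_intros) auto
    then show ?thesis by (subst recfn_cong) (auto simp: bounded_code_def True)
  next
    case False
    show ?thesis
      by (subst recfn_cong[where G = "\<lambda>xs. 0"]) (auto simp: bounded_code_def False recfn_const)
  qed
next
  case Query
  show ?case
  proof (cases k)
    case (Suc k')
    have "recfn (k + r) (\<lambda>xs. q (xs ! 0 # drop k xs))"
      by (rule recfn_subst[OF assms(2)]) (auto simp: Suc intro!: recfn_Cons_nth recfn_nth recfn_drop_nth)
    then show ?thesis
      by (subst recfn_cong) (auto simp: bounded_code_def Suc length_Suc_conv)
  qed (simp add: bounded_code_def[abs_def] recfn_const)
next
  case (Comp f gs)
  \<comment> \<open>Subtracting 1 turns the code of \<open>Some v\<close> into \<open>v\<close>. A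
    diverging argument gives a meaningless 0, which the case distinction below keeps from being
    used.\<close>
  define as where "as = (\<lambda>xs. map (\<lambda>g. bounded_code q g k xs - 1) gs)"
  have as: "recfn (k + r) (\<lambda>xs. as xs ! i)" if "i < length gs" for i
    using that unfolding as_def by simp (intro recfn_intros Comp.IH(2) nth_mem)
  have length_as: "length (as xs) = length gs" for xs by (simp add: as_def)
  have "recfn (k + r) (\<lambda>xs. bounded_code q f (length gs) (as xs @ drop k xs))"
    by (rule recfn_subst[OF Comp.IH(1)])
      (auto intro!: recfn_append_nth[where n = "length gs" and m = r] as recfn_drop_nth simp: length_as)
  then have "recfn (k + r) (\<lambda>xs. if \<forall>g\<in>set gs. \<not> bounded_code q g k xs = 0
      then bounded_code q f (length gs) (as xs @ drop k xs) else 0)"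
    by (intro recfn_intros recpred_list_all Comp.IH(2))
  moreover have "bounded_code q (Comp f gs) k xs = (if \<forall>g\<in>set gs. \<not> bounded_code q g k xs = 0
      then bounded_code q f (length gs) (as xs @ drop k xs) else 0)" if len: "length xs = k + r" for xs
  proof (cases "\<forall>g\<in>set gs. \<not> bounded_code q g k xs = 0")
    case True
    have "those (map (\<lambda>g. bounded_run (\<lambda>y. opt_decode (q (y # drop k xs))) (xs ! k) g (take k xs)) gs) = Some (as xs)"
      using True by (auto simp: those_eq_Some as_def bounded_code_def)
    then show ?thesis using True assms(1) by (simp add: bounded_code_def nth_append len length_as)
  next
    case False
    then obtain g where g: "g \<in> set gs" "bounded_run (\<lambda>y. opt_decode (q (y # drop k xs))) (xs ! k) g (take k xs) = None"
      by (auto simp: bounded_code_def)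
    then have "those (map (\<lambda>g. bounded_run (\<lambda>y. opt_decode (q (y # drop k xs))) (xs ! k) g (take k xs)) gs) = None"
      by (intro those_map_None)
    then show ?thesis unfolding if_not_P[OF False] by (simp add: bounded_code_def)
  qed
  ultimately show ?case by (subst recfn_cong) auto
next
  case (PrimRec f g)
  show ?case
  proof (cases k)
    case (Suc k')
    have 1: "recfn (k + r) (\<lambda>xs. bounded_code q f k' (tl xs))"
      using recfn_tl[OF PrimRec.IH(1)[of k']] by (simp add: Suc)
    have "recfn (Suc (Suc (k + r))) (\<lambda>ys. bounded_code q g (Suc k) (ys ! 0 # (ys ! 1 - 1) # tl (tl (tl ys))))"
      by (rule recfn_subst[OF PrimRec.IH(2)])
        (auto intro!: recfn_Cons_nth recfn_intros simp: Suc)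
    with 1 have "recfn (k + r) (\<lambda>xs. rec_nat (bounded_code q f k' (tl xs))
        (\<lambda>i v. if v = 0 then 0 else bounded_code q g (Suc k) (i # (v - 1) # tl xs)) (xs ! 0))"
      by (intro recfn_rec_nat recfn_intros) (auto simp: Suc)
    moreover have "bounded_code q (PrimRec f g) k xs = rec_nat (bounded_code q f k' (tl xs))
        (\<lambda>i v. if v = 0 then 0 else bounded_code q g (Suc k) (i # (v - 1) # tl xs)) (xs ! 0)"
      if len: "length xs = k + r" for xs
    proof -
      obtain n zs where xs: "xs = n # zs" using len Suc by (cases xs) auto
      have "opt_code (rec_nat (bounded_run Q s f ys) (\<lambda>k r. Option.bind r (\<lambda>v. bounded_run Q s g (k # v # ys))) m)
        = rec_nat (opt_code (bounded_run Q s f ys))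
          (\<lambda>i v. if v = 0 then 0 else opt_code (bounded_run Q s g (i # (v - 1) # ys))) m" for Q s ys m
      proof (induction m)
        case (Suc m)
        show ?case unfolding nat.rec(2) Suc.IH[symmetric] by (auto simp: opt_code_def split: option.split)
      qed simp
      then show ?thesis by (simp add: bounded_code_def xs Suc cong: if_cong)
    qed
    ultimately show ?thesis by (subst recfn_cong) auto
  qed (simp add: bounded_code_def[abs_def] recfn_const)
next
  case (Minimize f)
  have I: "recfn (Suc (k + r)) (\<lambda>ys. bounded_code q f (Suc k) (ys ! 0 # tl ys))"
    using Minimize.IH[of "Suc k"] by (subst recfn_cong) (auto simp: length_Suc_conv)
  have "recfn (Suc (Suc (k + r))) (\<lambda>ys. bounded_code q f (Suc k) (ys ! 0 # tl (tl ys)))"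
    using Minimize.IH[of "Suc k"]
    by (rule recfn_subst) (auto intro!: recfn_Cons_nth recfn_intros)
  \<comment> \<open>At most one \<open>y\<close> minimizes, so the sum is \<open>Suc y\<close>, the
    code of \<open>Some y\<close>, or 0, the code of \<open>None\<close>.\<close>
  then have "recfn (k + r) (\<lambda>xs. \<Sum>y<xs ! k. of_bool (bounded_code q f (Suc k) (y # xs) = 1
      \<and> (\<forall>z<y. 1 < bounded_code q f (Suc k) (z # xs))) * Suc y)"
    using I assms(1) by (intro recfn_intros) auto
  moreover have "bounded_code q (Minimize f) k xs = (\<Sum>y<xs ! k. of_bool (bounded_code q f (Suc k) (y # xs) = 1
      \<and> (\<forall>z<y. 1 < bounded_code q f (Suc k) (z # xs))) * Suc y)" if "length xs = k + r" for xs
  proof -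
    define h where "h = (\<lambda>y. bounded_run (\<lambda>y. opt_decode (q (y # drop k xs))) (xs ! k) f (y # take k xs))"
    have "(bounded_code q f (Suc k) (y # xs) = 1 \<and> (\<forall>z<y. 1 < bounded_code q f (Suc k) (z # xs))) \<longleftrightarrow> minimizes h y" for y
    proof -
      have "1 < opt_code o' \<longleftrightarrow> (\<exists>v. o' = Some (Suc v))" for o'
        by (auto simp: opt_code_def gr0_conv_Suc split: option.split)
      then show ?thesis by (simp add: minimizes_def bounded_code_def h_def)
    qed
    moreover have "bounded_code q (Minimize f) k xs = (\<Sum>y<xs ! k. of_bool (minimizes h y) * Suc y)"
    proof (cases "\<exists>y<xs ! k. minimizes h y")
      case True
      then obtain y where y: "y < xs ! k" "minimizes h y" by blast
      then have "minimizes h z \<longleftrightarrow> z = y \<and> True" for z using minimizes_unique by blast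
      then have "(\<Sum>y<xs ! k. of_bool (minimizes h y) * Suc y) = Suc y"
        using sum_delta_conj[of "{..<xs ! k}" y True Suc] y by simp
      moreover have "bounded_run (\<lambda>y. opt_decode (q (y # drop k xs))) (xs ! k) (Minimize f) (take k xs) = Some y"
        using y by (simp add: bounded_run_Minimize h_def)
      ultimately show ?thesis by (simp add: bounded_code_def)
    next
      case False
      then have "bounded_run (\<lambda>y. opt_decode (q (y # drop k xs))) (xs ! k) (Minimize f) (take k xs) \<noteq> Some y" for y
        by (auto simp: bounded_run_Minimize h_def)
      then show ?thesis using False by (auto simp: bounded_code_def)
    qed
    ultimately show ?thesis by simp
  qed
  ultimately show ?case by (subst recfn_cong) auto
qed

text \<open>\<open>Query\<close> reads only its first argument and diverges on the empty list;
  \<open>Comp z [Proj 0]\<close> does the same when \<open>z\<close> decides the oracle.\<close>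

primrec subst_oracle :: "prog \<Rightarrow> prog \<Rightarrow> prog" where
  "subst_oracle z Zero = Zero"
| "subst_oracle z Succ = Succ"
| "subst_oracle z (Proj i) = Proj i"
| "subst_oracle z Query = Comp z [Proj 0]"
| "subst_oracle z (Comp f gs) = Comp (subst_oracle z f) (map (subst_oracle z) gs)"
| "subst_oracle z (PrimRec f g) = PrimRec (subst_oracle z f) (subst_oracle z g)"
| "subst_oracle z (Minimize f) = Minimize (subst_oracle z f)"

lemma run_subst_oracle:
  assumes "\<And>n. run Y z [n] = Some (of_bool (n \<in> X))"
  shows "run Y (subst_oracle z p) xs = run X p xs"
proof (induction p arbitrary: xs)
  case (Comp f gs)
  have "map (\<lambda>g. run Y g xs) (map (subst_oracle z) gs) = map (\<lambda>g. run X g xs) gs"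
    using Comp.IH(2) by auto
  moreover have "run Y (subst_oracle z f) = run X f" using Comp.IH(1) by auto
  ultimately show ?case by (simp del: map_map)
qed (auto simp: assms run.simps(7) split: list.split)


section \<open>Martin-Loef tests by counting strings\<close>

text \<open>
  From here on a number \<open>c\<close> together with a length \<open>s\<close> stands for the string of the bits
  \<open>bit c i\<close> with \<open>i < s\<close>. Bits of \<open>c\<close> beyond \<open>s\<close> are allowed and ignored, so that prefixes need no
  truncation.
\<close>

definition initial :: "nat set \<Rightarrow> nat \<Rightarrow> nat" where
  "initial A s = horner_sum of_bool 2 (map (\<lambda>i. i \<in> A) [0..<s])"

lemma bit_initial [simp]: "bit (initial A s) i \<longleftrightarrow> i < s \<and> i \<in> A"
  by (auto simp: initial_def bit_horner_sum_bit_iff)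

lemma take_bit_initial [simp]: "take_bit j (initial A s) = initial A (min j s)"
  by (rule bit_eqI) (auto simp: bit_take_bit_iff)

lemma initial_less: "initial A s < 2 ^ s"
  using horner_sum_of_bool_2_less[where bs = "map (\<lambda>i. i \<in> A) [0..<s]"] by (simp add: initial_def)

section \<open>Decoding numbers into strings\<close>

lemma le_list_encode: "length xs \<le> list_encode xs"
proof (induction xs)
  case (Cons x xs)
  then show ?case using le_prod_encode_2[of "list_encode xs" x] by simp
qed simp

text \<open>A non-empty list is coded by the successor of the pair of its head and the code of its
  tail. The code 0 of the empty list is a fixed point: truncated subtraction leaves it at 0, and 0
  decodes to the pair of zeros.\<close>

definition drop_code :: "nat \<Rightarrow> nat \<Rightarrow> nat" where
  "drop_code j z = rec_nat z (\<lambda>_ r. snd (prod_decode (r - 1))) j"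

lemma drop_code_list_encode: "drop_code j (list_encode xs) = list_encode (drop j xs)"
proof (induction j)
  case (Suc j)
  have "prod_decode 0 = (0, 0)" using prod_encode_inverse[of "(0, 0)"] by (simp add: prod_encode_def)
  with Suc show ?case
    by (cases "drop j xs") (auto simp: drop_code_def drop_Suc prod_encode_inverse simp flip: tl_drop)
qed (simp add: drop_code_def)

lemma recfn_drop_code: "recfn k a \<Longrightarrow> recfn k b \<Longrightarrow> recfn k (\<lambda>xs. drop_code (a xs) (b xs))"
proof (rule recfn_comp2[of drop_code])
  show "recfn 2 (\<lambda>xs. drop_code (xs ! 0) (xs ! 1))"
    unfolding drop_code_def by (intro recfn_rec_nat recfn_snd_prod_decode recfn_intros) auto
qed

text \<open>Counts the non-empty tails of the coded list. A list is no longer than its code, so the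
  bound \<open>z\<close> misses none.\<close>

definition string_length :: "nat \<Rightarrow> nat" where
  "string_length z = card {j. j < z \<and> drop_code j z \<noteq> 0}"

definition string_value :: "nat \<Rightarrow> nat" where
  "string_value z = (\<Sum>j<string_length z. fst (prod_decode (drop_code j z - 1)) * 2 ^ j)"

lemma list_encode_eq_0_iff: "list_encode xs = 0 \<longleftrightarrow> xs = []"
  by (cases xs) auto

lemma string_length_code: "string_length (string_code \<sigma>) = length \<sigma>"
proof -
  have "drop_code j (string_code \<sigma>) \<noteq> 0 \<longleftrightarrow> j < length \<sigma>" for j
    by (simp add: string_code_def drop_code_list_encode list_encode_eq_0_iff not_le)
  moreover have "length \<sigma> \<le> string_code \<sigma>"
    using le_list_encode[of "map of_bool \<sigma>"] by (simp only: string_code_def length_map)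
  ultimately have "{j. j < string_code \<sigma> \<and> drop_code j (string_code \<sigma>) \<noteq> 0} = {..<length \<sigma>}"
    by (simp only: lessThan_def) (use less_le_trans in blast)
  then show ?thesis by (simp add: string_length_def)
qed

lemma string_value_code: "string_value (string_code \<sigma>) = horner_sum of_bool 2 \<sigma>"
proof -
  have "fst (prod_decode (drop_code j (string_code \<sigma>) - 1)) = of_bool (\<sigma> ! j)" if "j < length \<sigma>" for j
  proof -
    have "drop j (map of_bool \<sigma>) = (of_bool (\<sigma> ! j) :: nat) # drop (Suc j) (map of_bool \<sigma>)"
      using Cons_nth_drop_Suc[of j "map of_bool \<sigma> :: nat list"] that by simp
    then show ?thesis by (simp add: string_code_def drop_code_list_encode prod_encode_inverse)
  qed
  then show ?thesis
    by (simp add: string_value_def string_length_code horner_sum_eq_sum atLeast0LessThan)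
qed

lemma recfn_string_length: "recfn k a \<Longrightarrow> recfn k (\<lambda>xs. string_length (a xs))"
proof (rule recfn_comp1[of string_length])
  show "recfn 1 (\<lambda>xs. string_length (xs ! 0))"
    unfolding string_length_def by (intro recfn_intros recfn_drop_code) auto
qed

lemma recfn_string_value: "recfn k a \<Longrightarrow> recfn k (\<lambda>xs. string_value (a xs))"
proof (rule recfn_comp1[of string_value])
  show "recfn 1 (\<lambda>xs. string_value (xs ! 0))"
    unfolding string_value_def
    by (intro recfn_intros recfn_drop_code recfn_string_length recfn_fst_prod_decode) auto
qed

section \<open>Events decided by finitely many bits\<close>

lemma measure_cylinder:
  assumes "finite J"
  shows "measure cantor_measure {f. \<forall>i\<in>J. f i = b i} = (1 / 2) ^ card J"
proof -
  interpret product_prob_space "\<lambda>i :: nat. measure_pmf (bernoulli_pmf (1 / 2))" UNIV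
    by (rule product_prob_spaceI) (rule prob_space_measure_pmf)
  have eq: "{f. \<forall>i\<in>J. f i = b i}
      = prod_emb UNIV (\<lambda>i. measure_pmf (bernoulli_pmf (1 / 2))) J (Pi\<^sub>E J (\<lambda>i. {b i}))"
    unfolding prod_emb_def by (simp add: space_PiM PiE_iff vimage_def)
  have half: "measure (measure_pmf (bernoulli_pmf (1 / 2))) {x} = 1 / 2" for x
    unfolding measure_pmf_single by (cases x) (simp_all only: pmf_bernoulli_half)
  have "measure cantor_measure {f. \<forall>i\<in>J. f i = b i}
      = (\<Prod>i\<in>J. measure (measure_pmf (bernoulli_pmf (1 / 2))) {b i})"
    unfolding cantor_measure_def eq by (rule measure_PiM_emb) (use assms in auto)
  then show ?thesis unfolding half by simp
qed

lemma space_cantor: "space cantor_measure = UNIV"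
  by (simp add: cantor_measure_def space_PiM)

lemma prob_space_cantor: "prob_space cantor_measure"
  unfolding cantor_measure_def by (rule prob_space_PiM) (rule prob_space_measure_pmf)

lemma cylinder_measurable: "finite J \<Longrightarrow> {f. \<forall>i\<in>J. f i = b i} \<in> sets cantor_measure"
proof -
  assume "finite J"
  have "{f \<in> space cantor_measure. \<forall>i\<in>J. f i = b i} \<in> sets cantor_measure"
  proof (rule sets.sets_Collect_finite_All)
    fix i
    have "(\<lambda>f. f i) \<in> measurable cantor_measure (measure_pmf (bernoulli_pmf (1/2)))"
      unfolding cantor_measure_def by (rule measurable_component_singleton) simp
    then have "(\<lambda>f. f i) -` {b i} \<inter> space cantor_measure \<in> sets cantor_measure"
      by (rule measurable_sets) simp
    moreover have "(\<lambda>f. f i) -` {b i} \<inter> space cantor_measure = {f \<in> space cantor_measure. f i = b i}"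
      by auto
    ultimately show "{f \<in> space cantor_measure. f i = b i} \<in> sets cantor_measure" by simp
  qed fact
  then show ?thesis by (simp add: space_cantor)
qed

lemma initial_eq_iff:
  assumes "c < 2 ^ s" shows "initial {i. f i} s = c \<longleftrightarrow> (\<forall>i\<in>{..<s}. f i = bit c i)"
proof
  assume *: "\<forall>i\<in>{..<s}. f i = bit c i"
  show "initial {i. f i} s = c"
  proof (rule bit_eqI)
    fix i
    have "take_bit s c = c" using assms by (simp add: take_bit_nat_eq_self_iff)
    then have "bit c i \<Longrightarrow> i < s" using bit_take_bit_iff[of s c i] by auto
    then show "bit (initial {i. f i} s) i = bit c i" using * by auto
  qed
qed auto

text \<open>Disjoint cylinders over the strings of length \<open>s\<close> turn measure into a
  count, so that all later estimates concern cardinalities.\<close>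

lemma measure_initial:
  fixes s :: nat and P :: "nat \<Rightarrow> bool"
  shows "measure cantor_measure {f. P (initial {i. f i} s)} = card {c. c < 2 ^ s \<and> P c} / 2 ^ s"
    and "{f. P (initial {i. f i} s)} \<in> sets cantor_measure"
proof -
  interpret prob_space cantor_measure by (rule prob_space_cantor)
  define cyl where "cyl c = {f. \<forall>i\<in>{..<s}. f i = bit c i}" for c :: nat
  have cyl_iff: "f \<in> cyl c \<longleftrightarrow> initial {i. f i} s = c" if "c < 2 ^ s" for f c
    using initial_eq_iff[OF that] by (simp add: cyl_def)
  have eq: "{f. P (initial {i. f i} s)} = (\<Union>c\<in>{c. c < 2 ^ s \<and> P c}. cyl c)"
  proof -
    have "f \<in> (\<Union>c\<in>{c. c < 2 ^ s \<and> P c}. cyl c) \<longleftrightarrow> P (initial {i. f i} s)" for f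
      using initial_less[of "{i. f i}" s] cyl_iff by auto
    then show ?thesis by blast
  qed
  have sets: "cyl c \<in> sets cantor_measure" for c
    unfolding cyl_def by (rule cylinder_measurable) simp
  have "measure cantor_measure (\<Union>c\<in>{c. c < 2 ^ s \<and> P c}. cyl c)
      = (\<Sum>c\<in>{c. c < 2 ^ s \<and> P c}. measure cantor_measure (cyl c))"
  proof (rule finite_measure_finite_Union)
    show "disjoint_family_on cyl {c. c < 2 ^ s \<and> P c}"
      unfolding disjoint_family_on_def using cyl_iff by (auto simp: disjoint_iff)
  qed (use sets in auto)
  also have "\<dots> = (\<Sum>c\<in>{c. c < 2 ^ s \<and> P c}. (1 / 2) ^ s)"
    unfolding cyl_def by (subst measure_cylinder) simp_all
  finally show "measure cantor_measure {f. P (initial {i. f i} s)} = card {c. c < 2 ^ s \<and> P c} / 2 ^ s"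
    by (simp add: eq power_divide)
  show "{f. P (initial {i. f i} s)} \<in> sets cantor_measure"
    unfolding eq using sets by (intro sets.finite_UN) auto
qed

text \<open>An enumerated set of strings need not be closed under extension; with all prefixes
  included, the strings of length \<open>s\<close> cover everything enumerated up to that
  length.\<close>

definition has_prefix :: "(nat \<Rightarrow> nat \<Rightarrow> bool) \<Rightarrow> nat \<Rightarrow> nat \<Rightarrow> bool" where
  "has_prefix P s c \<longleftrightarrow> (\<exists>j\<le>s. P j (take_bit j c))"

lemma has_prefix_initial: "has_prefix P s (initial X s) \<longleftrightarrow> (\<exists>j\<le>s. P j (initial X j))"
  unfolding has_prefix_def take_bit_initial by (metis min_absorb1)

text \<open>The counts bound the measures of an increasing sequence of clopen sets, and continuity
  from below passes the bound to their union. All uses of randomness go through this lemma.\<close>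

lemma ml_random_avoids:
  assumes A: "ml_random A"
    and R: "recpred 3 (\<lambda>xs. R (xs ! 0) (xs ! 1) (xs ! 2))"
    and bound: "\<And>m s. card {c. c < 2 ^ s \<and> has_prefix (R m) s c} * 2 ^ m \<le> 2 ^ s"
  shows "\<exists>m. \<forall>s. \<not> R m s (initial A s)"
proof -
  interpret prob_space cantor_measure by (rule prob_space_cantor)
  have "recpred 2 (\<lambda>xs. R (xs ! 0) (string_length (xs ! 1)) (string_value (xs ! 1)))"
    using R unfolding recpred_def
    by (rule recfn_comp3[where f = "\<lambda>m s c. of_bool (R m s c)"])
      (intro recfn_intros recfn_string_length recfn_string_value; simp)+
  from recpred_semidecision[OF this] obtain p where
    p': "\<And>xs. length xs = 2 \<Longrightarrow> run {} p xs \<noteq> None \<longleftrightarrow>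
      R (xs ! 0) (string_length (xs ! 1)) (string_value (xs ! 1))" by blast
  have p: "run {} p [m, string_code \<sigma>] \<noteq> None \<longleftrightarrow> R m (length \<sigma>) (horner_sum of_bool 2 \<sigma>)" for m \<sigma>
    using p'[of "[m, string_code \<sigma>]"] by (simp add: string_length_code string_value_code)
  have cyl: "f \<in> cylinder \<sigma> \<longleftrightarrow> map f [0..<length \<sigma>] = \<sigma>" for f \<sigma>
    unfolding cylinder_def list_eq_iff_nth_eq by simp
  have ce: "ce_open p m = (\<Union>s. {f. has_prefix (R m) s (initial {i. f i} s)})" for m
  proof -
    have "f \<in> ce_open p m \<longleftrightarrow> (\<exists>s. R m s (initial {i. f i} s))" for f
    proof -
      have "f \<in> ce_open p m \<longleftrightarrow>
          (\<exists>\<sigma>. R m (length \<sigma>) (horner_sum of_bool 2 \<sigma>) \<and> map f [0..<length \<sigma>] = \<sigma>)"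
        unfolding ce_open_def UN_iff mem_Collect_eq p cyl by blast
      also have "\<dots> \<longleftrightarrow> (\<exists>s. R m s (horner_sum of_bool 2 (map f [0..<s])))"
      proof
        assume "\<exists>s. R m s (horner_sum of_bool 2 (map f [0..<s]))"
        then obtain s where "R m s (horner_sum of_bool 2 (map f [0..<s]))" ..
        then show "\<exists>\<sigma>. R m (length \<sigma>) (horner_sum of_bool 2 \<sigma>) \<and> map f [0..<length \<sigma>] = \<sigma>"
          by (intro exI[of _ "map f [0..<s]"]) simp
      qed metis
      finally show ?thesis by (simp add: initial_def)
    qed
    moreover have "(\<exists>s. R m s (initial X s)) \<longleftrightarrow> (\<exists>s. has_prefix (R m) s (initial X s))" for X
      unfolding has_prefix_initial by blast
    ultimately show ?thesis by auto
  qed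
  have "ml_test p"
    unfolding ml_test_def
  proof
    fix m
    define U where "U s = {f. has_prefix (R m) s (initial {i. f i} s)}" for s
    have "incseq U"
    proof (rule incseq_SucI)
      fix s show "U s \<subseteq> U (Suc s)"
        unfolding U_def has_prefix_initial using le_SucI by blast
    qed
    moreover have "U s \<in> events" for s
      unfolding U_def by (rule measure_initial(2)[where P = "has_prefix (R m) s"])
    ultimately have "(\<lambda>s. measure cantor_measure (U s)) \<longlonglongrightarrow> measure cantor_measure (\<Union>s. U s)"
      by (intro finite_Lim_measure_incseq) auto
    moreover have "measure cantor_measure (U s) \<le> (1 / 2) ^ m" for s
    proof -
      have "real (card {c. c < 2 ^ s \<and> has_prefix (R m) s c} * 2 ^ m) \<le> real (2 ^ s)"
        using bound by (rule of_nat_mono)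
      then show ?thesis
        unfolding U_def measure_initial(1)[where P = "has_prefix (R m) s"] by (simp add: field_simps)
    qed
    ultimately show "measure cantor_measure (ce_open p m) \<le> (1 / 2) ^ m"
      unfolding ce U_def[symmetric] by (intro LIMSEQ_le_const2) auto
  qed
  then have "(\<lambda>n. n \<in> A) \<notin> (\<Inter>m. ce_open p m)" using A by (auto simp: ml_random_def)
  then obtain m where "(\<lambda>n. n \<in> A) \<notin> ce_open p m" by auto
  then have "\<not> has_prefix (R m) s (initial A s)" for s by (auto simp: ce)
  then have "\<not> R m s (initial A s)" for s
    unfolding has_prefix_initial by blast
  then show ?thesis by blast
qed


section \<open>Open sets depending only on tails\<close>

text \<open>The number is \<open>c\<close> with its first \<open>k\<close> bits overwritten by those
  of \<open>t\<close>; the summands share no bit, so the addition produces no carry.\<close>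

lemma bit_splice:
  fixes t c k j :: nat
  assumes "t < 2 ^ k"
  shows "bit (t + 2 ^ k * (c div 2 ^ k)) j \<longleftrightarrow> (if j < k then bit t j else bit c j)"
proof -
  have t: "take_bit k t = t" using assms by (simp add: take_bit_nat_eq_self_iff)
  have eq: "t + 2 ^ k * (c div 2 ^ k) = take_bit k t + push_bit k (drop_bit k c)"
    by (simp add: t push_bit_eq_mult drop_bit_eq_div)
  show ?thesis
    unfolding eq by (subst bit_disjunctive_add_iff) (auto simp: bit_simps)
qed

text \<open>Independence of the first \<open>a\<close> bits and the others, in counting form:
  \<open>c\<close> corresponds to its remainder and quotient modulo \<open>2 ^ a\<close>.\<close>

lemma card_mod_div_split:
  fixes a s :: nat and U V :: "nat \<Rightarrow> bool"
  assumes "a \<le> s"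
  shows "card {c. c < 2 ^ s \<and> U (c mod 2 ^ a) \<and> V (c div 2 ^ a)}
    = card {x. x < 2 ^ a \<and> U x} * card {y. y < 2 ^ (s - a) \<and> V y}"
proof -
  have s: "(2::nat) ^ s = 2 ^ a * 2 ^ (s - a)" using assms by (simp flip: power_add)
  have "bij_betw (\<lambda>(x, y). x + 2 ^ a * y) ({x. x < 2 ^ a \<and> U x} \<times> {y. y < 2 ^ (s - a) \<and> V y})
     {c. c < 2 ^ s \<and> U (c mod 2 ^ a) \<and> V (c div 2 ^ a)}"
  proof (rule bij_betwI[where g = "\<lambda>c. (c mod 2 ^ a, c div 2 ^ a)"])
    show "(\<lambda>c. (c mod 2 ^ a, c div 2 ^ a)) \<in> {c. c < 2 ^ s \<and> U (c mod 2 ^ a) \<and> V (c div 2 ^ a)}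
      \<rightarrow> {x. x < 2 ^ a \<and> U x} \<times> {y. y < 2 ^ (s - a) \<and> V y}"
      by (auto simp: s less_mult_imp_div_less mult.commute)
    have "x + 2 ^ a * y < 2 ^ s" if "x < 2 ^ a" "y < 2 ^ (s - a)" for x y :: nat
    proof -
      have "x + 2 ^ a * y < 2 ^ a * Suc y" using that by simp
      also have "\<dots> \<le> 2 ^ a * 2 ^ (s - a)" using that by (intro mult_le_mono) auto
      finally show ?thesis by (simp add: s)
    qed
    then show "(\<lambda>(x, y). x + 2 ^ a * y) \<in> {x. x < 2 ^ a \<and> U x} \<times> {y. y < 2 ^ (s - a) \<and> V y}
      \<rightarrow> {c. c < 2 ^ s \<and> U (c mod 2 ^ a) \<and> V (c div 2 ^ a)}"
      by auto
  qed auto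
  from bij_betw_same_card[OF this] show ?thesis by (simp add: card_cartesian_product)
qed

text \<open>
  The value \<open>Suc s\<close> signals that no prefix of the string of length more than \<open>k\<close> lies in \<open>P k\<close>.
\<close>

definition next_stage :: "(nat \<Rightarrow> nat \<Rightarrow> nat \<Rightarrow> bool) \<Rightarrow> nat \<Rightarrow> nat \<Rightarrow> nat \<Rightarrow> nat" where
  "next_stage P k s c = (LEAST j. s < j \<or> k < j \<and> P k j (take_bit j c))"

text \<open>The length at which the \<open>m\<close>th wait ends, each wait aiming at the set
  indexed by the length reached before. After a failed search the value stays
  \<open>Suc s\<close>.\<close>

definition stage :: "(nat \<Rightarrow> nat \<Rightarrow> nat \<Rightarrow> bool) \<Rightarrow> nat \<Rightarrow> nat \<Rightarrow> nat \<Rightarrow> nat" where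
  "stage P m s c = rec_nat 0 (\<lambda>_ k. next_stage P k s c) m"

lemma stage_simps [simp]:
  "stage P 0 s c = 0" "stage P (Suc m) s c = next_stage P (stage P m s c) s c"
  by (simp_all add: stage_def)

lemma next_stage_eq_iff:
  assumes "a \<le> s"
  shows "next_stage P k s c = a \<longleftrightarrow>
    k < a \<and> P k a (take_bit a c) \<and> (\<forall>j<a. \<not> (k < j \<and> P k j (take_bit j c)))"
proof -
  have Least_iff: "(LEAST j. W j) = a \<longleftrightarrow> W a \<and> (\<forall>j<a. \<not> W j)" if "\<exists>j. W j" for W :: "nat \<Rightarrow> bool"
    using that by (metis LeastI_ex linorder_less_linear not_less_Least)
  have "\<exists>j. s < j \<or> k < j \<and> P k j (take_bit j c)" using lessI by blast
  from Least_iff[OF this] show ?thesis unfolding next_stage_def using assms by auto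
qed

text \<open>Each search ends at its first success, which is judged by the bits read so far. A stage
  \<open>a\<close> inside the string thus depends on the first \<open>a\<close> bits only.\<close>

lemma stage_cong:
  assumes "a \<le> s" "a \<le> s'" "take_bit a c = take_bit a c'" "stage P m s c = a"
  shows "stage P m s' c' = a"
  using assms
proof (induction m arbitrary: a)
  case (Suc m)
  define b where "b = stage P m s c"
  have *: "b < a \<and> P b a (take_bit a c) \<and> (\<forall>j<a. \<not> (b < j \<and> P b j (take_bit j c)))"
    using Suc.prems next_stage_eq_iff[of a s P b c] by (simp add: b_def)
  have tb: "take_bit j c = take_bit j c'" if "j \<le> a" for j
    using arg_cong[OF Suc.prems(3), of "take_bit j"] that by (simp add: min_absorb1)
  have "stage P m s' c' = b"
  proof (rule Suc.IH)
    show "b \<le> s" "b \<le> s'" using * Suc.prems by linarith+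
    show "take_bit b c = take_bit b c'" by (rule tb) (use * in simp)
  qed (rule b_def[symmetric])
  moreover have "next_stage P b s' c' = a"
    unfolding next_stage_eq_iff[OF Suc.prems(2)] using * tb by (metis less_imp_le order_refl)
  ultimately show ?case by simp
qed simp

lemma recfn_stage:
  assumes P: "recpred 3 (\<lambda>xs. P (xs ! 0) (xs ! 1) (xs ! 2))"
    and "recfn k a" "recfn k b" "recfn k c"
  shows "recfn k (\<lambda>xs. stage P (a xs) (b xs) (c xs))"
proof (rule recfn_comp3[of "stage P"])
  have P': "recpred l (\<lambda>xs. P (u xs) (v xs) (w xs))" if "recfn l u" "recfn l v" "recfn l w" for l u v w
    using P that unfolding recpred_def by (rule recfn_comp3[where f = "\<lambda>m s c. of_bool (P m s c)"])
  have "recfn 3 (\<lambda>xs. LEAST j. xs ! 1 < j \<or> xs ! 0 < j \<and> P (xs ! 0) j (take_bit j (xs ! 2)))"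
  proof (rule recfn_Least)
    show "\<exists>y. xs ! 1 < y \<or> xs ! 0 < y \<and> P (xs ! 0) y (take_bit y (xs ! 2))" for xs :: "nat list"
      using lessI by blast
  qed (intro recfn_intros recfn_take_bit P'; simp)
  then have next3: "recfn 3 (\<lambda>xs. next_stage P (xs ! 0) (xs ! 1) (xs ! 2))"
    by (simp add: next_stage_def)
  show "recfn 3 (\<lambda>xs. stage P (xs ! 0) (xs ! 1) (xs ! 2))"
    unfolding stage_def
    by (intro recfn_rec_nat recfn_comp3[OF next3] recfn_intros) simp_all
qed (use assms in auto)

text \<open>Condition on the value \<open>a\<close> of stage \<open>m\<close>. That value is a
  matter of the first \<open>a\<close> bits, whereas \<open>P a\<close> ignores them by
  \<open>low\<close>, so independence yields a factor \<open>q / r\<close> in each round. Summing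
  over \<open>a\<close> restores the count of stage \<open>m\<close>.\<close>

lemma stage_card_bound:
  fixes P :: "nat \<Rightarrow> nat \<Rightarrow> nat \<Rightarrow> bool" and q r :: nat
  assumes mono: "\<And>k s s' c. s \<le> s' \<Longrightarrow> P k s c \<Longrightarrow> P k s' c"
    and dep: "\<And>k s c. P k s (take_bit s c) = P k s c"
    and low: "\<And>k s c. P k s (2 ^ k * (c div 2 ^ k)) = P k s c"
    and bound: "\<And>k s. card {c. c < 2 ^ s \<and> P k s c} * r \<le> q * 2 ^ s"
  shows "card {c. c < 2 ^ s \<and> stage P m s c \<le> s} * r ^ m \<le> q ^ m * 2 ^ s"
proof (induction m)
  case (Suc m)
  define X where "X a = card {x. x < 2 ^ a \<and> stage P m a x = a}" for a
  define Y where "Y a = card {y. y < 2 ^ (s - a) \<and> P a s (2 ^ a * y)}" for a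
  have stage_a: "stage P m s c = a \<longleftrightarrow> stage P m a (c mod 2 ^ a) = a" if "a \<le> s" for a c
    using stage_cong[of a s a c "c mod 2 ^ a" P m] stage_cong[of a a s "c mod 2 ^ a" c P m] that
    by (auto simp: take_bit_eq_mod)
  have XY: "card {c. c < 2 ^ s \<and> stage P m s c = a \<and> P a s c} = X a * Y a" if "a \<le> s" for a
  proof -
    have "{c. c < 2 ^ s \<and> stage P m s c = a \<and> P a s c}
      = {c. c < 2 ^ s \<and> stage P m a (c mod 2 ^ a) = a \<and> P a s (2 ^ a * (c div 2 ^ a))}"
      using stage_a[OF that] low by auto
    then show ?thesis unfolding X_def Y_def
      using card_mod_div_split[OF that, of "\<lambda>x. stage P m a x = a" "\<lambda>y. P a s (2 ^ a * y)"] by simp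
  qed
  have X: "card {c. c < 2 ^ s \<and> stage P m s c = a} = X a * 2 ^ (s - a)" if "a \<le> s" for a
  proof -
    have "{c. c < 2 ^ s \<and> stage P m s c = a} = {c. c < 2 ^ s \<and> stage P m a (c mod 2 ^ a) = a \<and> True}"
      using stage_a[OF that] by auto
    then show ?thesis unfolding X_def
      using card_mod_div_split[OF that, of "\<lambda>x. stage P m a x = a" "\<lambda>y. True"] by simp
  qed
  have Y: "Y a * r \<le> q * 2 ^ (s - a)" if "a \<le> s" for a
  proof -
    have "{c. c < 2 ^ s \<and> P a s c} = {c. c < 2 ^ s \<and> True \<and> P a s (2 ^ a * (c div 2 ^ a))}"
      using low by auto
    then have "card {c. c < 2 ^ s \<and> P a s c} = 2 ^ a * Y a" unfolding Y_def
      using card_mod_div_split[OF that, of "\<lambda>x. True" "\<lambda>y. P a s (2 ^ a * y)"] by simp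
    then have "2 ^ a * (Y a * r) \<le> q * 2 ^ s" using bound[of s a] by (simp add: mult.assoc)
    also have "q * 2 ^ s = 2 ^ a * (q * 2 ^ (s - a))" using that by (simp flip: power_add)
    finally show ?thesis by simp
  qed
  \<comment> \<open>The length of the last success is forgotten: by monotonicity \<open>P a\<close>
    still holds at the full length \<open>s\<close>, so only the split at \<open>a\<close>
    matters.\<close>
  have "{c. c < 2 ^ s \<and> stage P (Suc m) s c \<le> s}
      \<subseteq> (\<Union>a\<le>s. {c. c < 2 ^ s \<and> stage P m s c = a \<and> P a s c})"
  proof
    fix c assume c: "c \<in> {c. c < 2 ^ s \<and> stage P (Suc m) s c \<le> s}"
    define a where "a = stage P m s c"
    define a' where "a' = next_stage P a s c"
    have "a' \<le> s" using c by (simp add: a_def a'_def)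
    then have "a < a'" "P a a' (take_bit a' c)" using next_stage_eq_iff[of a' s P a c] by (auto simp: a'_def)
    then have "P a s c" using dep mono \<open>a' \<le> s\<close> by blast
    then show "c \<in> (\<Union>a\<le>s. {c. c < 2 ^ s \<and> stage P m s c = a \<and> P a s c})"
      using c \<open>a < a'\<close> \<open>a' \<le> s\<close> by (auto simp: a_def)
  qed
  then have "card {c. c < 2 ^ s \<and> stage P (Suc m) s c \<le> s}
      \<le> card (\<Union>a\<le>s. {c. c < 2 ^ s \<and> stage P m s c = a \<and> P a s c})"
    by (intro card_mono) auto
  also have "\<dots> \<le> (\<Sum>a\<le>s. card {c. c < 2 ^ s \<and> stage P m s c = a \<and> P a s c})"
    by (rule card_UN_le) simp
  also have "\<dots> = (\<Sum>a\<le>s. X a * Y a)" by (intro sum.cong) (auto simp: XY)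
  finally have "card {c. c < 2 ^ s \<and> stage P (Suc m) s c \<le> s} * r \<le> (\<Sum>a\<le>s. X a * Y a) * r"
    by (rule mult_le_mono1)
  also have "\<dots> = (\<Sum>a\<le>s. X a * (Y a * r))" by (simp add: sum_distrib_right mult.assoc)
  also have "\<dots> \<le> (\<Sum>a\<le>s. X a * (q * 2 ^ (s - a)))" by (intro sum_mono mult_le_mono2 Y) auto
  also have "\<dots> = q * (\<Sum>a\<le>s. card {c. c < 2 ^ s \<and> stage P m s c = a})"
    unfolding sum_distrib_left by (intro sum.cong) (auto simp: X)
  also have "(\<Sum>a\<le>s. card {c. c < 2 ^ s \<and> stage P m s c = a})
      = card (\<Union>a\<le>s. {c. c < 2 ^ s \<and> stage P m s c = a})"
    by (rule card_UN_disjoint[symmetric]) auto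
  also have "(\<Union>a\<le>s. {c. c < 2 ^ s \<and> stage P m s c = a}) = {c. c < 2 ^ s \<and> stage P m s c \<le> s}"
    by auto
  finally have "card {c. c < 2 ^ s \<and> stage P (Suc m) s c \<le> s} * r * r ^ m
      \<le> q * card {c. c < 2 ^ s \<and> stage P m s c \<le> s} * r ^ m" by (rule mult_le_mono1)
  also have "\<dots> \<le> q * (q ^ m * 2 ^ s)" using Suc.IH by (simp add: mult.assoc)
  finally show ?case by (simp add: mult.assoc)
qed simp

text \<open>One round of waiting gains only the factor \<open>(q - 1) / q\<close>, while the levels
  of a test must shrink by one half; \<open>d\<close> rounds together make one level.\<close>

lemma power_pred_halving:
  assumes "0 < q" shows "\<exists>d. 2 * (q - 1) ^ d \<le> (q :: nat) ^ d"
proof -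
  have "(\<lambda>d. (real (q - 1) / real q) ^ d) \<longlonglongrightarrow> 0"
    using assms by (intro LIMSEQ_realpow_zero) auto
  then have "\<forall>\<^sub>F d in sequentially. (real (q - 1) / real q) ^ d < 1 / 2"
    by (rule order_tendstoD) simp
  then obtain d where "(real (q - 1) / real q) ^ d < 1 / 2"
    by (auto simp: eventually_sequentially)
  then have "real (2 * (q - 1) ^ d) < real (q ^ d)" using assms by (simp add: power_divide field_simps)
  then show ?thesis by (intro exI[of _ d]) (simp only: of_nat_less_iff less_imp_le)
qed

text \<open>If \<open>A\<close> met every \<open>P k\<close>, all stages would succeed on it, and
  every \<open>d\<close>th stage would be a level of a test. The hypothesis \<open>low\<close> makes
  successive rounds independent.\<close>

lemma ml_random_avoids_tail_open:
  fixes P :: "nat \<Rightarrow> nat \<Rightarrow> nat \<Rightarrow> bool" and q :: nat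
  assumes A: "ml_random A"
    and P: "recpred 3 (\<lambda>xs. P (xs ! 0) (xs ! 1) (xs ! 2))"
    and mono: "\<And>k s s' c. s \<le> s' \<Longrightarrow> P k s c \<Longrightarrow> P k s' c"
    and dep: "\<And>k s c. P k s (take_bit s c) = P k s c"
    and low: "\<And>k s c. P k s (2 ^ k * (c div 2 ^ k)) = P k s c"
    and bound: "\<And>k s. card {c. c < 2 ^ s \<and> P k s c} * q \<le> (q - 1) * 2 ^ s" and "0 < q"
  shows "\<exists>k. \<forall>s. \<not> P k s (initial A s)"
proof (rule ccontr)
  assume "\<not> ?thesis"
  then have in_P: "\<exists>s. P k s (initial A s)" for k by blast
  obtain d where d: "2 * (q - 1) ^ d \<le> q ^ d" using power_pred_halving[OF \<open>0 < q\<close>] by blast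
  have "\<exists>m. \<forall>s. \<not> stage P (d * m) s (initial A s) \<le> s"
  proof (rule ml_random_avoids[OF A])
    show "recpred 3 (\<lambda>xs. stage P (d * xs ! 0) (xs ! 1) (xs ! 2) \<le> xs ! 1)"
      by (intro recfn_intros recfn_stage P) auto
    fix m s
    have "stage P (d * m) s c \<le> s" if "has_prefix (\<lambda>s c. stage P (d * m) s c \<le> s) s c" for c
    proof -
      from that obtain j where j: "j \<le> s" "stage P (d * m) j (take_bit j c) \<le> j"
        unfolding has_prefix_def by blast
      have "stage P (d * m) s c = stage P (d * m) j (take_bit j c)"
        by (rule stage_cong[OF j(2) _ _ refl]) (use j in \<open>auto simp: min_absorb1\<close>)
      then show ?thesis using j by simp
    qed
    then have "card {c. c < 2 ^ s \<and> has_prefix (\<lambda>s c. stage P (d * m) s c \<le> s) s c}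
        \<le> card {c. c < 2 ^ s \<and> stage P (d * m) s c \<le> s}"
      by (intro card_mono) auto
    then have "card {c. c < 2 ^ s \<and> has_prefix (\<lambda>s c. stage P (d * m) s c \<le> s) s c} * q ^ (d * m)
        \<le> card {c. c < 2 ^ s \<and> stage P (d * m) s c \<le> s} * q ^ (d * m)" by (rule mult_le_mono1)
    also have "\<dots> \<le> (q - 1) ^ (d * m) * 2 ^ s"
      by (rule stage_card_bound[OF mono dep low bound])
    finally have "card {c. c < 2 ^ s \<and> has_prefix (\<lambda>s c. stage P (d * m) s c \<le> s) s c} * q ^ (d * m) * 2 ^ m
        \<le> (q - 1) ^ (d * m) * 2 ^ s * 2 ^ m" by (rule mult_le_mono1)
    also have "\<dots> = (2 * (q - 1) ^ d) ^ m * 2 ^ s" by (simp add: power_mult power_mult_distrib)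
    also have "\<dots> \<le> (q ^ d) ^ m * 2 ^ s" by (intro mult_le_mono1 power_mono d) simp
    finally have "q ^ (d * m) * (card {c. c < 2 ^ s \<and> has_prefix (\<lambda>s c. stage P (d * m) s c \<le> s) s c} * 2 ^ m)
        \<le> q ^ (d * m) * 2 ^ s" by (simp add: power_mult mult_ac)
    then show "card {c. c < 2 ^ s \<and> has_prefix (\<lambda>s c. stage P (d * m) s c \<le> s) s c} * 2 ^ m \<le> 2 ^ s"
      using \<open>0 < q\<close> by simp
  qed
  moreover have "\<exists>s. stage P m s (initial A s) \<le> s" for m
  proof (induction m)
    case (Suc m)
    then obtain s0 where s0: "stage P m s0 (initial A s0) \<le> s0" by blast
    define a where "a = stage P m s0 (initial A s0)"
    obtain s where s: "P a s (initial A s)" using in_P by blast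
    \<comment> \<open>\<open>Suc a\<close> is included because the next stage must be strictly
      longer than \<open>a\<close>; monotonicity permits the delay.\<close>
    define s1 where "s1 = max (Suc a) (max s s0)"
    have "stage P m s1 (initial A s1) = a"
      by (rule stage_cong[OF _ _ _ a_def[symmetric]]) (use s0 in \<open>auto simp: a_def s1_def min_absorb1\<close>)
    moreover have "P a s1 (initial A s1)"
    proof -
      have "P a s (take_bit s (initial A s1))" using s by (simp add: s1_def min_absorb1)
      then show ?thesis unfolding dep by (rule mono[rotated]) (simp add: s1_def)
    qed
    then have "next_stage P a s1 (initial A s1) \<le> s1"
      unfolding next_stage_def by (intro Least_le) (auto simp: s1_def)
    ultimately show ?case by auto
  qed auto
  ultimately show False by blast
qed


section \<open>Computing the coded real\<close>

text \<open>
  \<open>G n i m s c\<close> means that on the string \<open>(s, c)\<close> the functional gives the answer \<open>i\<close> for \<open>n\<close>,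
  where \<open>m\<close> is the coding place consulted or, for partial oracles, the number of bits withheld. The set
  \<open>forced G n i k\<close> is the set \<open>U k\<close> above.
\<close>

definition forced :: "(nat \<Rightarrow> nat \<Rightarrow> nat \<Rightarrow> nat \<Rightarrow> nat \<Rightarrow> bool) \<Rightarrow> nat \<Rightarrow> nat \<Rightarrow> nat \<Rightarrow> nat \<Rightarrow> nat \<Rightarrow> bool" where
  "forced G n i k s c \<longleftrightarrow> (\<forall>t<2 ^ k. \<exists>m<s. k \<le> m \<and> G n i m s (t + 2 ^ k * (c div 2 ^ k)))"

lemma geometric_tail: "(\<Sum>n\<in>{m..<m + l}. (1 / 2 :: real) ^ Suc n) \<le> (1 / 2) ^ m"
proof -
  have "(\<Sum>n\<in>{m..<m + l}. (1 / 2 :: real) ^ Suc n) = (1 / 2) ^ m - (1 / 2) ^ (m + l)"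
    by (induction l) auto
  then show ?thesis by simp
qed

text \<open>The common core of the four cases. \<open>found\<close> ranges over all finite
  modifications of \<open>A\<close>, which puts \<open>A\<close> into every set of the decreasing
  sequence; \<open>wrong\<close> concerns \<open>A\<close> alone and allows finitely many
  exceptions, since total reductions may err at finitely many coding places.\<close>

locale coding_functional =
  fixes G :: "nat \<Rightarrow> nat \<Rightarrow> nat \<Rightarrow> nat \<Rightarrow> nat \<Rightarrow> bool" and A B :: "nat set"
  assumes random: "ml_random A"
    and rec: "recpred 5 (\<lambda>xs. G (xs ! 0) (xs ! 1) (xs ! 2) (xs ! 3) (xs ! 4))"
    and mono: "\<And>n i m s s' c. s \<le> s' \<Longrightarrow> G n i m s c \<Longrightarrow> G n i m s' c"
    and dep: "\<And>n i m s c. G n i m s (take_bit s c) = G n i m s c"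
    and found: "\<And>C n k. finite {x. (x \<in> A) \<noteq> (x \<in> C)} \<Longrightarrow>
      \<exists>m\<ge>k. \<exists>s. G n (of_bool (n \<in> B)) m s (initial C s)"
    and wrong: "finite {n. \<exists>m s. G n (of_bool (n \<notin> B)) m s (initial A s)}"
begin

lemma recpred_G:
  assumes "recfn k a" "recfn k b" "recfn k c" "recfn k d" "recfn k e"
  shows "recpred k (\<lambda>xs. G (a xs) (b xs) (c xs) (d xs) (e xs))"
  using rec assms unfolding recpred_def
  by (rule recfn_comp5[where f = "\<lambda>a b c d e. of_bool (G a b c d e)"])

lemma recpred_forced:
  assumes "recfn l a" "recfn l b" "recfn l k" "recfn l s" "recfn l c"
  shows "recpred l (\<lambda>xs. forced G (a xs) (b xs) (k xs) (s xs) (c xs))"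
proof -
  have "recpred 5 (\<lambda>xs. forced G (xs ! 0) (xs ! 1) (xs ! 2) (xs ! 3) (xs ! 4))"
    unfolding forced_def by (intro recfn_intros recpred_G) simp_all
  then show ?thesis unfolding recpred_def
    by (rule recfn_comp5[where f = "\<lambda>a b c d e. of_bool (forced G a b c d e)"]) fact+
qed

lemma forced_mono: "s \<le> s' \<Longrightarrow> forced G n i k s c \<Longrightarrow> forced G n i k s' c"
  unfolding forced_def using mono less_le_trans by meson

lemma forced_dep: "forced G n i k s (take_bit s c) = forced G n i k s c"
proof -
  have "G n i m s (t + 2 ^ k * (take_bit s c div 2 ^ k)) = G n i m s (t + 2 ^ k * (c div 2 ^ k))"
    if "t < 2 ^ k" for m t
  proof -
    have "take_bit s (t + 2 ^ k * (take_bit s c div 2 ^ k)) = take_bit s (t + 2 ^ k * (c div 2 ^ k))"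
      by (rule bit_eqI) (auto simp: bit_take_bit_iff bit_splice[OF that])
    then show ?thesis using dep by metis
  qed
  then show ?thesis unfolding forced_def by blast
qed

lemma forced_low: "forced G n i k s (2 ^ k * (c div 2 ^ k)) = forced G n i k s c"
  by (simp add: forced_def)

lemma forced_0: "forced G n i 0 s c \<longleftrightarrow> (\<exists>m<s. G n i m s c)"
  by (simp add: forced_def)

lemma forced_imp_forced_0: "forced G n i k s c \<Longrightarrow> forced G n i 0 s c"
proof -
  assume "forced G n i k s c"
  \<comment> \<open>Overwriting the first \<open>k\<close> bits of \<open>c\<close> with themselves
    recovers \<open>c\<close>.\<close>
  moreover have "c mod 2 ^ k < 2 ^ k" by simp
  ultimately obtain m where "m < s" "G n i m s (c mod 2 ^ k + 2 ^ k * (c div 2 ^ k))"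
    unfolding forced_def by blast
  then show ?thesis unfolding forced_0 by auto
qed

text \<open>Every choice of the first \<open>k\<close> bits gives a finite modification of
  \<open>A\<close>, to which \<open>found\<close> applies. There are only \<open>2 ^ k\<close>
  choices, so a common length exists.\<close>

lemma A_forced: "\<exists>s. forced G n (of_bool (n \<in> B)) k s (initial A s)"
proof -
  have "\<exists>m s. k \<le> m \<and> G n (of_bool (n \<in> B)) m s (t + 2 ^ k * (initial A s div 2 ^ k))" if t: "t < 2 ^ k" for t
  proof -
    define C where "C = {x. if x < k then bit t x else x \<in> A}"
    have "finite {x. (x \<in> A) \<noteq> (x \<in> C)}"
      by (rule finite_subset[of _ "{..<k}"]) (auto simp: C_def)
    then obtain m s where ms: "k \<le> m" "G n (of_bool (n \<in> B)) m s (initial C s)" using found by blast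
    have "take_bit s (t + 2 ^ k * (initial A s div 2 ^ k)) = initial C s"
      by (rule bit_eqI) (auto simp: bit_take_bit_iff bit_splice[OF t] C_def)
    then show ?thesis using ms dep by metis
  qed
  then obtain m s where ms: "\<And>t. t < 2 ^ k \<Longrightarrow> k \<le> m t \<and>
      G n (of_bool (n \<in> B)) (m t) (s t) (t + 2 ^ k * (initial A (s t) div 2 ^ k))" by metis
  \<comment> \<open>\<open>Suc (m t)\<close> enters because \<open>forced\<close> looks for
    \<open>m\<close> below the length.\<close>
  define S where "S = Max (insert 0 ((\<lambda>t. max (s t) (Suc (m t))) ` {..<2 ^ k}))"
  have S: "s t \<le> S" "m t < S" if "t < 2 ^ k" for t
  proof -
    have "max (s t) (Suc (m t)) \<le> S" unfolding S_def using that by (intro Max_ge) auto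
    then show "s t \<le> S" "m t < S" by auto
  qed
  have "G n (of_bool (n \<in> B)) (m t) S (t + 2 ^ k * (initial A S div 2 ^ k))" if t: "t < 2 ^ k" for t
  proof -
    have "take_bit (s t) (t + 2 ^ k * (initial A S div 2 ^ k)) = take_bit (s t) (t + 2 ^ k * (initial A (s t) div 2 ^ k))"
      by (rule bit_eqI) (use S[OF t] in \<open>auto simp: bit_take_bit_iff bit_splice[OF t]\<close>)
    then have "G n (of_bool (n \<in> B)) (m t) (s t) (t + 2 ^ k * (initial A S div 2 ^ k))"
      using ms[OF t] dep by metis
    then show ?thesis using mono S[OF t] by blast
  qed
  then have "forced G n (of_bool (n \<in> B)) k S (initial A S)"
    unfolding forced_def using ms S by blast
  then show ?thesis ..
qed

text \<open>Denominators are cleared to keep the condition decidable on numbers. The exponent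
  \<open>n + 2\<close> leaves room for two candidates \<open>i\<close>: the complements for all
  \<open>n\<close> from \<open>m\<close> on add up to at most \<open>2 ^ - m\<close>.\<close>

definition likely :: "nat \<Rightarrow> nat \<Rightarrow> nat \<Rightarrow> bool" where
  "likely n i s \<longleftrightarrow> (2 ^ (n + 2) - 1) * 2 ^ s < card {c. c < 2 ^ s \<and> forced G n i 0 s c} * 2 ^ (n + 2)"

lemma likely_exists: "\<exists>s. likely n (of_bool (n \<in> B)) s"
proof (rule ccontr)
  assume "\<not> ?thesis"
  then have le: "card {c. c < 2 ^ s \<and> forced G n (of_bool (n \<in> B)) 0 s c} * 2 ^ (n + 2) \<le> (2 ^ (n + 2) - 1) * 2 ^ s" for s
    unfolding likely_def not_ex not_less by blast
  \<comment> \<open>Failure of \<open>likely\<close> at every length bounds the zeroth set away from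
    measure 1, and the other sets are contained in it.\<close>
  have "\<exists>k. \<forall>s. \<not> forced G n (of_bool (n \<in> B)) k s (initial A s)"
  proof (rule ml_random_avoids_tail_open[OF random, where q = "2 ^ (n + 2)"])
    fix k s
    have "card {c. c < 2 ^ s \<and> forced G n (of_bool (n \<in> B)) k s c} \<le> card {c. c < 2 ^ s \<and> forced G n (of_bool (n \<in> B)) 0 s c}"
      by (intro card_mono) (auto intro: forced_imp_forced_0)
    then show "card {c. c < 2 ^ s \<and> forced G n (of_bool (n \<in> B)) k s c} * 2 ^ (n + 2) \<le> (2 ^ (n + 2) - 1) * 2 ^ s"
      using le[of s] by (meson mult_le_mono1 order_trans)
  next
    show "recpred 3 (\<lambda>xs. forced G n (of_bool (n \<in> B)) (xs ! 0) (xs ! 1) (xs ! 2))"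
      by (intro recpred_forced recfn_intros recfn_const) simp_all
  qed (use forced_mono forced_dep forced_low in auto)
  then show False using A_forced by blast
qed

lemma likely_mono:
  assumes "s \<le> s'" "likely n i s" shows "likely n i s'"
proof -
  have p: "(2::nat) ^ s' = 2 ^ s * 2 ^ (s' - s)" using assms(1) by (simp flip: power_add)
  have "card {c. c < 2 ^ s \<and> forced G n i 0 s c} * 2 ^ (s' - s)
      = card {c. c < 2 ^ s' \<and> forced G n i 0 s (c mod 2 ^ s) \<and> True}"
    using card_mod_div_split[OF assms(1), of "forced G n i 0 s" "\<lambda>_. True"] by simp
  also have "\<dots> \<le> card {c. c < 2 ^ s' \<and> forced G n i 0 s' c}"
    using forced_mono[OF assms(1), of n i 0] forced_dep[of n i 0 s]
    by (intro card_mono) (auto simp: take_bit_eq_mod)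
  finally have *: "card {c. c < 2 ^ s \<and> forced G n i 0 s c} * 2 ^ (s' - s) \<le> card {c. c < 2 ^ s' \<and> forced G n i 0 s' c}" .
  have "(2 ^ (n + 2) - 1) * 2 ^ s' = (2 ^ (n + 2) - 1) * 2 ^ s * (2 ^ (s' - s) :: nat)" by (simp add: p)
  also have "\<dots> < card {c. c < 2 ^ s \<and> forced G n i 0 s c} * 2 ^ (n + 2) * 2 ^ (s' - s)"
    using assms(2) unfolding likely_def by (intro mult_strict_right_mono) auto
  also have "\<dots> = card {c. c < 2 ^ s \<and> forced G n i 0 s c} * 2 ^ (s' - s) * 2 ^ (n + 2)" by (simp add: mult_ac)
  also have "\<dots> \<le> card {c. c < 2 ^ s' \<and> forced G n i 0 s' c} * 2 ^ (n + 2)" by (rule mult_le_mono1[OF *])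
  finally show ?thesis by (simp add: likely_def)
qed

definition refutes :: "nat \<Rightarrow> nat \<Rightarrow> nat \<Rightarrow> nat \<Rightarrow> bool" where
  "refutes n i s c \<longleftrightarrow> likely n i s \<and> \<not> forced G n i 0 s c"

lemma recpred_likely:
  "recfn k a \<Longrightarrow> recfn k b \<Longrightarrow> recfn k c \<Longrightarrow> recpred k (\<lambda>xs. likely (a xs) (b xs) (c xs))"
proof -
  assume *: "recfn k a" "recfn k b" "recfn k c"
  have "recpred 3 (\<lambda>xs. likely (xs ! 0) (xs ! 1) (xs ! 2))"
    unfolding likely_def by (intro recfn_intros recpred_forced) simp_all
  then show ?thesis unfolding recpred_def
    by (rule recfn_comp3[where f = "\<lambda>a b c. of_bool (likely a b c)"]) fact+
qed

text \<open>Let \<open>j\<close> be the least length at which \<open>likely\<close> holds. Forced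
  strings stay forced when extended, so a refutation at any later prefix is already one at
  \<open>j\<close>, and a single complement, of relative size at most \<open>2 ^ - (n + 2)\<close>,
  contains them all.\<close>

lemma card_refutes:
  "card {c. c < 2 ^ s \<and> has_prefix (refutes n i) s c} * 2 ^ (n + 2) \<le> 2 ^ s"
proof (cases "\<exists>j\<le>s. likely n i j")
  case True
  define j where "j = (LEAST j. likely n i j)"
  have j: "likely n i j" "j \<le> s"
    using True unfolding j_def by (auto intro: LeastI Least_le[THEN order_trans])
  have min: "j \<le> j'" if "likely n i j'" for j' unfolding j_def using that by (rule Least_le)
  have "{c. c < 2 ^ s \<and> has_prefix (refutes n i) s c}
      \<subseteq> {c. c < 2 ^ s \<and> \<not> forced G n i 0 j (c mod 2 ^ j) \<and> True}"
  proof
    fix c assume "c \<in> {c. c < 2 ^ s \<and> has_prefix (refutes n i) s c}"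
    then obtain j' where c: "c < 2 ^ s" and j': "likely n i j'" "\<not> forced G n i 0 j' (take_bit j' c)"
      by (auto simp: has_prefix_def refutes_def)
    have "\<not> forced G n i 0 j c"
      using j'(2) forced_dep forced_mono[OF min[OF j'(1)]] by blast
    then show "c \<in> {c. c < 2 ^ s \<and> \<not> forced G n i 0 j (c mod 2 ^ j) \<and> True}"
      using c forced_dep[of n i 0 j c] by (simp add: take_bit_eq_mod)
  qed
  then have "card {c. c < 2 ^ s \<and> has_prefix (refutes n i) s c}
      \<le> card {c. c < 2 ^ s \<and> \<not> forced G n i 0 j (c mod 2 ^ j) \<and> True}"
    by (intro card_mono) auto
  also have "\<dots> = card {c. c < 2 ^ j \<and> \<not> forced G n i 0 j c} * 2 ^ (s - j)"
    using card_mod_div_split[OF j(2), of "\<lambda>c. \<not> forced G n i 0 j c" "\<lambda>_. True"] by simp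
  finally have 1: "card {c. c < 2 ^ s \<and> has_prefix (refutes n i) s c}
      \<le> card {c. c < 2 ^ j \<and> \<not> forced G n i 0 j c} * 2 ^ (s - j)" .
  have "card {c. c < 2 ^ j \<and> forced G n i 0 j c} + card {c. c < 2 ^ j \<and> \<not> forced G n i 0 j c}
      = card ({c. c < 2 ^ j \<and> forced G n i 0 j c} \<union> {c. c < 2 ^ j \<and> \<not> forced G n i 0 j c})"
    by (rule card_Un_disjoint[symmetric]) auto
  also have "{c. c < 2 ^ j \<and> forced G n i 0 j c} \<union> {c. c < 2 ^ j \<and> \<not> forced G n i 0 j c} = {..<2 ^ j}"
    by auto
  finally have sum: "card {c. c < 2 ^ j \<and> forced G n i 0 j c} * 2 ^ (n + 2)
      + card {c. c < 2 ^ j \<and> \<not> forced G n i 0 j c} * 2 ^ (n + 2) = 2 ^ j * 2 ^ (n + 2)"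
    by (simp flip: add_mult_distrib)
  have "(2 ^ (n + 2) - 1) * 2 ^ j + 2 ^ j = 2 ^ j * (2 ^ (n + 2) :: nat)"
    by (simp add: diff_mult_distrib)
  then have 2: "card {c. c < 2 ^ j \<and> \<not> forced G n i 0 j c} * 2 ^ (n + 2) \<le> 2 ^ j"
    using sum j(1) unfolding likely_def by linarith
  have "card {c. c < 2 ^ s \<and> has_prefix (refutes n i) s c} * 2 ^ (n + 2)
     \<le> card {c. c < 2 ^ j \<and> \<not> forced G n i 0 j c} * 2 ^ (s - j) * 2 ^ (n + 2)"
    by (rule mult_le_mono1[OF 1])
  also have "\<dots> = card {c. c < 2 ^ j \<and> \<not> forced G n i 0 j c} * 2 ^ (n + 2) * 2 ^ (s - j)" by (simp add: mult_ac)
  also have "\<dots> \<le> 2 ^ j * 2 ^ (s - j)" by (rule mult_le_mono1[OF 2])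
  also have "\<dots> = 2 ^ s" using j(2) by (simp flip: power_add)
  finally show ?thesis .
next
  case False
  then have "{c. c < 2 ^ s \<and> has_prefix (refutes n i) s c} = {}"
    by (auto simp: has_prefix_def refutes_def)
  then show ?thesis by (metis card.empty mult_0 zero_le)
qed

lemma likely_correct: "finite {n. \<exists>i<2. i \<noteq> of_bool (n \<in> B) \<and> (\<exists>s. likely n i s)}"
proof -
  \<comment> \<open>The bound \<open>n < Suc s\<close> makes the predicate decidable. It costs
    nothing, since \<open>likely\<close> persists and can be consulted at length
    \<open>max n s\<close>.\<close>
  have "\<exists>m. \<forall>s. \<not> (\<exists>n<Suc s. m \<le> n \<and> (\<exists>i<2. refutes n i s (initial A s)))"
  proof (rule ml_random_avoids[OF random])
    show "recpred 3 (\<lambda>xs. \<exists>n<Suc (xs ! 1). xs ! 0 \<le> n \<and> (\<exists>i<2. refutes n i (xs ! 1) (xs ! 2)))"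
      unfolding refutes_def by (intro recfn_intros recpred_likely recpred_forced) simp_all
    fix m s
    have "card {c. c < 2 ^ s \<and> has_prefix (\<lambda>s c. \<exists>n<Suc s. m \<le> n \<and> (\<exists>i<2. refutes n i s c)) s c}
      \<le> card (\<Union>n\<in>{m..<m + Suc s}. \<Union>i<2. {c. c < 2 ^ s \<and> has_prefix (refutes n i) s c})"
      by (intro card_mono) (fastforce simp: has_prefix_def)+
    also have "\<dots> \<le> (\<Sum>n\<in>{m..<m + Suc s}. card (\<Union>i<2. {c. c < 2 ^ s \<and> has_prefix (refutes n i) s c}))"
      by (rule card_UN_le) simp
    also have "\<dots> \<le> (\<Sum>n\<in>{m..<m + Suc s}. \<Sum>i<2. card {c. c < 2 ^ s \<and> has_prefix (refutes n i) s c})"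
      by (intro sum_mono card_UN_le) simp
    finally have "real (card {c. c < 2 ^ s \<and> has_prefix (\<lambda>s c. \<exists>n<Suc s. m \<le> n \<and> (\<exists>i<2. refutes n i s c)) s c})
      \<le> real (\<Sum>n\<in>{m..<m + Suc s}. \<Sum>i<2. card {c. c < 2 ^ s \<and> has_prefix (refutes n i) s c})"
      by (rule of_nat_mono)
    also have "\<dots> = (\<Sum>n\<in>{m..<m + Suc s}. \<Sum>i<2. real (card {c. c < 2 ^ s \<and> has_prefix (refutes n i) s c}))"
      by simp
    also have "\<dots> \<le> (\<Sum>n\<in>{m..<m + Suc s}. \<Sum>i<2::nat. 2 ^ s * (1 / 2) ^ (n + 2))"
    proof (intro sum_mono)
      fix n i
      have "real (card {c. c < 2 ^ s \<and> has_prefix (refutes n i) s c} * 2 ^ (n + 2)) \<le> real (2 ^ s)"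
        using card_refutes by (rule of_nat_mono)
      then show "real (card {c. c < 2 ^ s \<and> has_prefix (refutes n i) s c}) \<le> 2 ^ s * (1 / 2) ^ (n + 2)"
        by (simp add: field_simps)
    qed
    also have "\<dots> = 2 ^ s * (\<Sum>n\<in>{m..<m + Suc s}. (1 / 2) ^ Suc n)"
      unfolding sum_distrib_left by (intro sum.cong refl) simp
    also have "\<dots> \<le> 2 ^ s * (1 / 2) ^ m"
      by (intro mult_left_mono geometric_tail) simp
    finally have "real (card {c. c < 2 ^ s \<and> has_prefix (\<lambda>s c. \<exists>n<Suc s. m \<le> n \<and> (\<exists>i<2. refutes n i s c)) s c} * 2 ^ m)
      \<le> real (2 ^ s)" by (simp add: field_simps)
    then show "card {c. c < 2 ^ s \<and> has_prefix (\<lambda>s c. \<exists>n<Suc s. m \<le> n \<and> (\<exists>i<2. refutes n i s c)) s c} * 2 ^ m \<le> 2 ^ s"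
      by (simp only: of_nat_le_iff)
  qed
  then obtain m where m: "\<And>s n i. n < Suc s \<Longrightarrow> m \<le> n \<Longrightarrow> i < 2 \<Longrightarrow> \<not> refutes n i s (initial A s)" by blast
  have "{n. \<exists>i<2. i \<noteq> of_bool (n \<in> B) \<and> (\<exists>s. likely n i s)}
      \<subseteq> {..<m} \<union> {n. \<exists>m s. G n (of_bool (n \<notin> B)) m s (initial A s)}"
  proof
    fix n assume "n \<in> {n. \<exists>i<2. i \<noteq> of_bool (n \<in> B) \<and> (\<exists>s. likely n i s)}"
    then obtain i s where i: "i < 2" "i \<noteq> of_bool (n \<in> B)" "likely n i s" by blast
    then have i': "i = of_bool (n \<notin> B)" by (auto simp: less_2_cases_iff)
    show "n \<in> {..<m} \<union> {n. \<exists>m s. G n (of_bool (n \<notin> B)) m s (initial A s)}"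
    proof (cases "n < m")
      case False
      then have "\<not> refutes n i (max n s) (initial A (max n s))" using m[of n "max n s" i] i by simp
      moreover have "likely n i (max n s)" by (rule likely_mono[OF _ i(3)]) simp
      ultimately have "forced G n i 0 (max n s) (initial A (max n s))" by (simp add: refutes_def)
      then show ?thesis unfolding forced_0 i' by blast
    qed simp
  qed
  then show ?thesis using wrong by (meson finite_UnI finite_lessThan finite_subset)
qed

theorem computable_B: "computable B"
proof -
  \<comment> \<open>One number carries the candidate answer, as its parity, and the length
    searched.\<close>
  define f where "f n = (LEAST z. likely n (z mod 2) (z div 2))" for n
  define B' where "B' = {n. f n mod 2 = 1}"
  have ex: "\<exists>z. likely n (z mod 2) (z div 2)" for n
  proof -
    obtain s where "likely n (of_bool (n \<in> B)) s" using likely_exists by blast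
    then show ?thesis by (intro exI[of _ "2 * s + of_bool (n \<in> B)"]) simp
  qed
  have "recfn 1 (\<lambda>xs. LEAST z. likely (xs ! 0) (z mod 2) (z div 2))"
    by (intro recfn_Least ex recpred_likely recfn_intros) simp_all
  then have "recpred 1 (\<lambda>xs. f (xs ! 0) mod 2 = 1)"
    unfolding f_def by (intro recfn_intros)
  then have "computable B'" by (simp add: computable_iff_recpred B'_def)
  moreover have "finite {n. (n \<in> B') \<noteq> (n \<in> B)}"
  proof (rule finite_subset[OF _ likely_correct], intro subsetI CollectI)
    fix n assume n: "n \<in> {n. (n \<in> B') \<noteq> (n \<in> B)}"
    have "likely n (f n mod 2) (f n div 2)" unfolding f_def by (rule LeastI_ex[OF ex])
    moreover have "f n mod 2 \<noteq> of_bool (n \<in> B)" using n by (auto simp: B'_def)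
    moreover have "f n mod 2 < 2" by simp
    ultimately show "\<exists>i<2. i \<noteq> of_bool (n \<in> B) \<and> (\<exists>s. likely n i s)" by blast
  qed
  ultimately show ?thesis by (rule computable_finite_diff)
qed

end


section \<open>Functionals from the four reducibilities\<close>

lemma odd_times_power_unique:
  assumes "(2 * w + 1) * 2 ^ n = (2 * w' + 1) * (2 :: nat) ^ n'" shows "n = n'"
proof -
  have False if "(2 * w + 1) * 2 ^ n = (2 * w' + 1) * (2 :: nat) ^ n'" "n < n'" for w w' n n'
  proof -
    have "(2::nat) ^ n' = 2 ^ n * 2 ^ (n' - n)" using that(2) by (simp flip: power_add)
    then have "2 ^ n * (2 * w + 1) = 2 ^ n * ((2 * w' + 1) * (2 :: nat) ^ (n' - n))" using that(1) by (simp add: mult_ac)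
    then have "2 * w + 1 = (2 * w' + 1) * (2 :: nat) ^ (n' - n)" by (simp only: mult_left_cancel[OF power_not_zero] mult_cancel1) simp
    moreover have "even ((2 * w' + 1) * (2 :: nat) ^ (n' - n))" using that(2) by simp
    ultimately show False by (metis even_plus_one_iff even_mult_iff dvd_refl)
  qed
  then show ?thesis using assms by (metis linorder_neqE_nat)
qed

definition in_column :: "nat \<Rightarrow> nat \<Rightarrow> bool" where
  "in_column j n \<longleftrightarrow> (\<exists>w<Suc j. j = (2 * w + 1) * 2 ^ n)"

lemma in_column_iff: "in_column j n \<longleftrightarrow> (\<exists>w. j = (2 * w + 1) * 2 ^ n)"
proof
  assume "\<exists>w. j = (2 * w + 1) * 2 ^ n"
  then obtain w where w: "j = (2 * w + 1) * 2 ^ n" ..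
  have "w \<le> (2 * w + 1) * 1" by simp
  also have "\<dots> \<le> j" unfolding w by (intro mult_le_mono2) simp
  finally show "in_column j n" using w unfolding in_column_def by (intro exI[of _ w]) simp
qed (auto simp: in_column_def)

lemma in_column_code: "in_column j n \<Longrightarrow> j \<in> column_code X \<longleftrightarrow> n \<in> X"
  unfolding in_column_iff column_code_def using odd_times_power_unique by blast

text \<open>Finitely many faulty places can thus spoil only finitely many \<open>n\<close>.\<close>

lemma in_column_le: "in_column j n \<Longrightarrow> n \<le> j"
proof -
  assume "in_column j n"
  then obtain w where w: "j = (2 * w + 1) * 2 ^ n" unfolding in_column_iff by blast
  have "n \<le> 1 * 2 ^ n" using less_exp[of n] by simp
  also have "\<dots> \<le> j" unfolding w by (intro mult_le_mono1) simp
  finally show ?thesis .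
qed

lemma infinite_column: "infinite {j. in_column j n}"
proof -
  have "inj (\<lambda>w. (2 * w + 1) * (2::nat) ^ n)" by (auto simp: inj_def)
  then have "infinite (range (\<lambda>w. (2 * w + 1) * (2::nat) ^ n))" by (simp add: finite_image_iff)
  moreover have "range (\<lambda>w. (2 * w + 1) * 2 ^ n) \<subseteq> {j. in_column j n}" by (auto simp: in_column_iff)
  ultimately show ?thesis using infinite_super by blast
qed

text \<open>Every bit is coded infinitely often, so finitely many faulty places leave sound ones
  arbitrarily late.\<close>

lemma in_column_large: "finite F \<Longrightarrow> \<exists>j\<ge>k. in_column j n \<and> j \<notin> F"
proof -
  assume "finite F"
  then have "infinite ({j. in_column j n} - ({..<k} \<union> F))"
    using infinite_column by (simp add: Diff_infinite_finite)
  from infinite_imp_nonempty[OF this] obtain j where "j \<in> {j. in_column j n} - ({..<k} \<union> F)" by blast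
  then show ?thesis by (intro exI[of _ j]) auto
qed

lemma recpred_in_column: "recfn k a \<Longrightarrow> recfn k b \<Longrightarrow> recpred k (\<lambda>xs. in_column (a xs) (b xs))"
proof -
  assume *: "recfn k a" "recfn k b"
  have "recpred 2 (\<lambda>xs. in_column (xs ! 0) (xs ! 1))"
    unfolding in_column_def by (intro recfn_intros) simp_all
  then show ?thesis
    unfolding recpred_def by (rule recfn_comp2[where f = "\<lambda>a b. of_bool (in_column a b)"]) fact+
qed

lemma interval_code_iff: "2 ^ j \<le> x \<Longrightarrow> x < 2 ^ (j + 1) \<Longrightarrow> x \<in> interval_code X \<longleftrightarrow> j \<in> X"
proof -
  assume j: "2 ^ j \<le> x" "x < 2 ^ (j + 1)"
  have "i = j" if "2 ^ i \<le> x" "x < 2 ^ (i + 1)" for i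
  proof -
    have "(2::nat) ^ i < 2 ^ (j + 1)" "(2::nat) ^ j < 2 ^ (i + 1)" using that j by linarith+
    then have "i < j + 1" "j < i + 1" by (simp_all only: power_strict_increasing_iff one_less_numeral_iff semiring_norm(76))
    then show ?thesis by simp
  qed
  then show ?thesis using j unfolding interval_code_def by blast
qed

text \<open>For large \<open>m\<close> this is the same oracle for \<open>A\<close> and for a given
  finite modification of \<open>A\<close>, which brings modifications within reach of reductions
  that speak of partial oracles for \<open>A\<close> only.\<close>

definition tail_oracle :: "nat set \<Rightarrow> nat \<Rightarrow> partial_oracle" where
  "tail_oracle C m = {(j, x, l). m \<le> j \<and> x = (j \<in> C) \<and> l = 0}"

lemma tail_oracle_code:
  "y \<in> oracle_code (tail_oracle C m) \<longleftrightarrow> m \<le> fst (prod_decode y)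
    \<and> fst (prod_decode (snd (prod_decode y))) = of_bool (fst (prod_decode y) \<in> C)
    \<and> snd (prod_decode (snd (prod_decode y))) = 0"
proof -
  obtain j x l where y: "y = prod_encode (j, prod_encode (x, l))"
    by (metis prod.collapse prod_decode_inverse)
  show ?thesis unfolding y by (auto simp: oracle_code_def tail_oracle_def image_iff)
qed

lemma cofinite_tail_oracle: "cofinite_oracle A (tail_oracle A m)"
proof -
  have "- oracle_dom (tail_oracle A m) = {..<m}" by (auto simp: oracle_dom_def tail_oracle_def)
  then show ?thesis by (auto simp: cofinite_oracle_def partial_oracle_for_def tail_oracle_def)
qed

text \<open>A query about a withheld position or with a non-zero delay is answered 0 whatever the
  bits are; only a position beyond the known string leaves the answer open.\<close>

definition tail_query :: "nat \<Rightarrow> nat \<Rightarrow> nat \<Rightarrow> nat \<Rightarrow> nat option" where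
  "tail_query m s c y =
     (if m \<le> fst (prod_decode y) \<and> snd (prod_decode (snd (prod_decode y))) = 0
      then if fst (prod_decode y) < s
        then Some (of_bool (fst (prod_decode (snd (prod_decode y))) = of_bool (bit c (fst (prod_decode y)))))
        else None
      else Some 0)"

definition real_query :: "nat \<Rightarrow> nat \<Rightarrow> nat \<Rightarrow> nat option" where
  "real_query s c y = (if y < s then Some (of_bool (bit c y)) else None)"

lemma recpred_bounded_run3:
  assumes q: "recfn 4 (\<lambda>xs. opt_code (q (xs ! 3) (xs ! 1) (xs ! 2) (xs ! 0)))"
    and "recfn k m" "recfn k s" "recfn k c" "recfn k x" "recfn k i"
  shows "recpred k (\<lambda>xs. bounded_run (q (m xs) (s xs) (c xs)) (s xs) p [x xs] = Some (i xs))"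
proof -
  \<comment> \<open>\<open>bounded_code\<close> puts the queried number first and the bound next,
    hence this order of the arguments.\<close>
  define Q where "Q = (\<lambda>xs. opt_code (q (xs ! 3) (xs ! 1) (xs ! 2) (xs ! 0)))"
  have "recfn (1 + 3) (bounded_code Q p 1)"
    by (rule recfn_bounded_code) (use q in \<open>simp_all add: Q_def\<close>)
  then have "recfn 4 (bounded_code Q p 1)" by simp
  then have "recfn 4 (\<lambda>xs. opt_code (bounded_run (q (xs ! 3) (xs ! 1) (xs ! 2)) (xs ! 1) p [xs ! 0]))"
  proof (subst (asm) recfn_cong)
    fix xs :: "nat list" assume "length xs = 4"
    then obtain a b c d where xs: "xs = [a, b, c, d]" by (auto simp: length_Suc_conv eval_nat_numeral)
    have "opt_decode (opt_code o') = o'" for o' by (cases o') auto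
    then show "bounded_code Q p 1 xs = opt_code (bounded_run (q (xs ! 3) (xs ! 1) (xs ! 2)) (xs ! 1) p [xs ! 0])"
      by (simp add: bounded_code_def xs Q_def)
  qed
  then have "recfn k (\<lambda>xs. opt_code (bounded_run (q (m xs) (s xs) (c xs)) (s xs) p [x xs]))"
    by (rule recfn_comp4[where f = "\<lambda>x s c m. opt_code (bounded_run (q m s c) s p [x])"]) fact+
  then have "recpred k (\<lambda>xs. opt_code (bounded_run (q (m xs) (s xs) (c xs)) (s xs) p [x xs]) = Suc (i xs))"
    by (intro recpred_eq recfn_Suc assms)
  then show ?thesis by simp
qed

lemma recfn_tail_query: "recfn 4 (\<lambda>xs. opt_code (tail_query (xs ! 3) (xs ! 1) (xs ! 2) (xs ! 0)))"
proof -
  have "recfn 4 (\<lambda>xs. if xs ! 3 \<le> fst (prod_decode (xs ! 0)) \<and> snd (prod_decode (snd (prod_decode (xs ! 0)))) = 0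
      then if fst (prod_decode (xs ! 0)) < xs ! 1
        then Suc (of_bool (fst (prod_decode (snd (prod_decode (xs ! 0)))) = of_bool (bit (xs ! 2) (fst (prod_decode (xs ! 0))))))
        else 0
      else 1)"
    by (intro recfn_intros recfn_fst_prod_decode recfn_snd_prod_decode recpred_bit) simp_all
  then show ?thesis by (rule recfn_cong[THEN iffD1, rotated]) (simp add: tail_query_def)
qed

lemma recfn_real_query: "recfn 4 (\<lambda>xs. opt_code (real_query (xs ! 1) (xs ! 2) (xs ! 0)))"
proof -
  have "recfn 4 (\<lambda>xs. if xs ! 0 < xs ! 1 then Suc (of_bool (bit (xs ! 2) (xs ! 0))) else 0)"
    by (intro recfn_intros recpred_bit) simp_all
  then show ?thesis by (rule recfn_cong[THEN iffD1, rotated]) (simp add: real_query_def)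
qed

lemma tail_query_mono: "s \<le> s' \<Longrightarrow> extends (tail_query m s c) (tail_query m s' c)"
  by (auto simp: extends_def tail_query_def split: if_splits)

lemma tail_query_take_bit: "tail_query m s (take_bit s c) = tail_query m s c"
  by (auto simp: tail_query_def bit_take_bit_iff fun_eq_iff)

lemma real_query_mono: "s \<le> s' \<Longrightarrow> extends (real_query s c) (real_query s' c)"
  by (auto simp: extends_def real_query_def split: if_splits)

lemma real_query_take_bit: "real_query s (take_bit s c) = real_query s c"
  by (auto simp: real_query_def bit_take_bit_iff fun_eq_iff)

lemma tail_query_initial:
  "tail_query m s (initial C s) y =
     (if m \<le> fst (prod_decode y) \<and> snd (prod_decode (snd (prod_decode y))) = 0 \<and> s \<le> fst (prod_decode y)
      then None else Some (of_bool (y \<in> oracle_code (tail_oracle C m))))"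
  unfolding tail_oracle_code tail_query_def by auto

lemma tail_query_sound:
  "bounded_run (tail_query m s (initial C s)) s p xs = Some v \<Longrightarrow> run (oracle_code (tail_oracle C m)) p xs = Some v"
  by (rule bounded_run_sound) (auto simp: extends_def tail_query_initial split: if_splits)

lemma tail_query_complete:
  assumes "run (oracle_code (tail_oracle C m)) p xs = Some v"
  shows "\<exists>s. bounded_run (tail_query m s (initial C s)) s p xs = Some v"
proof (rule bounded_run_complete[OF _ _ assms])
  fix y show "\<exists>s. tail_query m s (initial C s) y = Some (of_bool (y \<in> oracle_code (tail_oracle C m)))"
    unfolding tail_query_initial by (intro exI[of _ "Suc (fst (prod_decode y))"]) simp
qed (auto simp: extends_def tail_query_initial split: if_splits)

lemma real_query_initial: "real_query s (initial C s) y = (if y < s then Some (of_bool (y \<in> C)) else None)"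
  by (auto simp: real_query_def)

lemma real_query_sound: "bounded_run (real_query s (initial C s)) s p xs = Some v \<Longrightarrow> run C p xs = Some v"
  by (rule bounded_run_sound) (auto simp: extends_def real_query_initial split: if_splits)

lemma real_query_complete: "run C p xs = Some v \<Longrightarrow> \<exists>s. bounded_run (real_query s (initial C s)) s p xs = Some v"
proof (rule bounded_run_complete)
  fix y show "\<exists>s. real_query s (initial C s) y = Some (of_bool (y \<in> C))"
    unfolding real_query_initial by (intro exI[of _ "Suc y"]) simp
qed (auto simp: extends_def real_query_initial split: if_splits)

text \<open>A partial computation never errs, so one answer at any place coding \<open>n\<close>
  settles \<open>n\<close>. This covers the cofinite and the generic case.\<close>

lemma tail_reduction:
  assumes A: "ml_random A" and col: "recpred 2 (\<lambda>xs. col (xs ! 0) (xs ! 1))"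
    and T: "\<And>x n. col x n \<Longrightarrow> x \<in> T \<longleftrightarrow> n \<in> B"
    and p: "\<And>m. partial_computation (oracle_code (tail_oracle A m)) p T"
    and dom: "\<And>m n. \<exists>x\<in>comp_dom (oracle_code (tail_oracle A m)) p. col x n"
  shows "computable B"
proof -
  define G where "G n i m s c \<longleftrightarrow> (\<exists>x<s. col x n \<and> bounded_run (tail_query m s c) s p [x] = Some i)" for n i m s c
  have "recpred k (\<lambda>xs. col (a xs) (b xs))" if "recfn k a" "recfn k b" for k a b
    using col that unfolding recpred_def by (rule recfn_comp2[where f = "\<lambda>x n. of_bool (col x n)"])
  note col' = this
  interpret coding_functional G A B
  proof
    show "recpred 5 (\<lambda>xs. G (xs ! 0) (xs ! 1) (xs ! 2) (xs ! 3) (xs ! 4))"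
      unfolding G_def
      by (intro recfn_intros col' recpred_bounded_run3 recfn_tail_query) simp_all
  next
    fix n i m s s' c assume "s \<le> s'" "G n i m s c"
    then show "G n i m s' c"
      unfolding G_def using bounded_run_mono[OF tail_query_mono] less_le_trans by meson
  next
    fix n i m s c show "G n i m s (take_bit s c) = G n i m s c"
      by (simp add: G_def tail_query_take_bit)
  next
    fix C :: "nat set" and n k
    assume "finite {x. (x \<in> A) \<noteq> (x \<in> C)}"
    then obtain m0 where "{x. (x \<in> A) \<noteq> (x \<in> C)} \<subseteq> {..<m0}" using finite_nat_bounded by blast
    then have m0: "x \<in> A \<longleftrightarrow> x \<in> C" if "m0 \<le> x" for x using that by (auto simp: subset_iff not_le)
    \<comment> \<open>From \<open>m0\<close> on, \<open>A\<close> and \<open>C\<close> have the same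
      tail oracle, so the reduction to \<open>A\<close> also speaks about \<open>C\<close>.\<close>
    define m where "m = max k m0"
    have eq: "tail_oracle C m = tail_oracle A m"
      using m0 by (auto simp: tail_oracle_def m_def)
    obtain x where x: "x \<in> comp_dom (oracle_code (tail_oracle C m)) p" "col x n"
      using dom[of m n] unfolding eq by blast
    then have "run (oracle_code (tail_oracle C m)) p [x] = Some (of_bool (n \<in> B))"
      using p[of m] T[OF x(2)] unfolding eq partial_computation_def by simp
    then obtain s where s: "bounded_run (tail_query m s (initial C s)) s p [x] = Some (of_bool (n \<in> B))"
      using tail_query_complete by blast
    define s' where "s' = max s (Suc x)"
    have "extends (tail_query m s (initial C s)) (tail_query m s' (initial C s'))"
      using tail_query_mono[of s s' m "initial C s'"] tail_query_take_bit[of m s "initial C s'"]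
      by (simp add: s'_def min_absorb1)
    then have "bounded_run (tail_query m s' (initial C s')) s' p [x] = Some (of_bool (n \<in> B))"
      by (rule bounded_run_mono[OF _ _ s]) (simp add: s'_def)
    then have "G n (of_bool (n \<in> B)) m s' (initial C s')"
      unfolding G_def using x(2) by (intro exI[of _ x]) (simp add: s'_def)
    then show "\<exists>m\<ge>k. \<exists>s. G n (of_bool (n \<in> B)) m s (initial C s)"
      by (intro exI[of _ m]) (auto simp: m_def)
  next
    have "\<not> G n (of_bool (n \<notin> B)) m s (initial A s)" for n m s
    proof
      assume "G n (of_bool (n \<notin> B)) m s (initial A s)"
      then obtain x where x: "col x n" "run (oracle_code (tail_oracle A m)) p [x] = Some (of_bool (n \<notin> B))"
        unfolding G_def using tail_query_sound by blast
      then show False using p[of m] T[OF x(1)] by (auto simp: partial_computation_def comp_dom_def)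
    qed
    then show "finite {n. \<exists>m s. G n (of_bool (n \<notin> B)) m s (initial A s)}" by simp
  qed (rule A)
  show ?thesis by (rule computable_B)
qed

text \<open>A total computation may err, so an answer counts only with a strict majority on the
  block of a place \<open>m\<close> in column \<open>n\<close>. The blocks are single points in the
  mod-finite case and dyadic intervals in the coarse case.\<close>

lemma majority_reduction:
  assumes A: "ml_random A" and lo: "recfn 1 (\<lambda>xs. lo (xs ! 0))" and hi: "recfn 1 (\<lambda>xs. hi (xs ! 0))"
    and T: "\<And>x j. lo j \<le> x \<Longrightarrow> x < hi j \<Longrightarrow> x \<in> T \<longleftrightarrow> j \<in> column_code B"
    and p: "\<And>C. finite {x. (x \<in> A) \<noteq> (x \<in> C)} \<Longrightarrow> \<exists>D. computes_real C p D \<and>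
      finite {j. 2 * card {x. x < hi j \<and> lo j \<le> x \<and> (x \<in> T \<longleftrightarrow> x \<in> D)} \<le> hi j - lo j}"
  shows "computable B"
proof -
  define G where "G n i m s c \<longleftrightarrow> in_column m n \<and> hi m - lo m <
      2 * card {x. x < hi m \<and> lo m \<le> x \<and> bounded_run (real_query s c) s p [x] = Some i}" for n i m s c
  have lo': "recfn k (\<lambda>xs. lo (a xs))" and hi': "recfn k (\<lambda>xs. hi (a xs))" if "recfn k a" for k a
    using recfn_comp1[OF lo that] recfn_comp1[OF hi that] .
  interpret coding_functional G A B
  proof
    show "recpred 5 (\<lambda>xs. G (xs ! 0) (xs ! 1) (xs ! 2) (xs ! 3) (xs ! 4))"
      unfolding G_def
      by (intro recfn_intros lo' hi' recpred_in_column
          recpred_bounded_run3[where q = "\<lambda>_. real_query" and m = "\<lambda>_. 0"] recfn_real_query) simp_all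
  next
    fix n i m s s' c assume ss: "s \<le> s'" and G: "G n i m s c"
    have "card {x. x < hi m \<and> lo m \<le> x \<and> bounded_run (real_query s c) s p [x] = Some i}
       \<le> card {x. x < hi m \<and> lo m \<le> x \<and> bounded_run (real_query s' c) s' p [x] = Some i}"
      by (intro card_mono) (auto intro: bounded_run_mono[OF real_query_mono[OF ss] ss])
    then show "G n i m s' c" using G unfolding G_def by linarith
  next
    fix n i m s c show "G n i m s (take_bit s c) = G n i m s c"
      by (simp add: G_def real_query_take_bit)
  next
    fix C :: "nat set" and n k
    assume "finite {x. (x \<in> A) \<noteq> (x \<in> C)}"
    from p[OF this] obtain D where D: "computes_real C p D"
      "finite {j. 2 * card {x. x < hi j \<and> lo j \<le> x \<and> (x \<in> T \<longleftrightarrow> x \<in> D)} \<le> hi j - lo j}" by blast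
    from in_column_large[OF D(2)] obtain m where m: "k \<le> m" "in_column m n"
      "hi m - lo m < 2 * card {x. x < hi m \<and> lo m \<le> x \<and> (x \<in> T \<longleftrightarrow> x \<in> D)}"
      by (auto simp: not_le)
    have "\<exists>s. bounded_run (real_query s (initial C s)) s p [x] = Some (of_bool (x \<in> D))" for x
      using D(1) real_query_complete unfolding computes_real_def by blast
    then obtain S where S: "\<And>x. bounded_run (real_query (S x) (initial C (S x))) (S x) p [x] = Some (of_bool (x \<in> D))"
      by metis
    define s where "s = Max (insert 0 (S ` {..<hi m}))"
    have "bounded_run (real_query s (initial C s)) s p [x] = Some (of_bool (x \<in> D))" if "x < hi m" for x
    proof -
      have le: "S x \<le> s" unfolding s_def using that by (intro Max_ge) auto
      have "extends (real_query (S x) (initial C (S x))) (real_query s (initial C s))"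
        using real_query_mono[OF le, of "initial C s"] real_query_take_bit[of "S x" "initial C s"] le
        by (simp add: min_absorb1)
      then show ?thesis by (rule bounded_run_mono[OF _ le S])
    qed
    then have "card {x. x < hi m \<and> lo m \<le> x \<and> (x \<in> T \<longleftrightarrow> x \<in> D)}
      \<le> card {x. x < hi m \<and> lo m \<le> x \<and> bounded_run (real_query s (initial C s)) s p [x] = Some (of_bool (n \<in> B))}"
      using T[of m] in_column_code[OF m(2), of B] by (intro card_mono) auto
    then have "G n (of_bool (n \<in> B)) m s (initial C s)"
      using m unfolding G_def by linarith
    then show "\<exists>m\<ge>k. \<exists>s. G n (of_bool (n \<in> B)) m s (initial C s)" using m(1) by blast
  next
    have "finite {x. (x \<in> A) \<noteq> (x \<in> A)}" by simp
    from p[OF this] obtain D where D: "computes_real A p D"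
      "finite {j. 2 * card {x. x < hi j \<and> lo j \<le> x \<and> (x \<in> T \<longleftrightarrow> x \<in> D)} \<le> hi j - lo j}" (is "finite ?bad") by blast
    \<comment> \<open>A strict majority for the wrong value makes the block \<open>m\<close> bad,
      and \<open>n\<close> is at most \<open>m\<close>.\<close>
    have "{n. \<exists>m s. G n (of_bool (n \<notin> B)) m s (initial A s)} \<subseteq> (\<Union>m\<in>?bad. {..m})"
    proof
      fix n assume "n \<in> {n. \<exists>m s. G n (of_bool (n \<notin> B)) m s (initial A s)}"
      then obtain m s where m: "in_column m n" and less: "hi m - lo m <
          2 * card {x. x < hi m \<and> lo m \<le> x \<and> bounded_run (real_query s (initial A s)) s p [x] = Some (of_bool (n \<notin> B))}"
        unfolding G_def by blast
      have "x \<in> D \<longleftrightarrow> n \<notin> B"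
        if "bounded_run (real_query s (initial A s)) s p [x] = Some (of_bool (n \<notin> B))" for x
      proof -
        have "Some (of_bool (n \<notin> B)) = (Some (of_bool (x \<in> D)) :: nat option)"
          using real_query_sound[OF that] D(1) unfolding computes_real_def by metis
        then show ?thesis unfolding option.inject of_bool_eq_iff by blast
      qed
      then have "card {x. x < hi m \<and> lo m \<le> x \<and> bounded_run (real_query s (initial A s)) s p [x] = Some (of_bool (n \<notin> B))}
          \<le> card {x. x < hi m \<and> lo m \<le> x \<and> (x \<in> T \<longleftrightarrow> x \<notin> D)}"
        using T[of m] in_column_code[OF m, of B] by (intro card_mono) auto
      moreover have "card {x. x < hi m \<and> lo m \<le> x \<and> (x \<in> T \<longleftrightarrow> x \<in> D)}
          + card {x. x < hi m \<and> lo m \<le> x \<and> (x \<in> T \<longleftrightarrow> x \<notin> D)} = hi m - lo m"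
      proof -
        have "{x. x < hi m \<and> lo m \<le> x \<and> (x \<in> T \<longleftrightarrow> x \<in> D)} \<union> {x. x < hi m \<and> lo m \<le> x \<and> (x \<in> T \<longleftrightarrow> x \<notin> D)} = {lo m..<hi m}"
          by auto
        then show ?thesis by (subst card_Un_disjoint[symmetric]) auto
      qed
      ultimately have "m \<in> ?bad" using less by simp
      then show "n \<in> (\<Union>m\<in>?bad. {..m})" using in_column_le[OF m] by blast
    qed
    then show "finite {n. \<exists>m s. G n (of_bool (n \<notin> B)) m s (initial A s)}"
      by (rule finite_subset) (use D(2) in auto)
  qed (rule A)
  show ?thesis by (rule computable_B)
qed

section \<open>Sets of density 1\<close>

lemma density1_cofinite:
  assumes "finite (- X)" shows "density1 X"
  unfolding density1_def
proof (rule tendsto_sandwich)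
  define K where "K = card (- X)"
  show "(\<lambda>n. 1 - real K / real n) \<longlonglongrightarrow> 1"
    using tendsto_diff[OF tendsto_const lim_const_over_n, of 1 "real K"] by simp
  have "real n - real K \<le> real (card (X \<inter> {..<n}))" for n
  proof -
    have "card {..<n} \<le> card (X \<inter> {..<n} \<union> - X)" using assms by (intro card_mono) auto
    also have "\<dots> \<le> card (X \<inter> {..<n}) + K" unfolding K_def by (rule card_Un_le)
    finally show ?thesis by simp
  qed
  then have *: "(real n - real K) / real n \<le> real (card (X \<inter> {..<n})) / real n" for n
    by (rule divide_right_mono) simp
  show "\<forall>\<^sub>F n in sequentially. 1 - real K / real n \<le> real (card (X \<inter> {..<n})) / real n"
  proof (rule eventually_sequentiallyI)
    fix n :: nat assume "1 \<le> n"
    then have "1 - real K / real n = (real n - real K) / real n" by (simp add: diff_divide_distrib)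
    then show "1 - real K / real n \<le> real (card (X \<inter> {..<n})) / real n" using *[of n] by simp
  qed
  have "card (X \<inter> {..<n}) \<le> n" for n using card_mono[of "{..<n}" "X \<inter> {..<n}"] by simp
  then show "\<forall>\<^sub>F n in sequentially. real (card (X \<inter> {..<n})) / real n \<le> 1"
    by (intro eventually_sequentiallyI[of 1]) (simp add: field_simps)
qed simp

text \<open>The fraction 7/8 serves twice: being above 3/4 it gives majorities on dyadic intervals,
  and its error rate 1/8 is small enough for the counting of predictions.\<close>

lemma density1_large:
  assumes "density1 X" shows "\<exists>N. \<forall>n\<ge>N. 7 * n \<le> 8 * card (X \<inter> {..<n})"
proof -
  have "\<forall>\<^sub>F n in sequentially. 7 / 8 < real (card (X \<inter> {..<n})) / real n"
    using assms unfolding density1_def by (rule order_tendstoD) simp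
  then obtain N where N: "\<And>n. N \<le> n \<Longrightarrow> 7 / 8 < real (card (X \<inter> {..<n})) / real n"
    by (auto simp: eventually_sequentially)
  have "7 * n \<le> 8 * card (X \<inter> {..<n})" if "N \<le> n" for n
  proof (cases "n = 0")
    case False
    then have "real (7 * n) < real (8 * card (X \<inter> {..<n}))" using N[OF that] by (simp add: field_simps)
    then show ?thesis by (simp only: of_nat_less_iff)
  qed simp
  then show ?thesis by blast
qed

text \<open>The interval is half of the numbers below \<open>2 ^ (j + 1)\<close>. Even if all
  smaller numbers lie in \<open>X\<close>, at least 3/4 of the interval must.\<close>

lemma density1_dyadic:
  assumes "density1 X"
  shows "finite {j. 2 * card {x. x < 2 ^ (j + 1) \<and> 2 ^ j \<le> x \<and> x \<in> X} \<le> 2 ^ (j + 1) - 2 ^ j}"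
proof -
  obtain N where N: "\<And>n. N \<le> n \<Longrightarrow> 7 * n \<le> 8 * card (X \<inter> {..<n})" using density1_large[OF assms] by blast
  have "2 ^ (j + 1) - 2 ^ j < 2 * card {x. x < 2 ^ (j + 1) \<and> 2 ^ j \<le> x \<and> x \<in> X}" if "N \<le> j" for j
  proof -
    have "j < 2 ^ (j + 1)" using less_exp[of "j + 1"] by linarith
    then have "7 * 2 ^ (j + 1) \<le> 8 * card (X \<inter> {..<2 ^ (j + 1)})" using N[of "2 ^ (j + 1)"] that by simp
    moreover have "card (X \<inter> {..<2 ^ (j + 1)}) \<le> card ({..<2 ^ j} \<union> {x. x < 2 ^ (j + 1) \<and> 2 ^ j \<le> x \<and> x \<in> X})"
      by (intro card_mono) auto
    moreover have "\<dots> \<le> card {..<(2::nat) ^ j} + card {x. x < 2 ^ (j + 1) \<and> 2 ^ j \<le> x \<and> x \<in> X}"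
      by (rule card_Un_le)
    moreover have "(0::nat) < 2 ^ j" "(2::nat) ^ (j + 1) = 2 * 2 ^ j" by simp_all
    ultimately show ?thesis unfolding card_lessThan by linarith
  qed
  then have "{j. 2 * card {x. x < 2 ^ (j + 1) \<and> 2 ^ j \<le> x \<and> x \<in> X} \<le> 2 ^ (j + 1) - 2 ^ j} \<subseteq> {..<N}"
    unfolding subset_iff mem_Collect_eq lessThan_iff by (meson not_le)
  then show ?thesis by (rule finite_subset) simp
qed

lemma generic_tail_oracle: "generic_oracle A (tail_oracle A m)"
  using cofinite_tail_oracle density1_cofinite by (auto simp: generic_oracle_def cofinite_oracle_def)

section \<open>Computability of the coded real, for each reducibility\<close>

lemma computable_if_column_code_cofinite_le:
  assumes "ml_random A" "cofinite_le (column_code B) A" shows "computable B"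
proof -
  obtain p where p: "\<And>m. partial_computation (oracle_code (tail_oracle A m)) p (column_code B)"
    "\<And>m. finite (- comp_dom (oracle_code (tail_oracle A m)) p)"
    using assms(2) cofinite_tail_oracle unfolding cofinite_le_def by blast
  show ?thesis
  proof (rule tail_reduction[OF assms(1) _ _ p(1), where col = in_column])
    show "recpred 2 (\<lambda>xs. in_column (xs ! 0) (xs ! 1))"
      by (intro recpred_in_column recfn_intros) simp_all
    fix m n
    show "\<exists>x\<in>comp_dom (oracle_code (tail_oracle A m)) p. in_column x n"
      using in_column_large[OF p(2)[of m], of 0 n] by auto
  qed (rule in_column_code)
qed

lemma computable_if_interval_code_generic_le:
  assumes "ml_random A" "generic_le (interval_code (column_code B)) A" shows "computable B"
proof -
  obtain p where p: "\<And>m. partial_computation (oracle_code (tail_oracle A m)) p (interval_code (column_code B))"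
    "\<And>m. density1 (comp_dom (oracle_code (tail_oracle A m)) p)"
    using assms(2) generic_tail_oracle unfolding generic_le_def by blast
  \<comment> \<open>The places coding \<open>n\<close> are now all points of the intervals whose
    index lies in column \<open>n\<close>.\<close>
  define col where "col x n \<longleftrightarrow> (\<exists>j<Suc x. 2 ^ j \<le> x \<and> x < 2 ^ (j + 1) \<and> in_column j n)" for x n
  show ?thesis
  proof (rule tail_reduction[OF assms(1), where col = col and p = p])
    show "recpred 2 (\<lambda>xs. col (xs ! 0) (xs ! 1))"
      unfolding col_def by (intro recfn_intros recpred_in_column) simp_all
    show "x \<in> interval_code (column_code B) \<longleftrightarrow> n \<in> B" if "col x n" for x n
      using that interval_code_iff in_column_code unfolding col_def by blast
    fix m n
    obtain j where j: "in_column j n"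
      "\<not> 2 * card {x. x < 2 ^ (j + 1) \<and> 2 ^ j \<le> x \<and> x \<in> comp_dom (oracle_code (tail_oracle A m)) p} \<le> 2 ^ (j + 1) - 2 ^ j"
      using in_column_large[OF density1_dyadic[OF p(2)[of m]], of 0 n] by blast
    then have "{x. x < 2 ^ (j + 1) \<and> 2 ^ j \<le> x \<and> x \<in> comp_dom (oracle_code (tail_oracle A m)) p} \<noteq> {}"
      by (metis card.empty mult_0_right zero_le)
    then obtain x where x: "x < 2 ^ (j + 1)" "2 ^ j \<le> x" "x \<in> comp_dom (oracle_code (tail_oracle A m)) p" by blast
    moreover have "j < Suc x" using x(2) less_exp[of j] by linarith
    ultimately show "\<exists>x\<in>comp_dom (oracle_code (tail_oracle A m)) p. col x n" using j(1) unfolding col_def by blast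
  qed (rule p)
qed

lemma computable_if_column_code_mod_finite_le:
  assumes "ml_random A" "mod_finite_le (column_code B) A" shows "computable B"
proof -
  obtain p where p: "\<And>C. finite {n. (n \<in> A) \<noteq> (n \<in> C)} \<Longrightarrow>
      \<exists>D. computes_real C p D \<and> finite {n. (n \<in> column_code B) \<noteq> (n \<in> D)}"
    using assms(2) unfolding mod_finite_le_def by blast
  show ?thesis
  proof (rule majority_reduction[OF assms(1), where lo = "\<lambda>j. j" and hi = Suc and p = p])
    fix C assume "finite {x. (x \<in> A) \<noteq> (x \<in> C)}"
    from p[OF this] obtain D where D: "computes_real C p D" "finite {n. (n \<in> column_code B) \<noteq> (n \<in> D)}" by blast
    \<comment> \<open>The block of \<open>j\<close> is the single point \<open>j\<close>, where a
      strict majority is agreement.\<close>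
    have "{x. x < Suc j \<and> j \<le> x \<and> (x \<in> column_code B \<longleftrightarrow> x \<in> D)} = {j}"
      if "j \<in> column_code B \<longleftrightarrow> j \<in> D" for j
      using that by (auto simp: less_Suc_eq)
    then have "\<not> 2 * card {x. x < Suc j \<and> j \<le> x \<and> (x \<in> column_code B \<longleftrightarrow> x \<in> D)} \<le> Suc j - j"
      if "j \<in> column_code B \<longleftrightarrow> j \<in> D" for j
      using that by simp
    then have "finite {j. 2 * card {x. x < Suc j \<and> j \<le> x \<and> (x \<in> column_code B \<longleftrightarrow> x \<in> D)} \<le> Suc j - j}"
      by (intro finite_subset[OF _ D(2)]) blast
    then show "\<exists>D. computes_real C p D
        \<and> finite {j. 2 * card {x. x < Suc j \<and> j \<le> x \<and> (x \<in> column_code B \<longleftrightarrow> x \<in> D)} \<le> Suc j - j}"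
      using D(1) by blast
  next
    fix x j :: nat assume "j \<le> x" "x < Suc j"
    then have "x = j" by simp
    then show "x \<in> column_code B \<longleftrightarrow> j \<in> column_code B" by simp
  qed (auto intro!: recfn_intros)
qed

lemma computable_if_interval_code_coarse_le:
  assumes "ml_random A" "coarse_le (interval_code (column_code B)) A" shows "computable B"
proof -
  obtain p where p: "\<And>C. density1 {n. n \<in> A \<longleftrightarrow> n \<in> C} \<Longrightarrow>
      \<exists>D. computes_real C p D \<and> density1 {n. n \<in> interval_code (column_code B) \<longleftrightarrow> n \<in> D}"
    using assms(2) unfolding coarse_le_def by blast
  show ?thesis
  proof (rule majority_reduction[OF assms(1), where lo = "\<lambda>j. 2 ^ j" and hi = "\<lambda>j. 2 ^ (j + 1)" and p = p])
    fix C assume fin: "finite {x. (x \<in> A) \<noteq> (x \<in> C)}"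
    have "- {n. n \<in> A \<longleftrightarrow> n \<in> C} = {x. (x \<in> A) \<noteq> (x \<in> C)}" by auto
    then have "density1 {n. n \<in> A \<longleftrightarrow> n \<in> C}" using density1_cofinite[of "{n. n \<in> A \<longleftrightarrow> n \<in> C}"] fin by simp
    from p[OF this] obtain D where D: "computes_real C p D"
      "density1 {n. n \<in> interval_code (column_code B) \<longleftrightarrow> n \<in> D}" by blast
    from density1_dyadic[OF D(2)] D(1)
    show "\<exists>D. computes_real C p D \<and> finite {j. 2 * card {x. x < 2 ^ (j + 1) \<and> 2 ^ j \<le> x
        \<and> (x \<in> interval_code (column_code B) \<longleftrightarrow> x \<in> D)} \<le> 2 ^ (j + 1) - 2 ^ j}"
      by auto
  next
    show "recfn 1 (\<lambda>xs. 2 ^ (xs ! 0))" "recfn 1 (\<lambda>xs. 2 ^ (xs ! 0 + 1))"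
      by (intro recfn_intros; simp)+
  qed (rule interval_code_iff)
qed


section \<open>Random reals are unpredictable\<close>

lemma sum_lessThan_double:
  fixes F :: "nat \<Rightarrow> nat"
  shows "(\<Sum>c<2 * m. F c) = (\<Sum>c<m. F c) + (\<Sum>c<m. F (m + c))"
proof -
  have "(\<Sum>c<m + l. F c) = (\<Sum>c<m. F c) + (\<Sum>c<l. F (m + c))" for l
    by (induction l) auto
  from this[of m] show ?thesis by (simp add: mult_2)
qed

lemma bit_add_power:
  fixes c j x :: nat
  assumes "c < 2 ^ j" "x \<le> j"
  shows "bit (2 ^ j + c) x \<longleftrightarrow> x = j \<or> bit c x"
proof -
  have "bit (c + 2 ^ j * (2 ^ j div 2 ^ j)) x \<longleftrightarrow> (if x < j then bit c x else bit ((2::nat) ^ j) x)"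
    by (rule bit_splice[OF assms(1)])
  then show ?thesis using assms(2) by (auto simp: add.commute bit_exp_iff)
qed

lemma not_bit_self: "c < 2 ^ j \<Longrightarrow> \<not> bit (c :: nat) j"
  by (simp add: bit_iff_odd)

text \<open>The distributive law: expanding the product chooses each bit freely. Up to normalization
  it computes the mean of a product of independent weights.\<close>

lemma sum_prod_bits:
  fixes w :: "nat \<Rightarrow> bool \<Rightarrow> nat"
  shows "(\<Sum>c<2 ^ j. \<Prod>x<j. w x (bit (c :: nat) x)) = (\<Prod>x<j. w x False + w x True)"
proof (induction j)
  case (Suc j)
  have "(\<Sum>c<2 ^ Suc j. \<Prod>x<Suc j. w x (bit (c :: nat) x))
      = (\<Sum>c<2 ^ j. \<Prod>x<Suc j. w x (bit (c :: nat) x)) + (\<Sum>c<2 ^ j. \<Prod>x<Suc j. w x (bit (2 ^ j + c :: nat) x))"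
    unfolding power_Suc by (rule sum_lessThan_double)
  also have "(\<Sum>c<2 ^ j. \<Prod>x<Suc j. w x (bit (c :: nat) x)) = (\<Sum>c<2 ^ j. (\<Prod>x<j. w x (bit (c :: nat) x)) * w j False)"
    by (intro sum.cong refl) (auto simp: not_bit_self)
  also have "(\<Sum>c<2 ^ j. \<Prod>x<Suc j. w x (bit (2 ^ j + c :: nat) x)) = (\<Sum>c<2 ^ j. (\<Prod>x<j. w x (bit (c :: nat) x)) * w j True)"
    by (intro sum.cong refl) (auto simp: bit_add_power intro!: prod.cong)
  finally show ?case by (simp add: Suc.IH flip: sum_distrib_right) (simp add: algebra_simps)
qed simp

text \<open>A value 0 of \<open>g x\<close> means no prediction and \<open>Suc b\<close> predicts
  the bit \<open>b\<close>, in agreement with \<open>opt_code\<close>.\<close>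

definition predicted :: "(nat \<Rightarrow> nat) \<Rightarrow> nat \<Rightarrow> nat set" where
  "predicted g s = {x. x < s \<and> g x \<noteq> 0}"

definition mistakes :: "(nat \<Rightarrow> nat) \<Rightarrow> nat \<Rightarrow> nat \<Rightarrow> nat set" where
  "mistakes g s c = {x. x < s \<and> g x \<noteq> 0 \<and> g x \<noteq> Suc (of_bool (bit c x))}"

lemma finite_predicted [simp]: "finite (predicted g s)"
  and finite_mistakes [simp]: "finite (mistakes g s c)"
  by (simp_all add: predicted_def mistakes_def)

text \<open>Markov's inequality for the weight \<open>3\<close> to the number of correct predictions.\<close>

lemma card_few_mistakes:
  assumes "8 * m \<le> card (predicted g s)"
  shows "card {c. c < 2 ^ s \<and> 8 * card (mistakes g s c) \<le> card (predicted g s)} * 2 ^ m \<le> 2 ^ s"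
proof -
  define d where "d = card (predicted g s)"
  define q where "q = d div 8"
  define r where "r = d mod 8"
  have d: "d = 8 * q + r" by (simp add: q_def r_def)
  \<comment> \<open>A correct prediction triples the weight. The mean over a fair bit grows by at
    most \<open>(3 + 1) / 2 = 2\<close> per prediction, whereas few mistakes mean a weight near
    \<open>3 ^ d\<close>.\<close>
  define w :: "nat \<Rightarrow> bool \<Rightarrow> nat" where "w x b = (if g x = Suc (of_bool b) then 3 else 1)" for x b
  have weight: "(\<Prod>x<s. w x (bit c x)) = 3 ^ (d - card (mistakes g s c))" for c
  proof -
    have "(\<Prod>x<s. w x (bit c x)) = 3 ^ card ({..<s} \<inter> {x. g x = Suc (of_bool (bit c x))})"
      unfolding w_def by (subst prod.If_cases) simp_all
    moreover have "card ({..<s} \<inter> {x. g x = Suc (of_bool (bit c x))}) = d - card (mistakes g s c)"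
    proof -
      have "{..<s} \<inter> {x. g x = Suc (of_bool (bit c x))} = predicted g s - mistakes g s c"
        by (auto simp: predicted_def mistakes_def)
      moreover have "mistakes g s c \<subseteq> predicted g s" by (auto simp: predicted_def mistakes_def)
      ultimately show ?thesis by (simp add: card_Diff_subset d_def)
    qed
    ultimately show ?thesis by simp
  qed
  have "card {c. c < 2 ^ s \<and> 8 * card (mistakes g s c) \<le> d} * 3 ^ (d - q)
      = (\<Sum>c\<in>{c. c < 2 ^ s \<and> 8 * card (mistakes g s c) \<le> d}. 3 ^ (d - q))" by simp
  also have "\<dots> \<le> (\<Sum>c\<in>{c. c < 2 ^ s \<and> 8 * card (mistakes g s c) \<le> d}. \<Prod>x<s. w x (bit c x))"
  proof (rule sum_mono)
    fix c assume "c \<in> {c. c < 2 ^ s \<and> 8 * card (mistakes g s c) \<le> d}"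
    then have "8 * card (mistakes g s c) \<le> d" by simp
    then have "card (mistakes g s c) \<le> q" unfolding q_def by linarith
    then show "3 ^ (d - q) \<le> (\<Prod>x<s. w x (bit c x))" unfolding weight by (intro power_increasing) auto
  qed
  also have "\<dots> \<le> (\<Sum>c<2 ^ s. \<Prod>x<s. w x (bit (c :: nat) x))" by (intro sum_mono2) auto
  also have "\<dots> = (\<Prod>x<s. w x False + w x True)" by (rule sum_prod_bits)
  also have "\<dots> \<le> (\<Prod>x<s. 2 * (if g x \<noteq> 0 then 2 else 1))" by (intro prod_mono) (auto simp: w_def)
  also have "\<dots> = 2 ^ s * 2 ^ d"
  proof -
    have "{..<s} \<inter> {x. g x \<noteq> 0} = predicted g s" by (auto simp: predicted_def)
    then show ?thesis unfolding prod.distrib by (subst prod.If_cases) (simp_all add: d_def)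
  qed
  finally have "card {c. c < 2 ^ s \<and> 8 * card (mistakes g s c) \<le> d} * 3 ^ (d - q) * 2 ^ m \<le> 2 ^ s * 2 ^ d * 2 ^ m"
    by (rule mult_le_mono1)
  also have "\<dots> \<le> 2 ^ s * 3 ^ (d - q)"
  proof -
    \<comment> \<open>With \<open>d = 8 * q + r\<close>, at most \<open>q\<close> mistakes leave
      weight at least \<open>3 ^ (7 * q + r)\<close>, against at most \<open>2 ^ (9 * q + r)\<close>
      for the mean times \<open>2 ^ m\<close>. The rate 1/8 works because \<open>2 ^ 9 = 512\<close>
      is below \<open>3 ^ 7 = 2187\<close>.\<close>
    have "m \<le> q" using assms unfolding q_def d_def by simp
    then have "(2::nat) ^ d * 2 ^ m \<le> 2 ^ (d + q)" unfolding power_add[symmetric] by (intro power_increasing) auto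
    also have "\<dots> = 512 ^ q * 2 ^ r"
    proof -
      have "(2::nat) ^ (d + q) = (2 ^ 9) ^ q * 2 ^ r" unfolding power_mult[symmetric] power_add[symmetric] by (simp add: d)
      then show ?thesis by simp
    qed
    also have "\<dots> \<le> 2187 ^ q * 3 ^ r" by (intro mult_le_mono power_mono) auto
    also have "\<dots> = 3 ^ (d - q)"
    proof -
      have "(3::nat) ^ (d - q) = (3 ^ 7) ^ q * 3 ^ r" unfolding power_mult[symmetric] power_add[symmetric] by (simp add: d)
      then show ?thesis by simp
    qed
    finally show ?thesis by simp
  qed
  finally have "3 ^ (d - q) * (card {c. c < 2 ^ s \<and> 8 * card (mistakes g s c) \<le> d} * 2 ^ m) \<le> 3 ^ (d - q) * 2 ^ s"
    by (simp add: mult_ac)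
  then show ?thesis unfolding d_def by simp
qed

text \<open>Level \<open>m\<close> of the test judges strings at one length only, the first with
  enough predictions, so a count at this length bounds the whole level. The first argument of
  \<open>g\<close> also acts as a time bound, since predictions may appear late.\<close>

lemma ml_random_unpredictable:
  assumes A: "ml_random A" and g: "recfn 2 (\<lambda>xs. g (xs ! 0) (xs ! 1))"
    and unbounded: "\<And>m. \<exists>s. m \<le> card (predicted (g s) s)"
    and good: "\<And>s. N \<le> card (predicted (g s) s) \<Longrightarrow> 8 * card (mistakes (g s) s (initial A s)) \<le> card (predicted (g s) s)"
  shows False
proof -
  \<comment> \<open>The multiple of 8 is what \<open>card_few_mistakes\<close> asks for; adding
    \<open>N\<close> keeps the judged length within the range of \<open>good\<close>.\<close>
  define big where "big m s \<longleftrightarrow> 8 * m + N \<le> card (predicted (g s) s)" for m s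
  define R where "R m s c \<longleftrightarrow> big m s \<and> (\<forall>s'<s. \<not> big m s') \<and> 8 * card (mistakes (g s) s c) \<le> card (predicted (g s) s)" for m s c
  have g': "recfn k (\<lambda>xs. g (a xs) (b xs))" if "recfn k a" "recfn k b" for k a b
    using g that by (rule recfn_comp2)
  have pred: "recfn k (\<lambda>xs. card (predicted (g (a xs)) (a xs)))" if "recfn k a" for k a
  proof (rule recfn_comp1[OF _ that])
    show "recfn 1 (\<lambda>xs. card (predicted (g (xs ! 0)) (xs ! 0)))"
      unfolding predicted_def by (intro recfn_intros g') simp_all
  qed
  have mist: "recfn k (\<lambda>xs. card (mistakes (g (a xs)) (a xs) (b xs)))" if "recfn k a" "recfn k b" for k a b
  proof (rule recfn_comp2[OF _ that])
    show "recfn 2 (\<lambda>xs. card (mistakes (g (xs ! 0)) (xs ! 0) (xs ! 1)))"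
      unfolding mistakes_def by (intro recfn_intros g' recpred_bit) simp_all
  qed
  have "\<exists>m. \<forall>s. \<not> R m s (initial A s)"
  proof (rule ml_random_avoids[OF A])
    show "recpred 3 (\<lambda>xs. R (xs ! 0) (xs ! 1) (xs ! 2))"
      unfolding R_def big_def by (intro recfn_intros pred mist) simp_all
    fix m s
    show "card {c. c < 2 ^ s \<and> has_prefix (R m) s c} * 2 ^ m \<le> 2 ^ s"
    proof (cases "\<exists>j\<le>s. big m j \<and> (\<forall>s'<j. \<not> big m s')")
      case True
      then obtain j where j: "j \<le> s" "big m j" "\<forall>s'<j. \<not> big m s'" by blast
      define V where "V c \<longleftrightarrow> 8 * card (mistakes (g j) j c) \<le> card (predicted (g j) j)" for c
      have "{c. c < 2 ^ s \<and> has_prefix (R m) s c} \<subseteq> {c. c < 2 ^ s \<and> V (c mod 2 ^ j) \<and> True}"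
      proof
        fix c assume "c \<in> {c. c < 2 ^ s \<and> has_prefix (R m) s c}"
        then obtain j' where c: "c < 2 ^ s" and j': "R m j' (take_bit j' c)" by (auto simp: has_prefix_def)
        have "j' = j" using j j' unfolding R_def by (meson linorder_neqE_nat)
        then show "c \<in> {c. c < 2 ^ s \<and> V (c mod 2 ^ j) \<and> True}"
          using c j' by (simp add: R_def V_def take_bit_eq_mod)
      qed
      then have "card {c. c < 2 ^ s \<and> has_prefix (R m) s c} * 2 ^ m \<le> card {c. c < 2 ^ s \<and> V (c mod 2 ^ j) \<and> True} * 2 ^ m"
        by (intro mult_le_mono1 card_mono) auto
      also have "\<dots> = card {c. c < 2 ^ j \<and> V c} * 2 ^ m * 2 ^ (s - j)"
        using card_mod_div_split[OF j(1), of V "\<lambda>_. True"] by simp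
      also have "\<dots> \<le> 2 ^ j * 2 ^ (s - j)"
        unfolding V_def by (intro mult_le_mono1 card_few_mistakes) (use j(2) in \<open>simp add: big_def\<close>)
      also have "\<dots> = 2 ^ s" using j(1) by (simp flip: power_add)
      finally show ?thesis .
    next
      case False
      then have "{c. c < 2 ^ s \<and> has_prefix (R m) s c} = {}" by (auto simp: has_prefix_def R_def)
      then show ?thesis by (metis card.empty mult_0 zero_le)
    qed
  qed
  then obtain m where m: "\<And>s. \<not> R m s (initial A s)" by blast
  define s where "s = (LEAST s. big m s)"
  have "\<exists>s. big m s" using unbounded unfolding big_def by blast
  then have "big m s" "\<forall>s'<s. \<not> big m s'"
    unfolding s_def using LeastI_ex not_less_Least by blast+
  moreover have "8 * card (mistakes (g s) s (initial A s)) \<le> card (predicted (g s) s)"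
    using \<open>big m s\<close> by (intro good) (simp add: big_def)
  ultimately show False using m[of s] by (simp add: R_def)
qed

section \<open>Random reals are not reducible to computable ones\<close>

lemma computable_subst_oracle:
  assumes "computable Z" shows "\<exists>p'. \<forall>xs. run {} p' xs = run Z p xs"
proof -
  obtain z where "\<And>n. run {} z [n] = Some (of_bool (n \<in> Z))" using assms unfolding computable_def by blast
  then have "run {} (subst_oracle z p) xs = run Z p xs" for xs by (rule run_subst_oracle)
  then show ?thesis by blast
qed

lemma computable_tail_oracle: "computable Z \<Longrightarrow> computable (oracle_code (tail_oracle Z m))"
  unfolding computable_iff_recpred tail_oracle_code
  by (intro recfn_intros recfn_fst_prod_decode recfn_snd_prod_decode recpred_mem)
    (simp_all add: computable_iff_recpred)

text \<open>Values found by bounded runs are predictions that are never wrong, and an infinite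
  domain supplies arbitrarily many.\<close>

lemma no_computable_partial:
  assumes A: "ml_random A" and p: "partial_computation X p A" "infinite (comp_dom X p)" and X: "computable X"
  shows False
proof -
  obtain p' where p': "\<And>xs. run {} p' xs = run X p xs" using computable_subst_oracle[OF X] by blast
  \<comment> \<open>The constant answer 0 is the empty oracle, which suffices once the computable
    oracle is compiled into \<open>p'\<close>.\<close>
  define g where "g s x = opt_code (bounded_run (\<lambda>_. Some 0) s p' [x])" for s x
  have g_Suc: "v = of_bool (x \<in> A)" if "g s x = Suc v" for s x v
  proof -
    have "bounded_run (\<lambda>_. Some 0) s p' [x] = Some v" using that by (simp add: g_def)
    then have "run {} p' [x] = Some v" by (rule bounded_run_sound[rotated]) (simp add: extends_def)
    then have "run X p [x] = Some v" by (simp add: p')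
    then show ?thesis using p(1) by (auto simp: partial_computation_def comp_dom_def)
  qed
  show False
  proof (rule ml_random_unpredictable[OF A, where g = g and N = 0])
    have "recfn (1 + 1) (bounded_code (\<lambda>_. 1) p' 1)" by (rule recfn_bounded_code) (simp_all add: recfn_const)
    then have "recfn 2 (bounded_code (\<lambda>_. 1) p' 1)" by (simp add: numeral_2_eq_2)
    then have "recfn 2 (\<lambda>xs. g (xs ! 1) (xs ! 0))"
    proof (rule recfn_cong[THEN iffD1, rotated])
      fix xs :: "nat list" assume "length xs = 2"
      then obtain a b where xs: "xs = [a, b]" by (auto simp: length_Suc_conv eval_nat_numeral)
      show "bounded_code (\<lambda>_. 1) p' 1 xs = g (xs ! 1) (xs ! 0)"
        by (simp add: bounded_code_def xs g_def)
    qed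
    then show "recfn 2 (\<lambda>xs. g (xs ! 0) (xs ! 1))"
      by (rule recfn_comp2[where f = "\<lambda>x s. g s x"]) (intro recfn_intros; simp)+
  next
    fix m
    obtain F where F: "F \<subseteq> comp_dom X p" "finite F" "card F = m"
      using infinite_arbitrarily_large[OF p(2)] by blast
    have "\<exists>s. g s x \<noteq> 0" if "x \<in> F" for x
    proof -
      have "run {} p' [x] \<noteq> None" using F(1) that by (auto simp: p' comp_dom_def)
      then obtain v where v: "run {} p' [x] = Some v" by blast
      have "\<exists>s. bounded_run (\<lambda>_. Some 0) s p' [x] = Some v"
        by (rule bounded_run_complete[where q = "\<lambda>_ _. Some 0", OF _ _ v]) (simp_all add: extends_def)
      then show ?thesis by (auto simp: g_def)
    qed
    then obtain S where S: "\<And>x. x \<in> F \<Longrightarrow> g (S x) x \<noteq> 0" by metis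
    define s where "s = Max (insert 0 ((\<lambda>x. max (S x) (Suc x)) ` F))"
    have "x \<in> predicted (g s) s" if x: "x \<in> F" for x
    proof -
      have "max (S x) (Suc x) \<le> s" unfolding s_def using that F(2) by (intro Max_ge) auto
      then have le: "S x \<le> s" "x < s" by auto
      obtain v where "bounded_run (\<lambda>_. Some 0) (S x) p' [x] = Some v" using S[OF x] by (auto simp: g_def)
      then have "bounded_run (\<lambda>_. Some 0) s p' [x] = Some v"
        by (rule bounded_run_mono[OF _ le(1), rotated]) (simp add: extends_def)
      then show ?thesis using le(2) by (simp add: predicted_def g_def)
    qed
    then have "card F \<le> card (predicted (g s) s)" by (intro card_mono) auto
    then show "\<exists>s. m \<le> card (predicted (g s) s)" using F(3) by blast
  next
    fix s
    have "mistakes (g s) s (initial A s) = {}"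
    proof -
      have *: "g s x = 0 \<or> g s x = Suc (of_bool (bit (initial A s) x))" if "x < s" for x
      proof (cases "g s x")
        case (Suc v)
        have "bit (initial A s) x = (x \<in> A)" using that by simp
        then show ?thesis unfolding Suc g_Suc[OF Suc] by simp
      qed simp
      have "x \<notin> mistakes (g s) s (initial A s)" for x
        unfolding mistakes_def mem_Collect_eq using *[of x] by argo
      then show ?thesis by (simp add: set_eq_iff)
    qed
    then show "8 * card (mistakes (g s) s (initial A s)) \<le> card (predicted (g s) s)" by simp
  qed
qed

text \<open>Here \<open>D\<close> predicts every bit, and density bounds the error rate by 1/8 from
  \<open>N\<close> on.\<close>

lemma no_computable_approximation:
  assumes A: "ml_random A" and D: "computable D" "density1 {n. n \<in> A \<longleftrightarrow> n \<in> D}"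
  shows False
proof -
  obtain N where N: "\<And>n. N \<le> n \<Longrightarrow> 7 * n \<le> 8 * card ({n. n \<in> A \<longleftrightarrow> n \<in> D} \<inter> {..<n})"
    using density1_large[OF D(2)] by blast
  define g :: "nat \<Rightarrow> nat \<Rightarrow> nat" where "g = (\<lambda>s x. Suc (of_bool (x \<in> D)))"
  have pred: "predicted (g s) s = {..<s}" for s by (auto simp: predicted_def g_def)
  show False
  proof (rule ml_random_unpredictable[OF A, where g = g and N = N])
    show "recfn 2 (\<lambda>xs. g (xs ! 0) (xs ! 1))"
      unfolding g_def by (intro recfn_intros recpred_mem D(1)) simp
    show "\<exists>s. m \<le> card (predicted (g s) s)" for m by (auto simp: pred)
  next
    fix s assume "N \<le> card (predicted (g s) s)"
    then have le: "7 * s \<le> 8 * card ({n. n \<in> A \<longleftrightarrow> n \<in> D} \<inter> {..<s})" using N[of s] by (simp add: pred)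
    have "mistakes (g s) s (initial A s) = {..<s} - {n. n \<in> A \<longleftrightarrow> n \<in> D} \<inter> {..<s}"
      by (auto simp: mistakes_def g_def)
    then have "card (mistakes (g s) s (initial A s)) = s - card ({n. n \<in> A \<longleftrightarrow> n \<in> D} \<inter> {..<s})"
      by (simp add: card_Diff_subset)
    then show "8 * card (mistakes (g s) s (initial A s)) \<le> card (predicted (g s) s)"
      using le by (simp add: pred)
  qed
qed

lemma density1_infinite: "density1 X \<Longrightarrow> infinite X"
proof
  assume X: "density1 X" "finite X"
  obtain j where "\<not> 2 * card {x. x < 2 ^ (j + 1) \<and> 2 ^ j \<le> x \<and> x \<in> X} \<le> 2 ^ (j + 1) - 2 ^ j" "Max (insert 0 X) \<le> j"
    \<comment> \<open>This supplies a late \<open>j\<close> outside the finite bad set; any column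
      would do.\<close>
    using in_column_large[OF density1_dyadic[OF X(1)], of "Max (insert 0 X)" 0] by blast
  then have "{x. x < 2 ^ (j + 1) \<and> 2 ^ j \<le> x \<and> x \<in> X} \<noteq> {}"
    by (metis card.empty mult_0_right zero_le)
  then obtain x where "2 ^ j \<le> x" "x \<in> X" by blast
  moreover have "x \<le> Max (insert 0 X)" using X(2) \<open>x \<in> X\<close> by simp
  moreover have "j < 2 ^ j" by (rule less_exp)
  ultimately show False using \<open>Max (insert 0 X) \<le> j\<close> by linarith
qed

lemma ml_random_not_generic_le:
  assumes "ml_random A" "computable Z" shows "\<not> generic_le A Z"
proof
  assume "generic_le A Z"
  then obtain p where "partial_computation (oracle_code (tail_oracle Z 0)) p A"
      "density1 (comp_dom (oracle_code (tail_oracle Z 0)) p)"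
    using generic_tail_oracle unfolding generic_le_def by blast
  then show False
    using no_computable_partial[OF assms(1)] density1_infinite computable_tail_oracle[OF assms(2)] by blast
qed

lemma ml_random_not_cofinite_le:
  assumes "ml_random A" "computable Z" shows "\<not> cofinite_le A Z"
proof
  assume "cofinite_le A Z"
  then obtain p where "partial_computation (oracle_code (tail_oracle Z 0)) p A"
      "finite (- comp_dom (oracle_code (tail_oracle Z 0)) p)"
    using cofinite_tail_oracle unfolding cofinite_le_def by blast
  then show False
    using no_computable_partial[OF assms(1)] density1_infinite density1_cofinite
      computable_tail_oracle[OF assms(2)] by blast
qed

lemma computable_computes_real:
  assumes "computable Z" "computes_real Z p D" shows "computable D"
proof -
  obtain p' where "\<And>xs. run {} p' xs = run Z p xs" using computable_subst_oracle[OF assms(1)] by blast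
  then show ?thesis using assms(2) unfolding computable_def computes_real_def by metis
qed

lemma ml_random_not_coarse_le:
  assumes "ml_random A" "computable Z" shows "\<not> coarse_le A Z"
proof
  assume "coarse_le A Z"
  moreover have "density1 {n. n \<in> Z \<longleftrightarrow> n \<in> Z}" by (rule density1_cofinite) simp
  ultimately obtain p D where "computes_real Z p D" "density1 {n. n \<in> A \<longleftrightarrow> n \<in> D}"
    unfolding coarse_le_def by blast
  then show False
    using no_computable_approximation[OF assms(1)] computable_computes_real[OF assms(2)] by blast
qed

lemma ml_random_not_mod_finite_le:
  assumes "ml_random A" "computable Z" shows "\<not> mod_finite_le A Z"
proof
  assume "mod_finite_le A Z"
  moreover have "finite {n. (n \<in> Z) \<noteq> (n \<in> Z)}" by simp
  ultimately obtain p D where D: "computes_real Z p D" "finite {n. (n \<in> A) \<noteq> (n \<in> D)}"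
    unfolding mod_finite_le_def by blast
  have "- {n. n \<in> A \<longleftrightarrow> n \<in> D} = {n. (n \<in> A) \<noteq> (n \<in> D)}" by auto
  then have "density1 {n. n \<in> A \<longleftrightarrow> n \<in> D}" using D(2) density1_cofinite by metis
  then show False
    using no_computable_approximation[OF assms(1)] computable_computes_real[OF assms(2) D(1)] by blast
qed

theorem proposition5p4:
  fixes A :: "nat set"
  assumes "ml_random A"
  shows "quasiminimal Cofinite A \<and> quasiminimal Mod_Finite A
    \<and> quasiminimal Generic A \<and> quasiminimal Coarse A"
  unfolding quasiminimal_def red_le.simps turing_embed.simps
  using assms ml_random_not_cofinite_le ml_random_not_mod_finite_le ml_random_not_generic_le
    ml_random_not_coarse_le computable_if_column_code_cofinite_le computable_if_column_code_mod_finite_le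
    computable_if_interval_code_generic_le computable_if_interval_code_coarse_le
  by blast

end
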